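(* Consider the maximum likelihood estimators $\hat\beta_n$ and $\hat h_n$ of $\beta$ and $h$ in the $p$-spin Curie–Weiss model with parameters $(\beta,h)$, with $A$, $R_1,R_2,R_3$, $\tilde\beta_p$ as in the context. The following convergences in law hold as $n\to\infty$. (ia) If $(\beta,h)\in R_1$, then $\sqrt n(\hat h_n-h)\to N(0,\sigma_h)$ with $\sigma_h$ a positive constant. (ib) If $(\beta,h)\in R_1\setminus\{(\beta,0):\beta\le\tilde\beta_p\}$, then $\sqrt n(\hat\beta_n-\beta)\to N(0,\sigma_\beta)$ with $\sigma_\beta$ a positive constant. (iia) If $(\beta,h)\in R_2$, then $\sqrt n(\hat h_n-h)\to U_h$, where $U_h=p_h^-N^-(0,\sigma_h^-)+p_h^+N^+(0,\sigma_h^+)+(1-p_h^--p_h^+)\delta_0$ (a mixture of laws) with $p_h^\pm,\sigma_h^\pm$ positive constants. (iib) If $(\beta,h)\in R_2\setminus\{(\tilde\beta_p,0)\}$, then $\sqrt n(\hat\beta_n-\beta)\to U_\beta$, where $U_\beta=p_\beta^-N^-(0,\sigma_\beta^-)+p_\beta^+N^+(0,\sigma_\beta^+)+(1-p_\beta^--p_\beta^+)\delta_0$ (a mixture of laws) with $p_\beta^\pm,\sigma_\beta^\pm$ positive constants. (iii) If $(\beta,h)\in R_3$, then $n^{3/4}(\hat\beta_n-\beta)\to Z_\beta$ and $n^{3/4}(\hat h_n-h)\to Z_h$, where for $\nu\in\{\beta,h\}$ the random variable $Z_\nu$ has the distribution $\mathbb P[Z_\nu\le t]=\mathbb P[Y_\nu(0)\le\mathbb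 EY_\nu(t)]$, where $Y_\nu(t)$ has density proportional to $\exp\big(c_*y^4+tf_\nu'(a_* )y\big)$, with $c_*=A^{(4)}(a_* )/24$, $f_\beta(a)=(2a-1)^p$ and $f_h(a)=2a-1$.
   Context: Let $p\in\mathbb N$ be the order of the spin interaction, and let $\beta>0$ and $h\in\mathbb R$ be parameters. For $\omega\in\{1,-1\}^n$ let $\bar\omega_+=|\{i:\omega_i=1\}|/n$. Let $I(a)=-a\log a-(1-a)\log(1-a)$ on $[0,1]$ ($0\log0=0$), $f_{\beta,h}(a)=\beta(2a-1)^p+h(2a-1)$, $A=A_{\beta,h}=f_{\beta,h}+I$. The $p$-spin Curie–Weiss measure is $\mu_n(\omega)\propto\exp(nf_{\beta,h}(\bar\omega_+))$ on $\{1,-1\}^n$. MLEs: each parameter is estimated from one sample $\omega\sim\mu_n$ with the other known; $\hat\beta_n$ is the solution $\gamma$ of $\mathbb E_{\gamma,h}[f_\beta(\bar\omega_+)]=f_\beta(\bar\omega_+)$ and $\hat h_n$ the solution $\gamma$ of $\mathbb E_{\beta,\gamma}[f_h(\bar\omega_+)]=f_h(\bar\omega_+)$, where $\mathbb E_{\beta,h}$ is expectation under the measure with parameters $(\beta,h)$, $f_\beta(a)=(2a-1)^p$, $f_h(a)=2a-1$. A maximizer $a$ of $A$ is $2m$-regular if $A^{(k)}(a)=0$ for $1\le k\le2m-1$ and $A^{(2m)}(a)<0$. As recalled in the paper from earlier work, the parameter space $(0,\infty)\times\mathbb R$ is partitioned into disjoint regions: $R_1$, where $A$ has a unique maximizer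 $a_*\in(0,1)$ and it is 2-regular; $R_2$, where $A$ has multiple maximizers in $(0,1)$ (in this case all are 2-regular); $R_3$, where $A$ has a unique maximizer $a_*\in(0,1)$ with $A''(a_* )=0$ (in this case $a_*$ is 4-regular). $\tilde\beta_p=\sup\{\beta\ge0:\sup_{a\in[0,1]}A_{\beta,0}(a)=\log2\}$. $N(0,\sigma)$ is the centered normal law with variance $\sigma$; $N^+(0,\sigma)$ and $N^-(0,\sigma)$ are the laws of $|Z|$ and $-|Z|$ with $Z\sim N(0,\sigma)$; $\delta_0$ is the point mass at $0$.
   Formalization: In (iii) the printed law of Z_β is used only if f_β'(a_* )>0; if f_β'(a_* )<0 it is replaced by P[Z_β≤t]=P[Y_β(0)≥E Y_β(t)]; if f_β'(a_* )=0 (p=2, (β,h)=(1/2,0)) nothing is claimed on β̂_n, as there the printed formula is not a distribution function. *)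

theory Defs
  imports "HOL-Probability.Probability"
begin

section \<open>The variational problem\<close>

definition f_beta :: "nat \<Rightarrow> real \<Rightarrow> real" where
  "f_beta p a = (2 * a - 1) ^ p"

definition f_h :: "real \<Rightarrow> real" where
  "f_h a = 2 * a - 1"

definition f_cw :: "nat \<Rightarrow> real \<Rightarrow> real \<Rightarrow> real \<Rightarrow> real" where
  "f_cw p \<beta> h a = \<beta> * f_beta p a + h * f_h a"

text \<open>The convention \<open>0 log 0 = 0\<close> is automatic. The functions \<open>I_ent\<close> and \<open>A_cw\<close> are only
  meaningful on the interval \<open>[0,1]\<close>; maximizers are taken over that interval, and derivatives
  only at interior points.\<close>

definition I_ent :: "real \<Rightarrow> real" where
  "I_ent a = - a * ln a - (1 - a) * ln (1 - a)"

definition A_cw :: "nat \<Rightarrow> real \<Rightarrow> real \<Rightarrow> real \<Rightarrow> real" where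
  "A_cw p \<beta> h a = f_cw p \<beta> h a + I_ent a"

definition maximizers :: "nat \<Rightarrow> real \<Rightarrow> real \<Rightarrow> real set" where
  "maximizers p \<beta> h = {a \<in> {0..1}. \<forall>b \<in> {0..1}. A_cw p \<beta> h b \<le> A_cw p \<beta> h a}"

definition even_regular :: "nat \<Rightarrow> real \<Rightarrow> real \<Rightarrow> nat \<Rightarrow> real \<Rightarrow> bool" where
  "even_regular p \<beta> h m a \<longleftrightarrow>
     (\<forall>k \<in> {1..2 * m - 1}. (deriv ^^ k) (A_cw p \<beta> h) a = 0) \<and>
     (deriv ^^ (2 * m)) (A_cw p \<beta> h) a < 0"

text \<open>That the maximizers are 2-regular in \<open>R2\<close> and 4-regular in \<open>R3\<close> is a consequence of these
  definitions, not part of them.\<close>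

definition R1 :: "nat \<Rightarrow> (real \<times> real) set" where
  "R1 p = {(\<beta>, h). \<beta> > 0 \<and>
     (\<exists>a \<in> {0<..<1}. maximizers p \<beta> h = {a} \<and> even_regular p \<beta> h 1 a)}"

definition R2 :: "nat \<Rightarrow> (real \<times> real) set" where
  "R2 p = {(\<beta>, h). \<beta> > 0 \<and>
     (\<exists>a \<in> {0<..<1}. \<exists>b \<in> {0<..<1}. a \<noteq> b \<and> a \<in> maximizers p \<beta> h \<and> b \<in> maximizers p \<beta> h)}"

definition R3 :: "nat \<Rightarrow> (real \<times> real) set" where
  "R3 p = {(\<beta>, h). \<beta> > 0 \<and>
     (\<exists>a \<in> {0<..<1}. maximizers p \<beta> h = {a} \<and> (deriv ^^ 2) (A_cw p \<beta> h) a = 0)}"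

definition beta_tilde :: "nat \<Rightarrow> real" where
  "beta_tilde p = Sup {\<beta>. \<beta> \<ge> 0 \<and> (SUP a \<in> {0..1}. A_cw p \<beta> 0 a) = ln 2}"


section \<open>The Curie--Weiss measure and the maximum likelihood estimators\<close>

definition configs :: "nat \<Rightarrow> (nat \<Rightarrow> int) set" where
  "configs n = ({..<n} \<rightarrow>\<^sub>E {1, -1})"

definition plus_frac :: "nat \<Rightarrow> (nat \<Rightarrow> int) \<Rightarrow> real" where
  "plus_frac n \<omega> = real (card {i \<in> {..<n}. \<omega> i = 1}) / real n"

definition cw_weight :: "nat \<Rightarrow> real \<Rightarrow> real \<Rightarrow> nat \<Rightarrow> (nat \<Rightarrow> int) \<Rightarrow> real" where
  "cw_weight p \<beta> h n \<omega> = exp (real n * f_cw p \<beta> h (plus_frac n \<omega>))"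

definition cw_measure :: "nat \<Rightarrow> real \<Rightarrow> real \<Rightarrow> nat \<Rightarrow> (nat \<Rightarrow> int) measure" where
  "cw_measure p \<beta> h n = point_measure (configs n)
     (\<lambda>\<omega>. ennreal (cw_weight p \<beta> h n \<omega> / (\<Sum>\<eta> \<in> configs n. cw_weight p \<beta> h n \<eta>)))"

text \<open>The moment equation has at most one real solution unless its statistic is constant on the
  sample space (which happens only when \<open>n = 0\<close>, or for the estimator of \<open>\<beta>\<close> when \<open>n = 1\<close> and \<open>p\<close> is
  even), and no real solution when the observed value is extremal and the statistic is not constant
  (for instance when all spins are \<open>+1\<close>). In these cases the estimator takes the unspecified value
  of \<open>THE\<close>.\<close>

definition mle_beta :: "nat \<Rightarrow> real \<Rightarrow> nat \<Rightarrow> (nat \<Rightarrow> int) \<Rightarrow> real" where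
  "mle_beta p h n \<omega> = (THE \<gamma>.
     (\<integral>\<eta>. f_beta p (plus_frac n \<eta>) \<partial>cw_measure p \<gamma> h n) = f_beta p (plus_frac n \<omega>))"

definition mle_h :: "nat \<Rightarrow> real \<Rightarrow> nat \<Rightarrow> (nat \<Rightarrow> int) \<Rightarrow> real" where
  "mle_h p \<beta> n \<omega> = (THE \<gamma>.
     (\<integral>\<eta>. f_h (plus_frac n \<eta>) \<partial>cw_measure p \<beta> \<gamma> n) = f_h (plus_frac n \<omega>))"

text \<open>Laws of the errors rescaled by \<open>n\<^sup>r\<close>, under the true parameters.\<close>

definition err_beta :: "nat \<Rightarrow> real \<Rightarrow> real \<Rightarrow> real \<Rightarrow> nat \<Rightarrow> real measure" where
  "err_beta p \<beta> h r n =
     distr (cw_measure p \<beta> h n) borel (\<lambda>\<omega>. real n powr r * (mle_beta p h n \<omega> - \<beta>))"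

definition err_h :: "nat \<Rightarrow> real \<Rightarrow> real \<Rightarrow> real \<Rightarrow> nat \<Rightarrow> real measure" where
  "err_h p \<beta> h r n =
     distr (cw_measure p \<beta> h n) borel (\<lambda>\<omega>. real n powr r * (mle_h p \<beta> n \<omega> - h))"


section \<open>Limit laws\<close>

text \<open>The second parameter of \<open>normal_density\<close> is a standard deviation, whereas \<open>v\<close> is a
  variance.\<close>

definition normal_law :: "real \<Rightarrow> real measure" where
  "normal_law v = density lborel (\<lambda>x. ennreal (normal_density 0 (sqrt v) x))"

definition normal_plus :: "real \<Rightarrow> real measure" where
  "normal_plus v = distr (normal_law v) borel (\<lambda>z. \<bar>z\<bar>)"

definition normal_minus :: "real \<Rightarrow> real measure" where
  "normal_minus v = distr (normal_law v) borel (\<lambda>z. - \<bar>z\<bar>)"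

definition half_normal_mixture :: "real \<Rightarrow> real \<Rightarrow> real \<Rightarrow> real \<Rightarrow> real measure" where
  "half_normal_mixture pm vm pp vp = measure_of UNIV (sets borel) (\<lambda>S.
     ennreal pm * emeasure (normal_minus vm) S +
     ennreal pp * emeasure (normal_plus vp) S +
     ennreal (1 - pm - pp) * emeasure (return borel 0) S)"

text \<open>\<open>quartic_law c d t\<close> is the law of \<open>Y(t)\<close>, with density proportional to
  \<open>exp (c y\<^sup>4 + t d y)\<close>; it is a probability measure for \<open>c < 0\<close>.\<close>

definition quartic_law :: "real \<Rightarrow> real \<Rightarrow> real \<Rightarrow> real measure" where
  "quartic_law c d t = density lborel
     (\<lambda>y. ennreal (exp (c * y ^ 4 + t * d * y) / (\<integral>z. exp (c * z ^ 4 + t * d * z) \<partial>lborel)))"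

definition quartic_mean :: "real \<Rightarrow> real \<Rightarrow> real \<Rightarrow> real" where
  "quartic_mean c d t = (\<integral>y. y \<partial>quartic_law c d t)"

end

theory Submission
  imports Defs "HOL-Real_Asymp.Real_Asymp"
begin

text \<open>The number \<open>k\<close> of positive spins has weight \<open>(n choose k) * exp (n f (k / n))\<close>, which by Stirling's
  formula is \<open>exp (n A (k / n))\<close> up to a factor of order \<open>1 / sqrt n\<close>. At a \<open>2 m\<close>-regular maximizer \<open>a\<close> of \<open>A\<close>
  the law therefore lives on the scale \<open>k / n = a + y / N\<close> with \<open>N = n powr (1 / (2 m))\<close>, and changing the
  estimated parameter by \<open>t N / n\<close> multiplies the limiting density \<open>exp (c y ^ (2 m))\<close> by \<open>exp (t f' a y)\<close>
  (Laplace's method, with the sums written as integrals of step functions and dominated convergence).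
  The score of the moment equation is increasing in the parameter, so the event that the rescaled error
  is at most \<open>t\<close> is the event that the statistic is at most its mean under the parameter shifted by \<open>t N / n\<close>.
  When there are several maximizers, a shift with \<open>t \<noteq> 0\<close> moves all of the shifted law to those with the
  extremal value of \<open>t f\<close>, which produces the half normal mixtures.\<close>

section \<open>The moment equation and the number of positive spins\<close>

text \<open>Two laws meet in the limit: the threshold is the mean of the statistic under the shifted
  parameter, while the probability of staying below it is taken under the true parameter. So one
  limit theorem is needed for tilted means and one for untilted probabilities, both resolved on the
  scale \<open>1 / N\<close>. Three obstacles shape the argument. The estimator is an unspecified
  value when the observation is extremal, so the identity of events fails there; such observations
  are negligible because the statistic is strictly monotone near every maximizer. With several
  maximizers the tilt selects no group at \<open>t = 0\<close>, so that point is reached only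
  through monotonicity of the cdfs. And in \<open>R2\<close> and \<open>R3\<close> the order of
  contact at the maximizers has to be derived: a degenerate maximizer is shown to have a negative
  fourth derivative and to exclude any second maximizer.\<close>

definition cw_mass :: "(real \<Rightarrow> real) \<Rightarrow> nat \<Rightarrow> nat \<Rightarrow> real" where
  "cw_mass F n k = real (n choose k) * exp (real n * F (real k / real n))"

definition cw_total :: "(real \<Rightarrow> real) \<Rightarrow> nat \<Rightarrow> real" where
  "cw_total F n = (\<Sum>k\<le>n. cw_mass F n k)"

definition cw_mean :: "(real \<Rightarrow> real) \<Rightarrow> nat \<Rightarrow> (real \<Rightarrow> real) \<Rightarrow> real" where
  "cw_mean F n f = (\<Sum>k\<le>n. cw_mass F n k * f (real k / real n)) / cw_total F n"

text \<open>\<open>F\<close> is the field without the term of the estimated parameter, and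
  \<open>f\<close> is the statistic multiplying that parameter. Both estimators have this form, so
  every limit theorem is proved once for an abstract pair.\<close>

definition cw_mle :: "(real \<Rightarrow> real) \<Rightarrow> (real \<Rightarrow> real) \<Rightarrow> nat \<Rightarrow> real \<Rightarrow> real" where
  "cw_mle F f n v = (THE \<gamma>. cw_mean (\<lambda>x. F x + \<gamma> * f x) n f = v)"

definition cw_prob :: "(real \<Rightarrow> real) \<Rightarrow> nat \<Rightarrow> (nat \<Rightarrow> bool) \<Rightarrow> real" where
  "cw_prob F n P = (\<Sum>k\<le>n. cw_mass F n k * of_bool (P k)) / cw_total F n"

lemma cw_mass_pos: "k \<le> n \<Longrightarrow> 0 < cw_mass F n k"
  by (simp add: cw_mass_def)

lemma cw_mass_nonneg: "0 \<le> cw_mass F n k"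
  by (simp add: cw_mass_def)

lemma cw_total_pos: "0 < cw_total F n"
  unfolding cw_total_def by (intro sum_pos) (auto simp: cw_mass_pos)

text \<open>The moment equation says that the score \<open>\<Sum>\<^sub>k W\<^sub>k (f\<^sub>k - v) exp (n x (f\<^sub>k - v))\<close> vanishes, and each
  summand of the score is nondecreasing in \<open>x\<close>.\<close>

lemma cw_mle_le_iff:
  assumes kl: "k \<le> n" "l \<le> n" "f (real k / real n) < v" "v < f (real l / real n)" and n: "n \<ge> 1"
  shows "cw_mle F f n v \<le> y \<longleftrightarrow> v \<le> cw_mean (\<lambda>x. F x + y * f x) n f"
proof -
  define g where "g i = f (real i / real n) - v" for i
  define s where "s x = (\<Sum>i\<le>n. cw_mass F n i * (g i * exp (real n * x * g i)))" for x
  have s_eq: "(\<Sum>i\<le>n. cw_mass (\<lambda>z. F z + x * f z) n i * (f (real i / real n) - v)) = exp (real n * x * v) * s x" for x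
  proof -
    have e: "exp (real n * (F z + x * f z)) = exp (real n * x * v) * (exp (real n * F z) * exp (real n * x * (f z - v)))" for z
      by (simp add: exp_add [symmetric] algebra_simps)
    show ?thesis
      unfolding s_def sum_distrib_left cw_mass_def g_def e
      by (intro sum.cong refl) (simp only: ac_simps)
  qed
  have diff: "cw_mean (\<lambda>z. F z + x * f z) n f - v =
      exp (real n * x * v) * s x / cw_total (\<lambda>z. F z + x * f z) n" for x
    unfolding s_eq [symmetric]
    using cw_total_pos [of "\<lambda>z. F z + x * f z" n]
    by (simp add: cw_mean_def cw_total_def field_simps sum_subtractf sum_distrib_left)
  have eq_iff: "cw_mean (\<lambda>z. F z + x * f z) n f = v \<longleftrightarrow> s x = 0" for x
    using diff [of x] cw_total_pos [of "\<lambda>z. F z + x * f z" n] by auto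
  have ge_iff: "v \<le> cw_mean (\<lambda>z. F z + x * f z) n f \<longleftrightarrow> 0 \<le> s x" for x
  proof -
    have "0 \<le> exp (real n * x * v) * s x / cw_total (\<lambda>z. F z + x * f z) n \<longleftrightarrow> 0 \<le> s x"
      using cw_total_pos [of "\<lambda>z. F z + x * f z" n]
      by (auto simp: zero_le_divide_iff zero_le_mult_iff)
    then show ?thesis
      using diff [of x] by linarith
  qed
  have term_mono: "g i * exp (real n * x * g i) \<le> g i * exp (real n * x' * g i)" if "x \<le> x'" for i x x'
  proof -
    have le: "real n * x \<le> real n * x'" using that by (simp add: mult_left_mono)
    show ?thesis
    proof (cases "g i \<ge> 0")
      case True
      then have "real n * x * g i \<le> real n * x' * g i" using le by (rule mult_right_mono[rotated])
      then show ?thesis using True by (intro mult_left_mono) auto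
    next
      case False
      then have "real n * x' * g i \<le> real n * x * g i" using le by (intro mult_right_mono_neg) auto
      then show ?thesis using False by (intro mult_left_mono_neg) auto
    qed
  qed
  have s_strict: "s x < s x'" if "x < x'" for x x'
    unfolding s_def
  proof (rule sum_strict_mono_ex1)
    show "\<forall>i\<in>{..n}. cw_mass F n i * (g i * exp (real n * x * g i)) \<le> cw_mass F n i * (g i * exp (real n * x' * g i))"
      using that by (intro ballI mult_left_mono term_mono cw_mass_nonneg) simp
    have "g l * exp (real n * x * g l) < g l * exp (real n * x' * g l)"
      using that kl n by (intro mult_strict_left_mono) (auto simp: g_def)
    then show "\<exists>i\<in>{..n}. cw_mass F n i * (g i * exp (real n * x * g i)) < cw_mass F n i * (g i * exp (real n * x' * g i))"
      using kl cw_mass_pos by (intro bexI[of _ l]) auto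
  qed simp
  have le_imp: "s x \<le> s x' \<longleftrightarrow> x \<le> x'" for x x'
    using s_strict [of x x'] s_strict [of x' x] by (cases x x' rule: linorder_cases) auto
  \<comment> \<open>Existence of a root by the intermediate value theorem. \<open>B\<close> bounds
    what the other terms can contribute with the wrong sign, and \<open>X\<close>, \<open>Y\<close>
    are chosen so that, by \<open>exp z \<ge> z\<close>, the single term at \<open>l\<close>
    (respectively \<open>k\<close>) outweighs \<open>B\<close> by 1.\<close>
  define B where "B = (\<Sum>i\<le>n. cw_mass F n i * \<bar>g i\<bar>)"
  have B: "0 \<le> B" by (simp add: B_def sum_nonneg cw_mass_nonneg)
  define X where "X = (B + 1) / (cw_mass F n l * (g l)\<^sup>2)"
  define Y where "Y = (B + 1) / (cw_mass F n k * (g k)\<^sup>2)"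
  have pos: "0 < cw_mass F n l * (g l)\<^sup>2" "0 < cw_mass F n k * (g k)\<^sup>2"
    using kl by (auto simp: g_def cw_mass_pos)
  have cancel: "(B + 1) / c * c = B + 1" if "0 < c" for c using that by simp
  have Xeq: "X * (cw_mass F n l * (g l)\<^sup>2) = B + 1" and Yeq: "Y * (cw_mass F n k * (g k)\<^sup>2) = B + 1"
    unfolding X_def Y_def by (rule cancel, rule pos)+
  from pos have XY: "0 \<le> X" "0 \<le> Y" using B by (auto simp: X_def Y_def)
  have tail: "g i * exp (real n * x * g i) \<ge> - \<bar>g i\<bar>" if "x \<ge> 0" for i x
    using that term_mono [of 0 x i] by auto
  have tail': "g i * exp (real n * x * g i) \<le> \<bar>g i\<bar>" if "x \<le> 0" for i x
    using that term_mono [of x 0 i] by auto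
  have "0 \<le> s X"
  proof -
    have "cw_mass F n l * (g l * (X * g l)) - B \<le> cw_mass F n l * (g l * exp (real n * X * g l)) - B"
    proof -
      have "0 \<le> X * g l" using XY kl by (simp add: g_def)
      then have "1 * (X * g l) \<le> real n * (X * g l)"
        using n by (intro mult_right_mono) auto
      then have "X * g l \<le> real n * X * g l" by (simp add: mult.assoc)
      also have "\<dots> \<le> exp (real n * X * g l)"
        using exp_ge_add_one_self [of "real n * X * g l"] by linarith
      finally show ?thesis
        using kl by (auto intro!: mult_left_mono simp: cw_mass_nonneg g_def)
    qed
    also have "\<dots> \<le> s X"
    proof -
      have "- B \<le> - (\<Sum>i\<in>{..n}-{l}. cw_mass F n i * \<bar>g i\<bar>)"
        unfolding B_def by (subst sum.remove [of _ l]) (use kl in \<open>auto simp: cw_mass_nonneg\<close>)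
      also have "\<dots> = (\<Sum>i\<in>{..n}-{l}. cw_mass F n i * - \<bar>g i\<bar>)"
        by (simp add: sum_negf)
      also have "\<dots> \<le> (\<Sum>i\<in>{..n}-{l}. cw_mass F n i * (g i * exp (real n * X * g i)))"
        by (intro sum_mono mult_left_mono tail XY cw_mass_nonneg)
      finally show ?thesis
        unfolding s_def by (subst sum.remove [of _ l]) (use kl in auto)
    qed
    also have "cw_mass F n l * (g l * (X * g l)) = B + 1"
      using Xeq by (simp add: power2_eq_square ac_simps)
    finally show ?thesis by simp
  qed
  moreover have "s (- Y) \<le> 0"
  proof -
    have "s (- Y) \<le> cw_mass F n k * (g k * exp (real n * (- Y) * g k)) + B"
    proof -
      have "(\<Sum>i\<in>{..n}-{k}. cw_mass F n i * (g i * exp (real n * (- Y) * g i))) \<le>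
          (\<Sum>i\<in>{..n}-{k}. cw_mass F n i * \<bar>g i\<bar>)"
        using XY by (intro sum_mono mult_left_mono tail' cw_mass_nonneg) auto
      also have "\<dots> \<le> B"
        unfolding B_def by (subst (2) sum.remove [of _ k]) (use kl in \<open>auto simp: cw_mass_nonneg\<close>)
      finally show ?thesis
        unfolding s_def by (subst sum.remove [of _ k]) (use kl in auto)
    qed
    also have "\<dots> \<le> cw_mass F n k * (g k * ((- Y) * g k)) + B"
    proof -
      have "0 \<le> (- Y) * g k" using XY kl by (simp add: g_def mult_nonneg_nonpos)
      then have "1 * ((- Y) * g k) \<le> real n * ((- Y) * g k)"
        using n by (intro mult_right_mono) auto
      then have "(- Y) * g k \<le> real n * ((- Y) * g k)" by simp
      also have "\<dots> \<le> exp (real n * (- Y) * g k)"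
        using exp_ge_add_one_self [of "real n * (- Y) * g k"] by (simp add: mult.assoc)
      finally show ?thesis
        using kl by (intro add_right_mono mult_left_mono mult_left_mono_neg cw_mass_nonneg) (auto simp: g_def)
    qed
    also have "cw_mass F n k * (g k * ((- Y) * g k)) = - (B + 1)"
      using Yeq by (simp add: power2_eq_square ac_simps)
    finally show ?thesis by simp
  qed
  moreover have "continuous_on {- Y..X} s"
    unfolding s_def by (intro continuous_intros)
  ultimately obtain z where z: "s z = 0"
    using IVT' [of s "- Y" 0 X] XY by auto
  \<comment> \<open>Strict monotonicity of the score makes \<open>z\<close> the only root, as
    \<open>THE\<close> requires.\<close>
  have "cw_mle F f n v = z"
    unfolding cw_mle_def eq_iff
    using z s_strict by (intro the_equality) (metis less_irrefl linorder_neqE_linordered_idom)+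
  then show ?thesis
    using le_imp [of z y] z by (simp add: ge_iff)
qed

section \<open>From spin configurations to sums over the number of positive spins\<close>

lemma finite_configs: "finite (configs n)"
  unfolding configs_def by (intro finite_PiE) auto

text \<open>A configuration is determined by its set of plus sites, and \<open>n choose k\<close> of
  these sets have \<open>k\<close> elements.\<close>

lemma sum_configs:
  fixes g :: "nat \<Rightarrow> real"
  shows "(\<Sum>\<omega>\<in>configs n. g (card {i\<in>{..<n}. \<omega> i = 1})) = (\<Sum>k\<le>n. real (n choose k) * g k)"
proof -
  have bij: "bij_betw (\<lambda>\<omega>. {i\<in>{..<n}. \<omega> i = 1}) (configs n) (Pow {..<n})"
  proof (rule bij_betwI)
    show "(\<lambda>B. \<lambda>i\<in>{..<n}. if i \<in> B then 1 else - 1 :: int) \<in> Pow {..<n} \<rightarrow> configs n"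
      by (auto simp: configs_def)
    fix \<omega> assume "\<omega> \<in> configs n"
    then show "(\<lambda>i\<in>{..<n}. if i \<in> {i\<in>{..<n}. \<omega> i = 1} then 1 else - 1 :: int) = \<omega>"
      by (intro ext) (auto simp: configs_def PiE_iff extensional_def restrict_def)
  qed auto
  have "(\<Sum>\<omega>\<in>configs n. g (card {i\<in>{..<n}. \<omega> i = 1})) = (\<Sum>B\<in>Pow {..<n}. g (card B))"
    by (rule sum.reindex_bij_betw [OF bij])
  also have "\<dots> = (\<Sum>k\<le>n. \<Sum>B\<in>{B\<in>Pow {..<n}. card B = k}. g (card B))"
    by (intro sum.group [symmetric]) (auto intro: card_mono[of "{..<n}", simplified])
  also have "\<dots> = (\<Sum>k\<le>n. real (n choose k) * g k)"
  proof (intro sum.cong refl)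
    fix k
    have "card {B\<in>Pow {..<n}. card B = k} = n choose k"
      using n_subsets [of "{..<n}" k] by simp
    then show "(\<Sum>B\<in>{B\<in>Pow {..<n}. card B = k}. g (card B)) = real (n choose k) * g k"
      by simp
  qed
  finally show ?thesis .
qed

lemma sum_cw_weight:
  "(\<Sum>\<omega>\<in>configs n. cw_weight p \<beta> h n \<omega> * g (card {i\<in>{..<n}. \<omega> i = 1})) =
    (\<Sum>k\<le>n. cw_mass (f_cw p \<beta> h) n k * g k)"
  using sum_configs [where n = n and g = "\<lambda>k. exp (real n * f_cw p \<beta> h (real k / real n)) * g k"]
  by (simp add: cw_weight_def plus_frac_def cw_mass_def mult.assoc)

lemma sum_cw_weight_total:
  "(\<Sum>\<omega>\<in>configs n. cw_weight p \<beta> h n \<omega>) = cw_total (f_cw p \<beta> h) n"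
  using sum_cw_weight [where g = "\<lambda>_. 1"] by (simp add: cw_total_def)

lemma integral_cw_measure:
  "(\<integral>\<eta>. f (plus_frac n \<eta>) \<partial>cw_measure p \<beta> h n) = cw_mean (f_cw p \<beta> h) n f"
proof -
  have "(\<integral>\<eta>. f (plus_frac n \<eta>) \<partial>cw_measure p \<beta> h n) =
    (\<Sum>\<omega>\<in>configs n. (cw_weight p \<beta> h n \<omega> / cw_total (f_cw p \<beta> h) n) * f (plus_frac n \<omega>))"
    unfolding cw_measure_def sum_cw_weight_total
    using cw_total_pos [of "f_cw p \<beta> h" n]
    by (subst lebesgue_integral_point_measure_finite)
      (auto simp: finite_configs cw_weight_def)
  also have "\<dots> = (\<Sum>\<omega>\<in>configs n. cw_weight p \<beta> h n \<omega> * f (plus_frac n \<omega>)) / cw_total (f_cw p \<beta> h) n"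
    by (simp add: sum_divide_distrib)
  also have "\<dots> = cw_mean (f_cw p \<beta> h) n f"
    using sum_cw_weight [where g = "\<lambda>k. f (real k / real n)"]
    by (simp add: cw_mean_def plus_frac_def)
  finally show ?thesis .
qed

lemma cdf_distr_cw_measure:
  "cdf (distr (cw_measure p \<beta> h n) borel (\<lambda>\<omega>. g (plus_frac n \<omega>))) t =
    cw_prob (f_cw p \<beta> h) n (\<lambda>k. g (real k / real n) \<le> t)"
proof -
  let ?M = "cw_measure p \<beta> h n" and ?S = "{\<omega>\<in>configs n. g (plus_frac n \<omega>) \<le> t}"
  have m: "(\<lambda>\<omega>. g (plus_frac n \<omega>)) \<in> borel_measurable ?M"
    by (simp add: cw_measure_def)
  have sp: "space ?M = configs n"
    by (simp add: cw_measure_def space_point_measure)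
  have "cdf (distr ?M borel (\<lambda>\<omega>. g (plus_frac n \<omega>))) t = measure ?M ?S"
    unfolding cdf_def by (subst measure_distr[OF m]) (auto simp: sp intro!: arg_cong[of _ _ "measure ?M"])
  also have "\<dots> = (\<Sum>\<omega>\<in>?S. cw_weight p \<beta> h n \<omega> / cw_total (f_cw p \<beta> h) n)"
    unfolding cw_measure_def sum_cw_weight_total
    using cw_total_pos [of "f_cw p \<beta> h" n] finite_configs [of n]
    by (subst measure_point_measure_finite_if)
      (auto simp: cw_weight_def intro!: sum_nonneg)
  also have "\<dots> = (\<Sum>\<omega>\<in>configs n. cw_weight p \<beta> h n \<omega> * of_bool (g (plus_frac n \<omega>) \<le> t)) / cw_total (f_cw p \<beta> h) n"
    unfolding sum_divide_distrib
    by (intro sum.mono_neutral_cong_left) (auto simp: finite_configs)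
  also have "\<dots> = cw_prob (f_cw p \<beta> h) n (\<lambda>k. g (real k / real n) \<le> t)"
    using sum_cw_weight [where g = "\<lambda>k. of_bool (g (real k / real n) \<le> t)"]
    by (simp add: cw_prob_def plus_frac_def)
  finally show ?thesis .
qed

lemma cdf_err_beta:
  "cdf (err_beta p \<beta> h r n) t =
    cw_prob (f_cw p \<beta> h) n (\<lambda>k. real n powr r * (cw_mle (f_cw p 0 h) (f_beta p) n (f_beta p (real k / real n)) - \<beta>) \<le> t)"
proof -
  have e: "f_cw p \<gamma> h = (\<lambda>x. f_cw p 0 h x + \<gamma> * f_beta p x)" for \<gamma>
    by (auto simp: f_cw_def)
  then have "mle_beta p h n \<omega> = cw_mle (f_cw p 0 h) (f_beta p) n (f_beta p (plus_frac n \<omega>))" for \<omega>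
    by (simp only: mle_beta_def cw_mle_def integral_cw_measure e [symmetric])
  then show ?thesis
    unfolding err_beta_def by (simp only: cdf_distr_cw_measure [where g = "\<lambda>x. real n powr r * (cw_mle (f_cw p 0 h) (f_beta p) n (f_beta p x) - \<beta>)"])
qed

lemma cdf_err_h:
  "cdf (err_h p \<beta> h r n) t =
    cw_prob (f_cw p \<beta> h) n (\<lambda>k. real n powr r * (cw_mle (f_cw p \<beta> 0) f_h n (f_h (real k / real n)) - h) \<le> t)"
proof -
  have e: "f_cw p \<beta> \<gamma> = (\<lambda>x. f_cw p \<beta> 0 x + \<gamma> * f_h x)" for \<gamma>
    by (auto simp: f_cw_def)
  then have "mle_h p \<beta> n \<omega> = cw_mle (f_cw p \<beta> 0) f_h n (f_h (plus_frac n \<omega>))" for \<omega>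
    by (simp only: mle_h_def cw_mle_def integral_cw_measure e [symmetric])
  then show ?thesis
    unfolding err_h_def by (simp only: cdf_distr_cw_measure [where g = "\<lambda>x. real n powr r * (cw_mle (f_cw p \<beta> 0) f_h n (f_h x) - h)"])
qed

section \<open>Stirling approximation of binomial coefficients\<close>

text \<open>The logarithm of the ratio between \<open>n!\<close> and
  \<open>n ^ (n + 1/2) * exp (- n)\<close>. Its limit enters the weights only as a common constant
  factor, which cancels in normalised sums.\<close>

definition stirling_rest :: "nat \<Rightarrow> real" where
  "stirling_rest n = ln (fact n) - (real n + 1 / 2) * ln (real n) + real n"

lemma stirling_rest_Suc:
  assumes "n \<ge> 1"
  shows "stirling_rest (Suc n) - stirling_rest n = 1 - (real n + 1 / 2) * ln (1 + 1 / real n)"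
proof -
  have "1 + 1 / real n = real (Suc n) / real n"
    using assms by (simp add: field_simps)
  then have L: "ln (1 + 1 / real n) = ln (real (Suc n)) - ln (real n)"
    using assms by (simp add: ln_div del: of_nat_Suc)
  have F: "ln (fact (Suc n) :: real) = ln (real (Suc n)) + ln (fact n)"
    by (simp add: ln_mult del: of_nat_Suc)
  show ?thesis
    unfolding stirling_rest_def L F by (simp add: field_simps)
qed

text \<open>The summand 1/2 in the exponent cancels the term of order \<open>1 / n\<close> in the
  increments, which leaves \<open>O(1 / n^2)\<close>; the telescoping series therefore
  converges.\<close>

lemma convergent_stirling_rest: "convergent stirling_rest"
proof -
  have "summable (\<lambda>n. 1 - (real n + 1 / 2) * ln (1 + 1 / real n))"
  proof (rule summable_comparison_test_bigo)
    show "summable (\<lambda>n. norm (1 / real n ^ 2))"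
      using inverse_power_summable [of 2, where 'a = real] by (simp add: field_simps)
    show "(\<lambda>n. 1 - (real n + 1 / 2) * ln (1 + 1 / real n)) \<in> O(\<lambda>n. 1 / real n ^ 2)"
      by real_asymp
  qed
  then have "summable (\<lambda>n. 1 - (real (Suc n) + 1 / 2) * ln (1 + 1 / real (Suc n)))"
    by (subst summable_Suc_iff)
  then have "summable (\<lambda>n. stirling_rest (Suc (Suc n)) - stirling_rest (Suc n))"
    by (simp add: stirling_rest_Suc)
  then have "convergent (\<lambda>n. \<Sum>i<n. stirling_rest (Suc (Suc i)) - stirling_rest (Suc i))"
    by (simp add: summable_iff_convergent)
  also have "(\<lambda>n. \<Sum>i<n. stirling_rest (Suc (Suc i)) - stirling_rest (Suc i)) =
      (\<lambda>n. stirling_rest (Suc n) - stirling_rest (Suc 0))"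
    by (subst sum_lessThan_telescope) simp
  finally have "convergent (\<lambda>n. stirling_rest (Suc n) - stirling_rest (Suc 0) + stirling_rest (Suc 0))"
    by (intro convergent_add convergent_const)
  then show ?thesis
    by (simp add: convergent_Suc_iff)
qed

text \<open>What remains of the binomial coefficient after its exponential rate is removed. The
  factor \<open>sqrt n\<close> gives it a finite positive limit as long as \<open>k / n\<close>
  converges inside the open unit interval.\<close>

definition binom_factor :: "nat \<Rightarrow> nat \<Rightarrow> real" where
  "binom_factor n k = sqrt (real n) * real (n choose k) * exp (- real n * I_ent (real k / real n))"

lemma binom_factor_nonneg: "0 \<le> binom_factor n k"
  by (simp add: binom_factor_def)

text \<open>The binomial distribution with success probability \<open>k / n\<close> gives \<open>k\<close> a mass at most 1.\<close>

lemma binom_factor_le_sqrt: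
  assumes "k \<le> n" "n \<ge> 1"
  shows "binom_factor n k \<le> sqrt (real n)"
proof -
  define a where "a = real k / real n"
  have a: "0 \<le> a" "a \<le> 1" "real n * a = real k" "real n * (1 - a) = real (n - k)"
    using assms by (auto simp: a_def field_simps)
  \<comment> \<open>The alternative \<open>j = 0\<close> admits the boundary values
    \<open>k = 0\<close> and \<open>k = n\<close>, where a base is 0 and its logarithm is only a
    default value.\<close>
  have "x ^ j = exp (real j * ln x)" if "x > 0 \<or> j = 0" for x :: real and j
    using that by (auto simp: exp_of_nat_mult)
  moreover have "a > 0 \<or> k = 0" "1 - a > 0 \<or> n - k = 0"
    using assms by (auto simp: a_def)
  ultimately have "a ^ k = exp (real k * ln a)" "(1 - a) ^ (n - k) = exp (real (n - k) * ln (1 - a))"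
    by blast+
  then have "a ^ k * (1 - a) ^ (n - k) = exp (real k * ln a + real (n - k) * ln (1 - a))"
    by (simp add: exp_add)
  also have "\<dots> = exp (- real n * I_ent a)"
    unfolding I_ent_def a(3,4)[symmetric] by (simp add: algebra_simps)
  finally have "real (n choose k) * exp (- real n * I_ent a) = real (n choose k) * a ^ k * (1 - a) ^ (n - k)"
    by simp
  also have "\<dots> \<le> (\<Sum>j\<le>n. real (n choose j) * a ^ j * (1 - a) ^ (n - j))"
    using a assms by (intro member_le_sum) auto
  also have "\<dots> = (a + (1 - a)) ^ n"
    by (rule binomial_ring [symmetric])
  finally show ?thesis
    unfolding binom_factor_def a_def[symmetric] using assms by (simp add: mult.assoc mult_left_le)
qed

lemma binom_factor_stirling:
  assumes "0 < k" "k < n"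
  defines "a \<equiv> real k / real n"
  shows "binom_factor n k =
    exp (stirling_rest n - stirling_rest k - stirling_rest (n - k)) / sqrt (a * (1 - a))"
proof -
  define l where "l = n - k"
  have l: "0 < l" "n = k + l" using assms by (auto simp: l_def)
  have n: "real n > 0" using l by simp
  have a: "0 < a" "a < 1" using assms by (auto simp: a_def)
  have la: "ln a = ln (real k) - ln (real n)" "ln (1 - a) = ln (real l) - ln (real n)"
  proof -
    have "1 - a = real l / real n" using l n by (simp add: a_def field_simps)
    then show "ln a = ln (real k) - ln (real n)" "ln (1 - a) = ln (real l) - ln (real n)"
      using assms l n by (simp_all add: a_def ln_div)
  qed
  have lnA: "ln (sqrt (a * (1 - a))) = (ln a + ln (1 - a)) / 2"
    using a by (simp add: ln_sqrt ln_mult)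
  have "real (n choose k) = fact n / (fact k * fact l)"
    using assms by (simp add: binomial_fact l_def)
  then have "ln (real (n choose k)) = ln (fact n) - ln (fact k) - ln (fact l)"
    by (simp add: ln_div ln_mult)
  moreover have "real n * I_ent a = - real k * ln a - real l * ln (1 - a)"
  proof -
    have na: "real n * a = real k" "real n * (1 - a) = real l"
      using n l by (simp_all add: a_def field_simps)
    show ?thesis
      unfolding I_ent_def na[symmetric] by (simp add: algebra_simps)
  qed
  moreover have "ln (binom_factor n k) =
      ln (real n) / 2 + ln (real (n choose k)) - real n * I_ent a"
    unfolding binom_factor_def using assms n by (simp add: ln_mult ln_sqrt)
  ultimately have "ln (binom_factor n k) =
    stirling_rest n - stirling_rest k - stirling_rest l - ln (sqrt (a * (1 - a)))"
    unfolding lnA la stirling_rest_def using l by (simp add: field_simps)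
  moreover have "binom_factor n k > 0"
    using assms n by (auto simp: binom_factor_def)
  ultimately have "binom_factor n k =
     exp (stirling_rest n - stirling_rest k - stirling_rest l - ln (sqrt (a * (1 - a))))"
    by (metis exp_ln)
  also have "\<dots> = exp (stirling_rest n - stirling_rest k - stirling_rest l) / sqrt (a * (1 - a))"
    using a by (simp add: exp_diff)
  finally show ?thesis by (simp add: l_def)
qed

text \<open>The limit of \<open>binom_factor\<close>: the three Stirling remainders, for
  \<open>n\<close>, \<open>k\<close> and \<open>n - k\<close>, tend to the same number and combine
  to minus that number.\<close>

definition laplace_weight :: "real \<Rightarrow> real" where
  "laplace_weight a = exp (- lim stirling_rest) / sqrt (a * (1 - a))"

lemma laplace_weight_pos: "0 < a \<Longrightarrow> a < 1 \<Longrightarrow> 0 < laplace_weight a"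
  by (simp add: laplace_weight_def)

lemma binom_factor_tendsto:
  assumes "0 < a" "a < 1" and k: "(\<lambda>n. real (k n) / real n) \<longlonglongrightarrow> a"
  shows "(\<lambda>n. binom_factor n (k n)) \<longlonglongrightarrow> laplace_weight a"
proof -
  have ev: "\<forall>\<^sub>F n in sequentially. 0 < k n \<and> k n < n"
    using order_tendstoD(1)[OF k assms(1)] order_tendstoD(2)[OF k assms(2)] eventually_gt_at_top[of 0]
    by eventually_elim (auto simp: zero_less_divide_iff)
  have S: "stirling_rest \<longlonglongrightarrow> lim stirling_rest"
    using convergent_stirling_rest by (simp add: convergent_LIMSEQ_iff)
  \<comment> \<open>Both \<open>k\<close> and \<open>n - k\<close> must tend to infinity for their
    Stirling remainders to converge; this is where the limit ratio has to be an interior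
    point.\<close>
  have top: "filterlim (\<lambda>n. j n) sequentially sequentially"
    if "(\<lambda>n. real (j n) / real n) \<longlonglongrightarrow> b" "b > 0" for j :: "nat \<Rightarrow> nat" and b
  proof -
    have "filterlim (\<lambda>n. real (j n) / real n * real n) at_top sequentially"
      by (rule filterlim_tendsto_pos_mult_at_top[OF that filterlim_real_sequentially])
    then have "filterlim (\<lambda>n. real (j n)) at_top sequentially"
      by (rule filterlim_mono_eventually[OF _ order_refl order_refl])
        (use eventually_gt_at_top[of 0] in eventually_elim, simp)
    then show ?thesis
      using filterlim_sequentially_iff_filterlim_real by blast
  qed
  have "(\<lambda>n. 1 - real (k n) / real n) \<longlonglongrightarrow> 1 - a"
    by (intro tendsto_intros k)
  then have l: "(\<lambda>n. real (n - k n) / real n) \<longlonglongrightarrow> 1 - a"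
    by (rule Lim_transform_eventually)
      (use ev in eventually_elim, auto simp: field_simps of_nat_diff)
  have "(\<lambda>n. exp (stirling_rest n - stirling_rest (k n) - stirling_rest (n - k n)) /
          sqrt (real (k n) / real n * (1 - real (k n) / real n))) \<longlonglongrightarrow>
      exp (lim stirling_rest - lim stirling_rest - lim stirling_rest) / sqrt (a * (1 - a))"
    using assms l by (intro tendsto_intros k S filterlim_compose[OF S] top[OF k] top[OF l]) auto
  then have "(\<lambda>n. exp (stirling_rest n - stirling_rest (k n) - stirling_rest (n - k n)) /
          sqrt (real (k n) / real n * (1 - real (k n) / real n))) \<longlonglongrightarrow> laplace_weight a"
    by (simp add: laplace_weight_def)
  then show ?thesis
    by (rule Lim_transform_eventually) (use ev in eventually_elim, simp add: binom_factor_stirling)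
qed

text \<open>Uniformity in \<open>n\<close> and \<open>k\<close> is what dominated convergence asks
  for. A convergent sequence of remainders is bounded, and \<open>u * (1 - v)\<close> is a lower
  bound for \<open>a * (1 - a)\<close>.\<close>

lemma binom_factor_bounded:
  assumes "0 < u" "v < 1"
  obtains C where "C > 0"
    "\<And>n k. 1 \<le> n \<Longrightarrow> u \<le> real k / real n \<Longrightarrow> real k / real n \<le> v \<Longrightarrow> binom_factor n k \<le> C"
proof -
  have "Bseq stirling_rest"
    by (rule convergent_imp_Bseq[OF convergent_stirling_rest])
  then obtain B where B: "\<And>n. \<bar>stirling_rest n\<bar> \<le> B"
    by (auto simp: Bseq_def)
  define C where "C = exp (3 * B) / sqrt (u * (1 - v))"
  have "binom_factor n k \<le> exp (3 * B) / sqrt (u * (1 - v)) \<and> C > 0"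
    if n: "1 \<le> n" and k: "u \<le> real k / real n" "real k / real n \<le> v" for n k
  proof -
    have uv: "u * (1 - v) > 0" using assms by simp
    have "real k / real n > 0" "real k / real n < 1" using k assms by linarith+
    then have "0 < k" "k < n" using n by (auto simp: zero_less_divide_iff)
    moreover have "u * (1 - v) \<le> real k / real n * (1 - real k / real n)"
      using k assms by (intro mult_mono) auto
    moreover have "stirling_rest n - stirling_rest k - stirling_rest (n - k) \<le> 3 * B"
      using B[of n] B[of k] B[of "n - k"] by linarith
    ultimately show ?thesis
      using uv by (auto simp: binom_factor_stirling C_def intro!: frac_le)
  qed
  then show ?thesis
    by (intro that[of "max C 1"]) (fastforce simp: C_def max.coboundedI1)+
qed

section \<open>Laplace asymptotics\<close>

lemma integrable_exp_neg_square:
  fixes k :: real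
  assumes "k > 0"
  shows "integrable lborel (\<lambda>y::real. exp (- k * y\<^sup>2))"
proof -
  define s where "s = sqrt (1 / (2 * k))"
  have s: "s > 0" "2 * s\<^sup>2 = 1 / k" using assms by (auto simp: s_def)
  have "integrable lborel (\<lambda>y. sqrt (2 * pi * s\<^sup>2) * normal_density 0 s y)"
    using s by (intro integrable_mult_right) simp
  also have "(\<lambda>y. sqrt (2 * pi * s\<^sup>2) * normal_density 0 s y) = (\<lambda>y. exp (- k * y\<^sup>2))"
    using s assms by (auto simp: normal_density_def fun_eq_iff)
  finally show ?thesis .
qed

text \<open>Allows a Gaussian majorant for every even order at once; the correction by 1 pays for
  the points with \<open>\<bar>z\<bar> < 1\<close>.\<close>

lemma power_even_ge_square:
  fixes z :: real
  assumes "m \<ge> 1"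
  shows "z\<^sup>2 - 1 \<le> z ^ (2 * m)"
proof (cases "\<bar>z\<bar> \<ge> 1")
  case True
  then have "\<bar>z\<bar> ^ 2 \<le> \<bar>z\<bar> ^ (2 * m)" using assms by (intro power_increasing) auto
  then show ?thesis by (simp add: power_even_abs)
next
  case False
  then have "z\<^sup>2 \<le> 1" by (simp add: abs_square_le_1)
  moreover have "0 \<le> z ^ (2 * m)" by (simp add: power_mult)
  ultimately show ?thesis by linarith
qed

text \<open>The quadratic part of \<open>z ^ (2 * m)\<close> absorbs the linear term and the polynomial factor.\<close>

lemma even_power_tail_bound:
  fixes k b :: real
  assumes "k > 0" "b \<ge> 0" "m \<ge> 1"
  obtains C where "C > 0"
    "\<And>y z. \<bar>z - y\<bar> \<le> 1 \<Longrightarrow> exp (- k * z ^ (2 * m) + b * \<bar>z\<bar>) * (1 + \<bar>z\<bar>) \<le> C * exp (- (k / 4) * y\<^sup>2)"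
proof
  \<comment> \<open>In the exponent, \<open>k\<close> comes from replacing the even power by a
    square and \<open>k / 2\<close> from moving \<open>z\<close> to \<open>y\<close>. The last term
    completes the square for the slope \<open>b + 1\<close>, whose extra 1 absorbs
    \<open>1 + \<bar>z\<bar> \<le> exp \<bar>z\<bar>\<close>.\<close>
  define C where "C = exp (3 * k / 2 + (b + 1)\<^sup>2 / (2 * k))"
  show "C > 0" by (simp add: C_def)
  fix y z :: real assume yz: "\<bar>z - y\<bar> \<le> 1"
  have "- k * z ^ (2 * m) \<le> k - k * z\<^sup>2"
  proof -
    have "k * (z\<^sup>2 - 1) \<le> k * z ^ (2 * m)"
      using power_even_ge_square[OF assms(3), of z] assms(1) by (intro mult_left_mono) auto
    then show ?thesis by (simp add: algebra_simps)
  qed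
  moreover have "(b + 1) * \<bar>z\<bar> \<le> (b + 1)\<^sup>2 / (2 * k) + k / 2 * z\<^sup>2"
  proof -
    have "0 \<le> ((b + 1) - k * \<bar>z\<bar>)\<^sup>2 / (2 * k)" using assms by simp
    also have "\<dots> = (b + 1)\<^sup>2 / (2 * k) + k / 2 * z\<^sup>2 - (b + 1) * \<bar>z\<bar>"
      using assms by (simp add: power2_diff power_mult_distrib diff_divide_distrib add_divide_distrib power2_eq_square[of k])
    finally show ?thesis by simp
  qed
  moreover have "k / 2 * z\<^sup>2 \<ge> k / 4 * y\<^sup>2 - k / 2"
  proof -
    have "y\<^sup>2 \<le> 2 * z\<^sup>2 + 2 * (z - y)\<^sup>2"
      using zero_le_power2[of "2 * z - y"] by (simp add: power2_eq_square algebra_simps)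
    moreover have "(z - y)\<^sup>2 \<le> 1" using yz by (simp add: abs_square_le_1)
    ultimately have "y\<^sup>2 / 2 - 1 \<le> z\<^sup>2" by linarith
    then have "k / 2 * (y\<^sup>2 / 2 - 1) \<le> k / 2 * z\<^sup>2" using assms by (intro mult_left_mono) auto
    then show ?thesis by (simp add: algebra_simps)
  qed
  ultimately have *: "- k * z ^ (2 * m) + b * \<bar>z\<bar> + \<bar>z\<bar> \<le> 3 * k / 2 + (b + 1)\<^sup>2 / (2 * k) + - (k / 4) * y\<^sup>2"
    by (simp add: algebra_simps)
  have "exp (- k * z ^ (2 * m) + b * \<bar>z\<bar>) * (1 + \<bar>z\<bar>) \<le> exp (- k * z ^ (2 * m) + b * \<bar>z\<bar>) * exp \<bar>z\<bar>"
    using exp_ge_add_one_self[of "\<bar>z\<bar>"] by (intro mult_left_mono) auto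
  also have "\<dots> \<le> C * exp (- (k / 4) * y\<^sup>2)"
    unfolding C_def exp_add [symmetric] using * by simp
  finally show "exp (- k * z ^ (2 * m) + b * \<bar>z\<bar>) * (1 + \<bar>z\<bar>) \<le> C * exp (- (k / 4) * y\<^sup>2)" .
qed

text \<open>Serves both estimators and all three regions. \<open>M\<close> is the set of maximizers,
  all of the same order \<open>2 * m\<close>, and \<open>c a\<close> is the leading Taylor
  coefficient at \<open>a\<close>. A nonzero \<open>f' a\<close> lets the statistic resolve
  fluctuations on the scale \<open>1 / N\<close>; for \<open>f_beta\<close> in the Gaussian cases
  this can fail only at the parameters that the theorem removes.\<close>

locale cw_laplace =
  fixes F f f' :: "real \<Rightarrow> real" and M :: "real set" and m :: nat and c :: "real \<Rightarrow> real" and Amax L :: real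
  assumes cont_A: "continuous_on {0..1} (\<lambda>x. F x + I_ent x)"
    and finite_M: "finite M" and M_nonempty: "M \<noteq> {}" and M_interior: "M \<subseteq> {0<..<1}"
    and A_max: "\<And>a. a \<in> M \<Longrightarrow> F a + I_ent a = Amax"
    and A_less: "\<And>b. b \<in> {0..1} - M \<Longrightarrow> F b + I_ent b < Amax"
    and m_pos: "m \<ge> 1"
    and c_neg: "\<And>a. a \<in> M \<Longrightarrow> c a < 0"
    and expansion: "\<And>a. a \<in> M \<Longrightarrow>
      ((\<lambda>x. (F (a + x) + I_ent (a + x) - Amax) / x ^ (2 * m)) \<longlongrightarrow> c a) (at 0)"
    and f_deriv: "\<And>x. (f has_real_derivative f' x) (at x)"
    and f'_cont: "\<And>x. isCont f' x"
    and f'_nonzero: "\<And>a. a \<in> M \<Longrightarrow> f' a \<noteq> 0"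
    and f_lipschitz: "\<And>x y. x \<in> {0..1} \<Longrightarrow> y \<in> {0..1} \<Longrightarrow> \<bar>f x - f y\<bar> \<le> L * \<bar>x - y\<bar>"
begin

definition A :: "real \<Rightarrow> real" where "A x = F x + I_ent x"

definition N :: "nat \<Rightarrow> real" where "N n = real n powr (1 / (2 * real m))"

lemma N_pos: "n \<ge> 1 \<Longrightarrow> N n > 0"
  by (simp add: N_def)

lemma N_power: "n \<ge> 1 \<Longrightarrow> N n ^ (2 * m) = real n"
proof -
  assume n: "n \<ge> 1"
  have "N n ^ (2 * m) = N n powr (real (2 * m))"
    using N_pos[OF n] by (rule powr_realpow[symmetric])
  also have "\<dots> = real n powr 1"
    unfolding N_def powr_powr using m_pos by simp
  finally show ?thesis using n by simp
qed

lemma N_le: "n \<ge> 1 \<Longrightarrow> N n \<le> real n"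
proof -
  assume n: "n \<ge> 1"
  have "N n \<le> real n powr 1"
    unfolding N_def using n m_pos by (intro powr_mono) (auto simp: field_simps)
  then show ?thesis using n by simp
qed

lemma N_div_tendsto: "(\<lambda>n. N n / real n) \<longlonglongrightarrow> 0"
proof -
  have "(\<lambda>n. real n powr (1 / (2 * real m) - 1)) \<longlonglongrightarrow> 0"
    using m_pos by (intro tendsto_neg_powr filterlim_real_sequentially) (auto simp: field_simps)
  then show ?thesis
    by (rule Lim_transform_eventually)
      (use eventually_gt_at_top[of 0] in eventually_elim, simp add: N_def powr_diff)
qed

lemma N_at_top: "filterlim N at_top sequentially"
proof -
  have "(\<lambda>n. inverse (N n)) \<longlonglongrightarrow> 0"
  proof (rule Lim_transform_eventually)
    show "(\<lambda>n. real n powr (- (1 / (2 * real m)))) \<longlonglongrightarrow> 0"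
      using m_pos by (intro tendsto_neg_powr filterlim_real_sequentially) auto
  qed (simp add: N_def powr_minus)
  then have "filterlim (\<lambda>n. inverse (inverse (N n))) at_top sequentially"
    by (rule filterlim_inverse_at_top)
      (use eventually_gt_at_top[of 0] in eventually_elim, use N_pos in auto)
  then show ?thesis by simp
qed

lemma f_isCont: "isCont f x"
  using f_deriv by (rule DERIV_isCont)

text \<open>Half of the leading coefficient is given up to absorb the error of the expansion. The
  resulting inequality, unlike the limit, can dominate an integrand.\<close>

lemma local_bound:
  assumes "a \<in> M"
  obtains \<kappa> \<delta> where "\<kappa> > 0" "\<delta> > 0" "\<And>x. \<bar>x\<bar> < \<delta> \<Longrightarrow> A (a + x) - Amax \<le> - \<kappa> * x ^ (2 * m)"
proof -
  have "\<forall>\<^sub>F x in at 0. (A (a + x) - Amax) / x ^ (2 * m) < c a / 2"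
    using expansion[OF assms] c_neg[OF assms] unfolding A_def by (intro order_tendstoD) auto
  then obtain \<delta> where \<delta>: "\<delta> > 0" "\<And>x. x \<noteq> 0 \<Longrightarrow> \<bar>x\<bar> < \<delta> \<Longrightarrow> (A (a + x) - Amax) / x ^ (2 * m) < c a / 2"
    unfolding eventually_at by (auto simp: dist_real_def)
  show ?thesis
  proof (rule that[of "- c a / 2" \<delta>])
    show "- c a / 2 > 0" using c_neg[OF assms] by simp
    fix x :: real assume x: "\<bar>x\<bar> < \<delta>"
    show "A (a + x) - Amax \<le> - (- c a / 2) * x ^ (2 * m)"
    proof (cases "x = 0")
      case True
      then show ?thesis using A_max[OF assms] m_pos by (simp add: A_def power_0_left)
    next
      case False
      then have "x ^ (2 * m) > 0" by (simp add: zero_less_power_eq)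
      then show ?thesis using \<delta>(2)[OF False x] by (simp add: pos_divide_less_eq)
    qed
  qed (use \<delta> in auto)
qed

section \<open>Sums around one maximizer as integrals of step functions\<close>

definition nbhd :: "real \<Rightarrow> real \<Rightarrow> nat \<Rightarrow> nat set" where
  "nbhd \<delta> a n = {k. k \<le> n \<and> \<bar>real k / real n - a\<bar> < \<delta>}"

lemma finite_nbhd [simp]: "finite (nbhd \<delta> a n)"
  by (rule finite_subset[of _ "{..n}"]) (auto simp: nbhd_def)

text \<open>Up to a factor independent of \<open>k\<close>, the mass of \<open>k\<close> under the
  tilted law. Subtracting \<open>Amax\<close> and \<open>v\<close> inside the exponential keeps the
  terms bounded near the maximizers with \<open>f a = v\<close>.\<close>

definition local_term :: "real \<Rightarrow> real \<Rightarrow> nat \<Rightarrow> nat \<Rightarrow> real" where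
  "local_term t v n k = binom_factor n k *
     exp (real n * (A (real k / real n) - Amax) + t * N n * (f (real k / real n) - v))"

text \<open>In the rescaled variable the lattice point \<open>k\<close> occupies an interval of
  length \<open>N / n\<close>; these intervals are disjoint and carry the constant pieces of the
  step function.\<close>

definition cell :: "real \<Rightarrow> nat \<Rightarrow> nat \<Rightarrow> real set" where
  "cell a n k = {N n * (real k / real n - a)..<N n * (real (Suc k) / real n - a)}"

definition idx :: "real \<Rightarrow> nat \<Rightarrow> real \<Rightarrow> nat" where
  "idx a n y = nat \<lfloor>real n * (a + y / N n)\<rfloor>"

lemma mem_cell_iff:
  assumes "n \<ge> 1"
  shows "y \<in> cell a n k \<longleftrightarrow> \<lfloor>real n * (a + y / N n)\<rfloor> = int k"
proof -
  have n: "real n > 0" "N n > 0" using assms N_pos by auto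
  have "y \<in> cell a n k \<longleftrightarrow> real k / real n - a \<le> y / N n \<and> y / N n < real (Suc k) / real n - a"
    unfolding cell_def using n by (simp add: pos_le_divide_eq pos_divide_less_eq mult.commute)
  also have "\<dots> \<longleftrightarrow> real k \<le> real n * (a + y / N n) \<and> real n * (a + y / N n) < real k + 1"
    using n by (auto simp: field_simps)
  also have "\<dots> \<longleftrightarrow> \<lfloor>real n * (a + y / N n)\<rfloor> = int k"
    by (auto simp: floor_eq_iff)
  finally show ?thesis .
qed

lemma cell_close:
  assumes "n \<ge> 1" "y \<in> cell a n k"
  shows "\<bar>N n * (real k / real n - a) - y\<bar> \<le> N n / real n"
proof -
  have "N n * (real (Suc k) / real n - a) = N n * (real k / real n - a) + N n / real n"
    using assms by (simp add: field_simps)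
  then show ?thesis using assms(2) by (simp add: cell_def)
qed

text \<open>Holds only eventually: for small \<open>n\<close> the point \<open>a + y / N\<close> may
  be negative, and \<open>nat\<close> would then truncate the index to 0.\<close>

lemma cell_idx:
  assumes "0 < a"
  shows "\<forall>\<^sub>F n in sequentially. y \<in> cell a n (idx a n y)"
proof -
  have "(\<lambda>n. a + y / N n) \<longlonglongrightarrow> a + 0"
    by (intro tendsto_add tendsto_const real_tendsto_divide_at_top[OF tendsto_const N_at_top])
  then have "\<forall>\<^sub>F n in sequentially. a + y / N n > 0"
    using assms by (intro order_tendstoD) auto
  then show ?thesis
    using eventually_ge_at_top[of 1]
  proof eventually_elim
    case (elim n)
    then have "\<lfloor>real n * (a + y / N n)\<rfloor> \<ge> 0" by simp
    then show ?case using elim by (simp add: mem_cell_iff idx_def)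
  qed
qed

definition step_fun :: "real \<Rightarrow> real \<Rightarrow> nat \<Rightarrow> (nat \<Rightarrow> real) \<Rightarrow> real \<Rightarrow> real" where
  "step_fun \<delta> a n h y = (\<Sum>k\<in>nbhd \<delta> a n. h k * indicator (cell a n k) y)"

lemma step_fun_eq:
  assumes "n \<ge> 1" "y \<in> cell a n k"
  shows "step_fun \<delta> a n h y = (if k \<in> nbhd \<delta> a n then h k else 0)"
proof -
  have "indicator (cell a n j) y = (of_bool (j = k) :: real)" for j
    using assms by (auto simp: indicator_def mem_cell_iff)
  then show ?thesis
    by (simp only: step_fun_def of_bool_def if_distrib[of "\<lambda>u. _ * u"] mult_1_right mult_zero_right
        sum.delta'[OF finite_nbhd] sum.delta[OF finite_nbhd])
qed

lemma measurable_step_fun [measurable]: "step_fun \<delta> a n h \<in> borel_measurable borel"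
  unfolding step_fun_def cell_def by measurable

lemma integral_step_fun:
  assumes "n \<ge> 1"
  shows "(\<integral>y. step_fun \<delta> a n h y \<partial>lborel) = N n / real n * (\<Sum>k\<in>nbhd \<delta> a n. h k)"
proof -
  have le: "N n * (real k / real n - a) \<le> N n * (real (Suc k) / real n - a)" for k
    using N_pos[OF assms] assms by (intro mult_left_mono) (auto simp: divide_right_mono)
  have meas: "measure lborel (cell a n k) = N n / real n" for k
    unfolding cell_def using le[of k] assms by (simp add: field_simps)
  have "emeasure lborel (cell a n k) < \<infinity>" for k
    unfolding cell_def using le[of k] by simp
  then have "(\<integral>y. step_fun \<delta> a n h y \<partial>lborel) = (\<Sum>k\<in>nbhd \<delta> a n. h k * measure lborel (cell a n k))"
    unfolding step_fun_def by (subst Bochner_Integration.integral_sum) (auto simp: cell_def)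
  then show ?thesis by (simp only: meas sum_distrib_right [symmetric] mult.commute)
qed

lemma ratio_tendsto:
  assumes "(\<lambda>n. N n * (real (k n) / real n - a)) \<longlonglongrightarrow> y"
  shows "(\<lambda>n. real (k n) / real n) \<longlonglongrightarrow> a"
proof -
  have "(\<lambda>n. N n * (real (k n) / real n - a) / N n) \<longlonglongrightarrow> 0"
    using assms by (rule real_tendsto_divide_at_top[OF _ N_at_top])
  then have "(\<lambda>n. real (k n) / real n - a) \<longlonglongrightarrow> 0"
    by (rule Lim_transform_eventually)
      (use eventually_ge_at_top[of 1] in eventually_elim, use N_pos in force)
  then show ?thesis by (simp add: LIM_zero_iff)
qed

text \<open>Caratheodory's form of the derivative avoids dividing by \<open>k / n - a\<close>, which
  may vanish.\<close>

lemma f_scaled_tendsto: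
  assumes z: "(\<lambda>n. N n * (real (k n) / real n - a)) \<longlonglongrightarrow> y"
  shows "(\<lambda>n. N n * (f (real (k n) / real n) - f a)) \<longlonglongrightarrow> f' a * y"
proof -
  obtain R where R: "\<And>u. f u - f a = R u * (u - a)" "isCont R a" "R a = f' a"
    using f_deriv[of a] unfolding CARAT_DERIV by blast
  have "(\<lambda>n. R (real (k n) / real n)) \<longlonglongrightarrow> R a"
    using R(2) ratio_tendsto[OF z] by (rule isCont_tendsto_compose)
  then have "(\<lambda>n. R (real (k n) / real n) * (N n * (real (k n) / real n - a))) \<longlonglongrightarrow> f' a * y"
    using z R(3) by (intro tendsto_intros) auto
  then show ?thesis by (simp add: R(1) ac_simps)
qed

lemma local_term_tendsto:
  assumes "a \<in> M" and z: "(\<lambda>n. N n * (real (k n) / real n - a)) \<longlonglongrightarrow> y"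
  shows "(\<lambda>n. local_term t (f a) n (k n)) \<longlonglongrightarrow> laplace_weight a * exp (c a * y ^ (2 * m) + t * f' a * y)"
proof -
  have a: "0 < a" "a < 1" using M_interior assms(1) by auto
  define x where "x n = real (k n) / real n - a" for n
  have ev: "\<forall>\<^sub>F n in sequentially. 1 \<le> n" by (rule eventually_ge_at_top)
  have ka: "(\<lambda>n. real (k n) / real n) \<longlonglongrightarrow> a" using z by (rule ratio_tendsto)
  then have x0: "x \<longlonglongrightarrow> 0" unfolding x_def by (simp add: LIM_zero_iff)
  \<comment> \<open>The Taylor quotient, extended continuously to 0 so that the case
    \<open>k / n = a\<close> needs no separate treatment. As \<open>N ^ (2 * m) = n\<close>,
    multiplying by \<open>n\<close> turns powers of \<open>x\<close> into powers of the rescaled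
    variable.\<close>
  define Q where "Q u = (if u = 0 then c a else (A (a + u) - Amax) / u ^ (2 * m))" for u
  have "isCont Q 0"
    unfolding isCont_def using expansion[OF assms(1)]
    by (subst Q_def, simp, subst Lim_cong_within[where g = "\<lambda>u. (F (a + u) + I_ent (a + u) - Amax) / u ^ (2 * m)"])
      (auto simp: Q_def A_def)
  then have "(\<lambda>n. Q (x n)) \<longlonglongrightarrow> Q 0" using x0 by (rule isCont_tendsto_compose)
  then have "(\<lambda>n. Q (x n) * (N n * x n) ^ (2 * m)) \<longlonglongrightarrow> c a * y ^ (2 * m)"
    using z by (intro tendsto_intros) (auto simp: Q_def x_def)
  then have 1: "(\<lambda>n. real n * (A (real (k n) / real n) - Amax)) \<longlonglongrightarrow> c a * y ^ (2 * m)"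
  proof (rule Lim_transform_eventually)
    have Q: "A (a + u) - Amax = Q u * u ^ (2 * m)" for u
      using A_max[OF assms(1)] m_pos by (auto simp: Q_def A_def power_0_left)
    show "\<forall>\<^sub>F n in sequentially. Q (x n) * (N n * x n) ^ (2 * m) = real n * (A (real (k n) / real n) - Amax)"
      using ev
    proof eventually_elim
      case (elim n)
      have "A (real (k n) / real n) - Amax = Q (x n) * x n ^ (2 * m)"
        using Q[of "x n"] by (simp add: x_def)
      then show ?case using N_power[OF elim] by (simp add: power_mult_distrib)
    qed
  qed
  have 2: "(\<lambda>n. t * N n * (f (real (k n) / real n) - f a)) \<longlonglongrightarrow> t * f' a * y"
    using tendsto_mult[OF tendsto_const[of t] f_scaled_tendsto[OF z]] by (simp only: mult.assoc)
  show ?thesis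
    unfolding local_term_def
    by (intro tendsto_intros binom_factor_tendsto a ka 1 2)
qed

text \<open>Dominated convergence for the step functions. The linear growth allowed for
  \<open>g\<close> covers the computation of means; convergence is asked only almost everywhere
  because indicators of events jump in the limit at one point.\<close>

lemma local_laplace:
  assumes a: "a \<in> M" and \<delta>: "0 < a - \<delta>" "a + \<delta> < 1" "\<delta> > 0" and \<kappa>: "\<kappa> > 0"
    and bound: "\<And>x. \<bar>x\<bar> < \<delta> \<Longrightarrow> A (a + x) - Amax \<le> - \<kappa> * x ^ (2 * m)"
    and H [measurable]: "H \<in> borel_measurable borel"
    and g: "\<And>n k. n \<ge> 1 \<Longrightarrow> k \<in> nbhd \<delta> a n \<Longrightarrow> \<bar>g n k\<bar> \<le> C * (1 + N n * \<bar>real k / real n - a\<bar>)"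
    and lim: "AE y in lborel. \<forall>k. (\<lambda>n. N n * (real (k n) / real n - a)) \<longlonglongrightarrow> y \<longrightarrow> (\<lambda>n. g n (k n)) \<longlonglongrightarrow> H y"
  shows "integrable lborel (\<lambda>y. exp (c a * y ^ (2 * m) + t * f' a * y) * H y)" (is ?int)
    and "(\<lambda>n. N n / real n * (\<Sum>k\<in>nbhd \<delta> a n. local_term t (f a) n k * g n k)) \<longlonglongrightarrow>
      laplace_weight a * (\<integral>y. exp (c a * y ^ (2 * m) + t * f' a * y) * H y \<partial>lborel)" (is ?lim)
proof -
  have a01: "0 < a" "a < 1" using M_interior a by auto
  define G where "G = (\<lambda>y. laplace_weight a * (exp (c a * y ^ (2 * m) + t * f' a * y) * H y))"
  define h where "h n k = local_term t (f a) n k * g n k" for n k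
  define s where "s n = step_fun \<delta> a n (h n)" for n
  obtain Cb where Cb: "Cb > 0" "\<And>n k. 1 \<le> n \<Longrightarrow> a - \<delta> \<le> real k / real n \<Longrightarrow> real k / real n \<le> a + \<delta> \<Longrightarrow> binom_factor n k \<le> Cb"
    using binom_factor_bounded[OF \<delta>(1,2)] by blast
  obtain E where E: "E > 0" "\<And>y z. \<bar>z - y\<bar> \<le> 1 \<Longrightarrow>
      exp (- \<kappa> * z ^ (2 * m) + \<bar>t * L\<bar> * \<bar>z\<bar>) * (1 + \<bar>z\<bar>) \<le> E * exp (- (\<kappa> / 4) * y\<^sup>2)"
    using even_power_tail_bound[OF \<kappa> abs_ge_zero m_pos, of "t * L"] by metis
  define W where "W y = Cb * \<bar>C\<bar> * E * exp (- (\<kappa> / 4) * y\<^sup>2)" for y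
  have W_nonneg: "0 \<le> W y" for y using Cb E by (simp add: W_def)
  have dom: "\<bar>s n y\<bar> \<le> W y" for n y
  proof (cases "\<exists>k. n \<ge> 1 \<and> y \<in> cell a n k \<and> k \<in> nbhd \<delta> a n")
    case True
    then obtain k where k: "n \<ge> 1" "y \<in> cell a n k" "k \<in> nbhd \<delta> a n" by blast
    define x where "x = real k / real n - a"
    define z where "z = N n * x"
    have x: "\<bar>x\<bar> < \<delta>" "k \<le> n" using k(3) by (auto simp: nbhd_def x_def)
    have zabs: "\<bar>z\<bar> = N n * \<bar>x\<bar>" using N_pos[OF k(1)] by (simp add: z_def abs_mult)
    \<comment> \<open>Cells have length at most 1, so the lattice point \<open>z\<close> is within
      distance 1 of \<open>y\<close>, the range in which the tail bound may trade \<open>z\<close>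
      for \<open>y\<close>.\<close>
    have "N n / real n \<le> 1" using N_le[OF k(1)] k(1) by simp
    then have zy: "\<bar>z - y\<bar> \<le> 1"
      using cell_close[OF k(1,2)] by (simp add: z_def x_def)
    have e1: "real n * (A (real k / real n) - Amax) \<le> - \<kappa> * z ^ (2 * m)"
    proof -
      have "real n * (A (a + x) - Amax) \<le> real n * (- \<kappa> * x ^ (2 * m))"
        using bound[OF x(1)] by (intro mult_left_mono) auto
      also have "\<dots> = - \<kappa> * z ^ (2 * m)"
        by (simp add: z_def power_mult_distrib N_power[OF k(1)])
      finally show ?thesis by (simp add: x_def)
    qed
    have e2: "t * N n * (f (real k / real n) - f a) \<le> \<bar>t * L\<bar> * \<bar>z\<bar>"
    proof -
      have "\<bar>f (real k / real n) - f a\<bar> \<le> L * \<bar>x\<bar>"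
        unfolding x_def using x(2) a01 k(1) by (intro f_lipschitz) auto
      also have "\<dots> \<le> \<bar>L\<bar> * \<bar>x\<bar>" by (intro mult_right_mono) auto
      finally have "\<bar>t * N n\<bar> * \<bar>f (real k / real n) - f a\<bar> \<le> \<bar>t * N n\<bar> * (\<bar>L\<bar> * \<bar>x\<bar>)"
        by (intro mult_left_mono) auto
      moreover have "t * N n * (f (real k / real n) - f a) \<le> \<bar>t * N n\<bar> * \<bar>f (real k / real n) - f a\<bar>"
        by (metis abs_ge_self abs_mult)
      moreover have "\<bar>t * N n\<bar> * (\<bar>L\<bar> * \<bar>x\<bar>) = \<bar>t * L\<bar> * \<bar>z\<bar>"
        using N_pos[OF k(1)] by (simp add: zabs abs_mult)
      ultimately show ?thesis by linarith
    qed
    have lt: "\<bar>local_term t (f a) n k\<bar> \<le> Cb * exp (- \<kappa> * z ^ (2 * m) + \<bar>t * L\<bar> * \<bar>z\<bar>)"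
    proof -
      have "binom_factor n k \<le> Cb"
        using x by (intro Cb(2) k) (auto simp: x_def abs_less_iff)
      then show ?thesis
        unfolding local_term_def using e1 e2 binom_factor_nonneg[of n k] Cb(1)
        by (auto simp: abs_mult intro!: mult_mono)
    qed
    have "\<bar>g n k\<bar> \<le> C * (1 + \<bar>z\<bar>)"
      using g[OF k(1,3)] by (simp add: zabs x_def)
    also have "\<dots> \<le> \<bar>C\<bar> * (1 + \<bar>z\<bar>)" by (intro mult_right_mono) auto
    finally have gk: "\<bar>g n k\<bar> \<le> \<bar>C\<bar> * (1 + \<bar>z\<bar>)" .
    have "\<bar>s n y\<bar> = \<bar>local_term t (f a) n k\<bar> * \<bar>g n k\<bar>"
      unfolding s_def h_def using k by (simp add: step_fun_eq abs_mult)
    also have "\<dots> \<le> (Cb * exp (- \<kappa> * z ^ (2 * m) + \<bar>t * L\<bar> * \<bar>z\<bar>)) * (\<bar>C\<bar> * (1 + \<bar>z\<bar>))"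
      using Cb(1) by (intro mult_mono lt gk) auto
    also have "\<dots> = Cb * \<bar>C\<bar> * (exp (- \<kappa> * z ^ (2 * m) + \<bar>t * L\<bar> * \<bar>z\<bar>) * (1 + \<bar>z\<bar>))"
      by (simp only: ac_simps)
    also have "\<dots> \<le> Cb * \<bar>C\<bar> * (E * exp (- (\<kappa> / 4) * y\<^sup>2))"
      using Cb(1) by (intro mult_left_mono E(2) zy) auto
    finally show ?thesis by (simp add: W_def mult.assoc)
  next
    case False
    have "s n y = 0"
    proof (cases "n \<ge> 1")
      case True
      then have "indicator (cell a n k) y = (0::real)" if "k \<in> nbhd \<delta> a n" for k
        using False that by (auto simp: indicator_def)
      then show ?thesis by (simp add: s_def step_fun_def)
    next
      case False
      then have "n = 0" by simp
      \<comment> \<open>For \<open>n = 0\<close> the quotient \<open>k / n\<close> is 0 by default,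
        and \<open>a > \<delta>\<close> keeps it out of the neighbourhood.\<close>
      then have "nbhd \<delta> a n = {}" using \<delta> by (auto simp: nbhd_def)
      then show ?thesis by (simp add: s_def step_fun_def)
    qed
    then show ?thesis using W_nonneg by simp
  qed
  have intW: "integrable lborel W"
    unfolding W_def using \<kappa> by (intro integrable_mult_right integrable_exp_neg_square) simp
  have conv: "AE y in lborel. (\<lambda>n. s n y) \<longlonglongrightarrow> G y"
    using lim
  proof eventually_elim
    case (elim y)
    define k where "k n = idx a n y" for n
    have ev: "\<forall>\<^sub>F n in sequentially. y \<in> cell a n (k n) \<and> n \<ge> 1"
      using cell_idx[OF a01(1), of y] eventually_ge_at_top[of 1] by eventually_elim (auto simp: k_def)
    have "(\<lambda>n. N n * (real (k n) / real n - a) - y) \<longlonglongrightarrow> 0"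
    proof (rule Lim_null_comparison[OF _ N_div_tendsto])
      show "\<forall>\<^sub>F n in sequentially. norm (N n * (real (k n) / real n - a) - y) \<le> N n / real n"
        using ev by eventually_elim (use cell_close in auto)
    qed
    then have z: "(\<lambda>n. N n * (real (k n) / real n - a)) \<longlonglongrightarrow> y" by (simp add: LIM_zero_iff)
    have "\<forall>\<^sub>F n in sequentially. \<bar>real (k n) / real n - a\<bar> < \<delta>"
      using ratio_tendsto[OF z] \<delta>(3) by (simp add: tendsto_iff dist_real_def)
    then have ev2: "\<forall>\<^sub>F n in sequentially. h n (k n) = s n y"
      using ev
    proof eventually_elim
      case (elim n)
      then have n: "n \<ge> 1" "N n > 0" "y \<in> cell a n (k n)" using N_pos by auto
      have d: "\<bar>real (k n) / real n - a\<bar> < \<delta>" using elim n by simp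
      then have "real (k n) / real n < 1" using \<delta> by (simp add: abs_less_iff)
      then have "k n \<le> n" using n by simp
      then have "k n \<in> nbhd \<delta> a n" using d by (simp add: nbhd_def)
      then show ?case unfolding s_def using n by (simp add: step_fun_eq)
    qed
    have "(\<lambda>n. h n (k n)) \<longlonglongrightarrow> laplace_weight a * exp (c a * y ^ (2 * m) + t * f' a * y) * H y"
      unfolding h_def using elim z by (intro tendsto_mult local_term_tendsto a) auto
    then have "(\<lambda>n. h n (k n)) \<longlonglongrightarrow> G y" by (simp only: G_def mult.assoc)
    then show ?case
      by (rule Lim_transform_eventually[OF _ ev2])
  qed
  have meas: "G \<in> borel_measurable lborel" "\<And>n. s n \<in> borel_measurable lborel"
    unfolding G_def s_def by measurable
  have "integrable lborel G"
    by (rule integrable_dominated_convergence[OF meas intW conv]) (use dom in auto)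
  moreover have w: "laplace_weight a > 0" using a01 by (rule laplace_weight_pos)
  ultimately show ?int unfolding G_def by simp
  have "(\<lambda>n. integral\<^sup>L lborel (s n)) \<longlonglongrightarrow> integral\<^sup>L lborel G"
    by (rule integral_dominated_convergence[OF meas intW conv]) (use dom in auto)
  then have "(\<lambda>n. integral\<^sup>L lborel (s n)) \<longlonglongrightarrow> laplace_weight a * (\<integral>y. exp (c a * y ^ (2 * m) + t * f' a * y) * H y \<partial>lborel)"
    by (simp add: G_def)
  then show ?lim
    by (rule Lim_transform_eventually)
      (use eventually_ge_at_top[of 1] in eventually_elim, simp only: s_def integral_step_fun h_def)
qed

section \<open>Patching the contributions of finitely many maximizers\<close>

lemma uniform_radius:
  "\<exists>\<delta>>0. \<forall>a\<in>M. (0 < a - \<delta> \<and> a + \<delta> < 1) \<and>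
      (\<exists>\<kappa>>0. \<forall>x. \<bar>x\<bar> < \<delta> \<longrightarrow> A (a + x) - Amax \<le> - \<kappa> * x ^ (2 * m)) \<and>
      (\<forall>b\<in>M. a \<noteq> b \<longrightarrow> 2 * \<delta> \<le> \<bar>a - b\<bar>)"
proof -
  have small: "\<forall>\<^sub>F \<delta> in at_right 0. \<delta> < e" if "e > 0" for e :: real
    using that by (auto simp: eventually_at_right_field)
  \<comment> \<open>Each of finitely many conditions holds for all small positive radii, so a common
    radius exists. The last condition makes the neighbourhoods disjoint.\<close>
  have "\<forall>\<^sub>F \<delta> in at_right 0. \<delta> > 0 \<and> (\<forall>a\<in>M. (0 < a - \<delta> \<and> a + \<delta> < 1) \<and>
      (\<exists>\<kappa>>0. \<forall>x. \<bar>x\<bar> < \<delta> \<longrightarrow> A (a + x) - Amax \<le> - \<kappa> * x ^ (2 * m)) \<and>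
      (\<forall>b\<in>M. a \<noteq> b \<longrightarrow> 2 * \<delta> \<le> \<bar>a - b\<bar>))"
  proof (intro eventually_conj eventually_ball_finite finite_M ballI)
    show "\<forall>\<^sub>F \<delta> in at_right 0. (\<delta>::real) > 0" by (simp add: eventually_at_right_less)
    fix a assume a: "a \<in> M"
    then have a01: "0 < a" "a < 1" using M_interior by auto
    show "\<forall>\<^sub>F \<delta> in at_right 0. 0 < a - \<delta>" using small[of a] a01 by simp
    show "\<forall>\<^sub>F \<delta> in at_right 0. a + \<delta> < 1"
      using small[of "1 - a"] a01 by (auto elim: eventually_mono)
    obtain \<kappa> \<delta>0 where "\<kappa> > 0" "\<delta>0 > 0" "\<And>x. \<bar>x\<bar> < \<delta>0 \<Longrightarrow> A (a + x) - Amax \<le> - \<kappa> * x ^ (2 * m)"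
      using local_bound[OF a] by blast
    then show "\<forall>\<^sub>F \<delta> in at_right 0. \<exists>\<kappa>>0. \<forall>x. \<bar>x\<bar> < \<delta> \<longrightarrow> A (a + x) - Amax \<le> - \<kappa> * x ^ (2 * m)"
      by (intro eventually_mono[OF small[of \<delta>0]]) (auto intro!: exI[of _ \<kappa>])
    fix b assume "b \<in> M"
    show "\<forall>\<^sub>F \<delta> in at_right 0. a \<noteq> b \<longrightarrow> 2 * \<delta> \<le> \<bar>a - b\<bar>"
      by (cases "a = b") (auto intro!: eventually_mono[OF small[of "\<bar>a - b\<bar> / 2"]])
  qed
  then show ?thesis
    by (rule eventually_happens'[OF trivial_limit_at_right_real])
qed

text \<open>Compactness: off the open balls around \<open>M\<close> the continuous function
  \<open>A\<close> attains its maximum, and that value is below \<open>Amax\<close>.\<close>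

lemma A_gap:
  assumes "\<delta> > 0"
  obtains \<epsilon> where "\<epsilon> > 0" "\<And>x. x \<in> {0..1} \<Longrightarrow> (\<And>a. a \<in> M \<Longrightarrow> \<delta> \<le> \<bar>x - a\<bar>) \<Longrightarrow> A x - Amax \<le> - \<epsilon>"
proof -
  define K where "K = {0..1} - (\<Union>a\<in>M. ball a \<delta>)"
  have K: "x \<in> K \<longleftrightarrow> x \<in> {0..1} \<and> (\<forall>a\<in>M. \<delta> \<le> \<bar>x - a\<bar>)" for x
    by (auto simp: K_def dist_real_def abs_minus_commute not_less)
  show ?thesis
  proof (cases "K = {}")
    case True
    then show ?thesis using K by (intro that[of 1]) auto
  next
    case False
    have "compact K" unfolding K_def by (intro compact_diff) auto
    moreover have "continuous_on K A"
      using continuous_on_subset[OF cont_A, of K] by (auto simp: K_def A_def)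
    ultimately obtain x0 where x0: "x0 \<in> K" "\<And>x. x \<in> K \<Longrightarrow> A x \<le> A x0"
      using continuous_attains_sup[OF _ False] by blast
    have "x0 \<notin> M" using x0(1) assms by (auto simp: K)
    then have "A x0 < Amax" using A_less[of x0] x0(1) by (auto simp: K A_def)
    then show ?thesis using x0 K by (intro that[of "Amax - A x0"]) (auto simp: algebra_simps)
  qed
qed

lemma abs_diff_le_1: "x \<in> {0..1} \<Longrightarrow> y \<in> {0..1} \<Longrightarrow> \<bar>x - y\<bar> \<le> 1" for x y :: real
  by (simp add: abs_le_iff)

lemma local_term_nonneg: "0 \<le> local_term t v n k"
  by (simp add: local_term_def binom_factor_nonneg)

lemma local_term_cong: "t * v = t * w \<Longrightarrow> local_term t v n k = local_term t w n k"
  by (simp add: local_term_def right_diff_distrib mult.assoc[of t] mult.left_commute[of t "N n"])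

text \<open>Stirling bounds are not uniform up to the endpoints 0 and 1, so the crude bound
  \<open>sqrt n\<close> on the binomial factor is used; the exponential loss in \<open>n\<close>
  beats every polynomial factor and the tilt, whose exponent is only of order
  \<open>N\<close>.\<close>

lemma tail_negligible:
  assumes \<epsilon>: "\<epsilon> > 0"
    and S: "\<And>n k. k \<in> S n \<Longrightarrow> k \<le> n \<and> A (real k / real n) - Amax \<le> - \<epsilon>"
    and v: "v \<in> f ` M" and C: "C \<ge> 0"
    and g: "\<And>n k. n \<ge> 1 \<Longrightarrow> k \<le> n \<Longrightarrow> \<bar>g n k\<bar> \<le> C * (1 + N n)"
  shows "(\<lambda>n. N n / real n * (\<Sum>k\<in>S n. local_term t v n k * g n k)) \<longlonglongrightarrow> 0"
proof (rule Lim_null_comparison)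
  \<comment> \<open>One half of \<epsilon> pays for the tilt, which is at most \<open>b * N\<close>.
    The factor \<open>4 * C * n ^ 3\<close> collects at most \<open>2 n\<close> terms, a binomial
    factor at most \<open>n\<close>, and the bound \<open>2 C n\<close> on \<open>g\<close>.\<close>
  define b where "b = \<bar>t * L\<bar>"
  have "(\<lambda>n. b * (N n / real n)) \<longlonglongrightarrow> b * 0" by (intro tendsto_intros N_div_tendsto)
  then have "\<forall>\<^sub>F n in sequentially. b * (N n / real n) < \<epsilon> / 2"
    using \<epsilon> by (intro order_tendstoD) auto
  then show "\<forall>\<^sub>F n in sequentially. norm (N n / real n * (\<Sum>k\<in>S n. local_term t v n k * g n k)) \<le>
      4 * C * real n ^ 3 * exp (- (\<epsilon> / 2) * real n)"
    using eventually_ge_at_top[of 1]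
  proof eventually_elim
    case (elim n)
    then have n: "real n \<ge> 1" "N n > 0" "N n \<le> real n" "b * N n \<le> \<epsilon> / 2 * real n"
      using N_pos N_le by (auto simp: pos_divide_less_eq)
    have fin: "finite (S n)" "card (S n) \<le> n + 1"
    proof -
      have "S n \<subseteq> {..n}" using S by auto
      then show "finite (S n)" "card (S n) \<le> n + 1"
        using finite_subset[of "S n" "{..n}"] card_mono[of "{..n}" "S n"] by auto
    qed
    have "\<bar>local_term t v n k * g n k\<bar> \<le> real n * exp (- (\<epsilon> / 2) * real n) * (C * (2 * real n))"
      if k: "k \<in> S n" for k
    proof -
      from v obtain a where a: "a \<in> M" "v = f a" by auto
      have "real k / real n \<in> {0..1}" "a \<in> {0..1}"
        using S[OF k] n(1) M_interior a by auto
      then have "\<bar>f (real k / real n) - v\<bar> \<le> L * \<bar>real k / real n - a\<bar>"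
        "\<bar>real k / real n - a\<bar> \<le> 1"
        unfolding a(2) by (auto intro!: f_lipschitz abs_diff_le_1)
      moreover from this have "L * \<bar>real k / real n - a\<bar> \<le> \<bar>L\<bar> * 1"
        by (intro mult_mono) auto
      ultimately have "\<bar>t * N n\<bar> * \<bar>f (real k / real n) - v\<bar> \<le> \<bar>t * N n\<bar> * \<bar>L\<bar>"
        by (intro mult_left_mono) auto
      moreover have "t * N n * (f (real k / real n) - v) \<le> \<bar>t * N n\<bar> * \<bar>f (real k / real n) - v\<bar>"
        by (metis abs_ge_self abs_mult)
      moreover have "\<bar>t * N n\<bar> * \<bar>L\<bar> = b * N n"
        using n(2) by (simp add: b_def abs_mult)
      ultimately have "t * N n * (f (real k / real n) - v) \<le> b * N n" by linarith
      moreover have "real n * (A (real k / real n) - Amax) \<le> real n * (- \<epsilon>)"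
        using S[OF k] by (intro mult_left_mono) auto
      ultimately have e: "real n * (A (real k / real n) - Amax) + t * N n * (f (real k / real n) - v) \<le> - (\<epsilon> / 2) * real n"
        using n(4) by (simp add: algebra_simps)
      have "binom_factor n k \<le> sqrt (real n)"
        using S[OF k] elim by (intro binom_factor_le_sqrt) auto
      also have "sqrt (real n) \<le> real n"
        using n(1) real_sqrt_le_mono[of "real n" "real n * real n"] by (simp add: mult_le_cancel_left1)
      finally have "\<bar>local_term t v n k\<bar> \<le> real n * exp (- (\<epsilon> / 2) * real n)"
        unfolding local_term_def abs_mult using e binom_factor_nonneg[of n k]
        by (intro mult_mono) auto
      moreover have "\<bar>g n k\<bar> \<le> C * (2 * real n)"
      proof -
        have "\<bar>g n k\<bar> \<le> C * (1 + N n)" using S[OF k] elim by (intro g) auto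
        also have "\<dots> \<le> C * (2 * real n)" using n C by (intro mult_left_mono) linarith+
        finally show ?thesis .
      qed
      ultimately show ?thesis
        unfolding abs_mult by (intro mult_mono) auto
    qed
    then have "\<bar>\<Sum>k\<in>S n. local_term t v n k * g n k\<bar> \<le> real (card (S n)) * (real n * exp (- (\<epsilon> / 2) * real n) * (C * (2 * real n)))"
      by (intro order_trans[OF sum_abs] order_trans[OF sum_bounded_above]) auto
    also have "\<dots> \<le> (2 * real n) * (real n * exp (- (\<epsilon> / 2) * real n) * (C * (2 * real n)))"
      using fin n(1) C by (intro mult_right_mono) auto
    finally have "\<bar>\<Sum>k\<in>S n. local_term t v n k * g n k\<bar> \<le> 4 * C * real n ^ 3 * exp (- (\<epsilon> / 2) * real n)"
      by (simp add: power3_eq_cube ac_simps)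
    moreover have "0 \<le> N n / real n" "N n / real n \<le> 1" using n by auto
    ultimately show ?case
      unfolding real_norm_def abs_mult
      using mult_mono[of "\<bar>N n / real n\<bar>" 1 "\<bar>\<Sum>k\<in>S n. local_term t v n k * g n k\<bar>"] by simp
  qed
  show "(\<lambda>n. 4 * C * real n ^ 3 * exp (- (\<epsilon> / 2) * real n)) \<longlonglongrightarrow> 0"
  proof -
    have "(\<lambda>n. real n ^ 3 * exp (- (\<epsilon> / 2) * real n)) \<longlonglongrightarrow> 0"
      using \<epsilon> by real_asymp
    from tendsto_mult[OF tendsto_const[of "4 * C"] this] show ?thesis by (simp add: mult.assoc)
  qed
qed

text \<open>Maximizers at which the tilt \<open>t f\<close> is not largest are suppressed by a factor
  \<open>exp (- \<eta> N n)\<close>, so that only the group \<open>G\<close> contributes.\<close>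

lemma global_laplace:
  assumes G: "G \<subseteq> M" "G \<noteq> {}" "\<And>a. a \<in> G \<Longrightarrow> t * f a = t * v" "\<And>a. a \<in> M - G \<Longrightarrow> t * f a < t * v"
    and H [measurable]: "\<And>a. H a \<in> borel_measurable borel"
    and C: "C \<ge> 0"
    and g: "\<And>n k a. n \<ge> 1 \<Longrightarrow> k \<le> n \<Longrightarrow> a \<in> G \<Longrightarrow> \<bar>g n k\<bar> \<le> C * (1 + N n * \<bar>real k / real n - a\<bar>)"
    and lim: "\<And>a. a \<in> G \<Longrightarrow> AE y in lborel. \<forall>k. (\<lambda>n. N n * (real (k n) / real n - a)) \<longlonglongrightarrow> y \<longrightarrow>
      (\<lambda>n. g n (k n)) \<longlonglongrightarrow> H a y"
  shows "\<And>a. a \<in> G \<Longrightarrow> integrable lborel (\<lambda>y. exp (c a * y ^ (2 * m) + t * f' a * y) * H a y)" (is "\<And>a. _ \<Longrightarrow> ?int a")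
    and "(\<lambda>n. N n / real n * (\<Sum>k\<le>n. local_term t v n k * g n k)) \<longlonglongrightarrow>
      (\<Sum>a\<in>G. laplace_weight a * (\<integral>y. exp (c a * y ^ (2 * m) + t * f' a * y) * H a y \<partial>lborel))" (is ?lim)
proof -
  obtain \<delta> where \<delta>: "\<delta> > 0"
    "\<And>a. a \<in> M \<Longrightarrow> 0 < a - \<delta> \<and> a + \<delta> < 1"
    "\<And>a. a \<in> M \<Longrightarrow> \<exists>\<kappa>>0. \<forall>x. \<bar>x\<bar> < \<delta> \<longrightarrow> A (a + x) - Amax \<le> - \<kappa> * x ^ (2 * m)"
    "\<And>a b. a \<in> M \<Longrightarrow> b \<in> M \<Longrightarrow> a \<noteq> b \<Longrightarrow> 2 * \<delta> \<le> \<bar>a - b\<bar>"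
    using uniform_radius by metis
  \<comment> \<open>Only \<open>t * f a = t * v\<close> is available here, not
    \<open>f a = v\<close>. In this way \<open>t = 0\<close> is covered with \<open>G = M\<close>
    and an arbitrary \<open>v\<close>.\<close>
  have near: "?int a \<and>
    (\<lambda>n. N n / real n * (\<Sum>k\<in>nbhd \<delta> a n. local_term t v n k * g n k)) \<longlonglongrightarrow>
      laplace_weight a * (\<integral>y. exp (c a * y ^ (2 * m) + t * f' a * y) * H a y \<partial>lborel)" if a: "a \<in> G" for a
  proof -
    have aM: "a \<in> M" using a G by auto
    obtain \<kappa> where \<kappa>: "\<kappa> > 0" "\<And>x. \<bar>x\<bar> < \<delta> \<Longrightarrow> A (a + x) - Amax \<le> - \<kappa> * x ^ (2 * m)"
      using \<delta>(3)[OF aM] by blast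
    show ?thesis
      using local_laplace[OF aM _ _ \<delta>(1) \<kappa> H _ lim[OF a], of C t] \<delta>(2)[OF aM] g[OF _ _ a]
      unfolding local_term_cong[OF G(3)[OF a, symmetric]] by (auto simp: nbhd_def)
  qed
  then show "?int a" if "a \<in> G" for a using that by blast
  obtain a0 where a0: "a0 \<in> G" using G(2) by blast
  have gbound: "\<bar>g n k\<bar> \<le> C * (1 + N n)" if "n \<ge> 1" "k \<le> n" for n k
  proof -
    have "real k / real n \<in> {0..1}" "a0 \<in> {0..1}" using that a0 G(1) M_interior by auto
    then have "N n * \<bar>real k / real n - a0\<bar> \<le> N n * 1"
      using N_pos[OF that(1)] by (intro mult_left_mono abs_diff_le_1) auto
    then have "C * (1 + N n * \<bar>real k / real n - a0\<bar>) \<le> C * (1 + N n)"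
      using C by (intro mult_left_mono) auto
    then show ?thesis using g[OF that a0] by linarith
  qed
  have off: "(\<lambda>n. N n / real n * (\<Sum>k\<in>nbhd \<delta> a n. local_term t v n k * g n k)) \<longlonglongrightarrow> 0"
    if a: "a \<in> M - G" for a
  proof -
    have aM: "a \<in> M" using a by auto
    obtain \<kappa> where \<kappa>: "\<kappa> > 0" "\<And>x. \<bar>x\<bar> < \<delta> \<Longrightarrow> A (a + x) - Amax \<le> - \<kappa> * x ^ (2 * m)"
      using \<delta>(3)[OF aM] by blast
    \<comment> \<open>The same sum centred at the maximizer's own value \<open>f a\<close>, which
      converges by the local result. Recentring it at \<open>v\<close> costs the factor
      \<open>exp (- \<eta> * N n)\<close>, small enough to beat the growth \<open>1 + N n\<close> of
      \<open>g\<close>.\<close>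
    define T where "T n = N n / real n * (\<Sum>k\<in>nbhd \<delta> a n. local_term t (f a) n k * 1)" for n
    define l where "l = laplace_weight a * (\<integral>y. exp (c a * y ^ (2 * m) + t * f' a * y) * 1 \<partial>lborel)"
    have T: "T \<longlonglongrightarrow> l"
      unfolding T_def l_def
      by (rule local_laplace(2)[OF aM _ _ \<delta>(1) \<kappa>, where g = "\<lambda>_ _. 1" and C = 1])
        (use \<delta>(2)[OF aM] N_pos in \<open>auto intro!: mult_nonneg_nonneg less_imp_le[of 0 "N _"]\<close>)
    define \<eta> where "\<eta> = t * v - t * f a"
    have \<eta>: "\<eta> > 0" using G(4)[OF a] by (simp add: \<eta>_def)
    show ?thesis
    proof (rule Lim_null_comparison)
      have "((\<lambda>x::real. exp (- \<eta> * x) * (1 + x)) \<longlongrightarrow> 0) at_top"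
        using \<eta> by real_asymp
      then have "(\<lambda>n. exp (- \<eta> * N n) * (1 + N n)) \<longlonglongrightarrow> 0"
        by (rule filterlim_compose[OF _ N_at_top])
      then have "(\<lambda>n. C * (exp (- \<eta> * N n) * (1 + N n)) * T n) \<longlonglongrightarrow> C * 0 * l"
        by (intro tendsto_intros T)
      then show "(\<lambda>n. C * (exp (- \<eta> * N n) * (1 + N n)) * T n) \<longlonglongrightarrow> 0" by simp
      show "\<forall>\<^sub>F n in sequentially. norm (N n / real n * (\<Sum>k\<in>nbhd \<delta> a n. local_term t v n k * g n k)) \<le>
          C * (exp (- \<eta> * N n) * (1 + N n)) * T n"
        using eventually_ge_at_top[of 1]
      proof eventually_elim
        case (elim n)
        have lt: "local_term t v n k = exp (- \<eta> * N n) * local_term t (f a) n k" for k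
          by (simp add: local_term_def \<eta>_def exp_add [symmetric] algebra_simps)
        have "norm (N n / real n * (\<Sum>k\<in>nbhd \<delta> a n. local_term t v n k * g n k)) =
            N n / real n * \<bar>\<Sum>k\<in>nbhd \<delta> a n. local_term t v n k * g n k\<bar>"
          using N_pos[OF elim] by (simp add: abs_mult)
        also have "\<dots> \<le> N n / real n * (\<Sum>k\<in>nbhd \<delta> a n. (exp (- \<eta> * N n) * local_term t (f a) n k) * (C * (1 + N n)))"
        proof (intro mult_left_mono order_trans[OF sum_abs] sum_mono)
          fix k assume k: "k \<in> nbhd \<delta> a n"
          have "\<bar>local_term t v n k * g n k\<bar> = local_term t v n k * \<bar>g n k\<bar>"
            using local_term_nonneg[of t v n k] by (simp add: abs_mult)
          also have "\<dots> \<le> local_term t v n k * (C * (1 + N n))"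
            using k by (intro mult_left_mono gbound elim local_term_nonneg) (auto simp: nbhd_def)
          finally show "\<bar>local_term t v n k * g n k\<bar> \<le> (exp (- \<eta> * N n) * local_term t (f a) n k) * (C * (1 + N n))"
            by (simp only: lt)
        qed (use N_pos[OF elim] in auto)
        also have "\<dots> = C * (exp (- \<eta> * N n) * (1 + N n)) * T n"
          by (simp add: T_def sum_distrib_left ac_simps)
        finally show ?case .
      qed
    qed
  qed
  define S where "S n = {..n} - (\<Union>a\<in>M. nbhd \<delta> a n)" for n
  obtain \<epsilon> where \<epsilon>: "\<epsilon> > 0" "\<And>x. x \<in> {0..1} \<Longrightarrow> (\<And>a. a \<in> M \<Longrightarrow> \<delta> \<le> \<bar>x - a\<bar>) \<Longrightarrow> A x - Amax \<le> - \<epsilon>"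
    using A_gap[OF \<delta>(1)] by blast
  have S: "k \<le> n \<and> A (real k / real n) - Amax \<le> - \<epsilon>" if "k \<in> S n" for n k
    using that by (auto simp: S_def nbhd_def not_less intro!: \<epsilon>(2) divide_le_eq_1[THEN iffD2])
  have rest: "(\<lambda>n. N n / real n * (\<Sum>k\<in>S n. local_term t v n k * g n k)) \<longlonglongrightarrow> 0"
    unfolding local_term_cong[OF G(3)[OF a0, symmetric]]
    by (rule tail_negligible[OF \<epsilon>(1) S _ C gbound]) (use a0 G in force)+
  have split: "(\<Sum>k\<le>n. u k) = (\<Sum>a\<in>G. \<Sum>k\<in>nbhd \<delta> a n. u k) + (\<Sum>a\<in>M - G. \<Sum>k\<in>nbhd \<delta> a n. u k) + (\<Sum>k\<in>S n. u k)" for u :: "nat \<Rightarrow> real" and n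
  proof -
    have "(\<Sum>k\<le>n. u k) = (\<Sum>k\<in>S n. u k) + (\<Sum>k\<in>(\<Union>a\<in>M. nbhd \<delta> a n). u k)"
      unfolding S_def by (rule sum.subset_diff) (auto simp: nbhd_def)
    also have "(\<Sum>k\<in>(\<Union>a\<in>M. nbhd \<delta> a n). u k) = (\<Sum>a\<in>M. \<Sum>k\<in>nbhd \<delta> a n. u k)"
    proof (rule sum.UNION_disjoint[OF finite_M])
      show "\<forall>a\<in>M. \<forall>b\<in>M. a \<noteq> b \<longrightarrow> nbhd \<delta> a n \<inter> nbhd \<delta> b n = {}"
      proof (intro ballI impI)
        fix a b assume "a \<in> M" "b \<in> M" "a \<noteq> b"
        then have "2 * \<delta> \<le> \<bar>a - b\<bar>" by (rule \<delta>(4))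
        then show "nbhd \<delta> a n \<inter> nbhd \<delta> b n = {}" by (auto simp: nbhd_def)
      qed
    qed simp
    also have "\<dots> = (\<Sum>a\<in>M - G. \<Sum>k\<in>nbhd \<delta> a n. u k) + (\<Sum>a\<in>G. \<Sum>k\<in>nbhd \<delta> a n. u k)"
      by (rule sum.subset_diff[OF G(1) finite_M])
    finally show ?thesis by simp
  qed
  have "(\<lambda>n. (\<Sum>a\<in>G. N n / real n * (\<Sum>k\<in>nbhd \<delta> a n. local_term t v n k * g n k)) +
      (\<Sum>a\<in>M - G. N n / real n * (\<Sum>k\<in>nbhd \<delta> a n. local_term t v n k * g n k)) +
      N n / real n * (\<Sum>k\<in>S n. local_term t v n k * g n k)) \<longlonglongrightarrow>
      (\<Sum>a\<in>G. laplace_weight a * (\<integral>y. exp (c a * y ^ (2 * m) + t * f' a * y) * H a y \<partial>lborel)) + (\<Sum>a\<in>M - G. 0) + 0"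
    using near by (intro tendsto_add tendsto_sum off rest) auto
  then show ?lim
    unfolding split by (simp add: ring_distribs sum_distrib_left)
qed

end

lemma cw_prob_diff:
  assumes "\<And>k. k \<le> n \<Longrightarrow> B k \<or> (P k \<longleftrightarrow> Q k)"
  shows "\<bar>cw_prob F n P - cw_prob F n Q\<bar> \<le> cw_prob F n B"
proof -
  have "\<bar>(\<Sum>k\<le>n. cw_mass F n k * of_bool (P k)) - (\<Sum>k\<le>n. cw_mass F n k * of_bool (Q k))\<bar> \<le>
      (\<Sum>k\<le>n. cw_mass F n k * of_bool (B k))"
    unfolding sum_subtractf [symmetric] using assms
    by (intro order_trans[OF sum_abs] sum_mono) (auto simp: cw_mass_nonneg of_bool_def)
  then show ?thesis
    using cw_total_pos[of F n]
    by (simp add: cw_prob_def diff_divide_distrib [symmetric] divide_right_mono)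
qed

section \<open>Normalised sums, tilted means and the law of the estimator\<close>

context cw_laplace
begin

abbreviation tilt :: "real \<Rightarrow> nat \<Rightarrow> real \<Rightarrow> real" where
  "tilt t n \<equiv> \<lambda>x. F x + t * N n / real n * f x"

text \<open>The prefactor does not involve \<open>k\<close>, so it cancels in every normalised sum;
  this is also why the centring value \<open>v\<close> may be chosen freely there.\<close>

lemma local_term_eq_cw_mass:
  assumes "n \<ge> 1"
  shows "local_term t v n k = sqrt (real n) * exp (- real n * Amax - t * N n * v) *
    cw_mass (tilt t n) n k"
proof -
  let ?x = "real k / real n"
  have "- real n * I_ent ?x + (real n * (A ?x - Amax) + t * N n * (f ?x - v)) =
      (- real n * Amax - t * N n * v) + real n * (F ?x + t * N n / real n * f ?x)"
    using assms by (simp add: A_def algebra_simps)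
  then have "exp (- real n * I_ent ?x) * exp (real n * (A ?x - Amax) + t * N n * (f ?x - v)) =
      exp (- real n * Amax - t * N n * v) * exp (real n * (F ?x + t * N n / real n * f ?x))"
    unfolding exp_add [symmetric] by simp
  then show ?thesis
    unfolding local_term_def binom_factor_def cw_mass_def by (simp only: ac_simps)
qed

lemma local_term_ratio:
  assumes "n \<ge> 1"
  shows "(\<Sum>k\<le>n. cw_mass (tilt t n) n k * g k) / cw_total (tilt t n) n =
    (N n / real n * (\<Sum>k\<le>n. local_term t v n k * g k)) / (N n / real n * (\<Sum>k\<le>n. local_term t v n k * 1))"
  unfolding local_term_eq_cw_mass[OF assms] mult.assoc sum_distrib_left [symmetric] cw_total_def
  using assms N_pos[OF assms] by simp

definition tilted_int :: "real \<Rightarrow> real \<Rightarrow> (real \<Rightarrow> real) \<Rightarrow> real" where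
  "tilted_int a t h = laplace_weight a * (\<integral>y. exp (c a * y ^ (2 * m) + t * f' a * y) * h y \<partial>lborel)"

lemma tilted_int_pos:
  assumes "a \<in> M"
  shows "tilted_int a t (\<lambda>_. 1) > 0"
proof -
  obtain \<delta> where \<delta>: "\<delta> > 0" "0 < a - \<delta>" "a + \<delta> < 1"
    and "\<exists>\<kappa>>0. \<forall>x. \<bar>x\<bar> < \<delta> \<longrightarrow> A (a + x) - Amax \<le> - \<kappa> * x ^ (2 * m)"
    using uniform_radius assms by metis
  then obtain \<kappa> where \<kappa>: "\<kappa> > 0" "\<And>x. \<bar>x\<bar> < \<delta> \<Longrightarrow> A (a + x) - Amax \<le> - \<kappa> * x ^ (2 * m)" by blast
  have int: "integrable lborel (\<lambda>y. exp (c a * y ^ (2 * m) + t * f' a * y) * 1)"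
    by (rule local_laplace(1)[OF assms \<delta>(2,3,1) \<kappa>, where g = "\<lambda>_ _. 1" and C = 1])
      (auto intro!: mult_nonneg_nonneg less_imp_le[of 0 "N _"] N_pos)
  have "(\<integral>y. exp (c a * y ^ (2 * m) + t * f' a * y) \<partial>lborel) \<noteq> 0"
    using int by (subst integral_nonneg_eq_0_iff_AE) (auto simp: AE_iff_measurable[OF _ refl])
  then have "(\<integral>y. exp (c a * y ^ (2 * m) + t * f' a * y) \<partial>lborel) > 0"
    by (intro le_neq_trans) (auto intro!: integral_nonneg)
  then show ?thesis
    using assms M_interior laplace_weight_pos[of a] by (auto simp: tilted_int_def)
qed

lemma ratio_limit:
  assumes G: "G \<subseteq> M" "G \<noteq> {}" "\<And>a. a \<in> G \<Longrightarrow> t * f a = t * v" "\<And>a. a \<in> M - G \<Longrightarrow> t * f a < t * v"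
    and H [measurable]: "\<And>a. H a \<in> borel_measurable borel"
    and C: "C \<ge> 0"
    and g: "\<And>n k a. n \<ge> 1 \<Longrightarrow> k \<le> n \<Longrightarrow> a \<in> G \<Longrightarrow> \<bar>g n k\<bar> \<le> C * (1 + N n * \<bar>real k / real n - a\<bar>)"
    and lim: "\<And>a. a \<in> G \<Longrightarrow> AE y in lborel. \<forall>k. (\<lambda>n. N n * (real (k n) / real n - a)) \<longlonglongrightarrow> y \<longrightarrow>
      (\<lambda>n. g n (k n)) \<longlonglongrightarrow> H a y"
  shows "(\<lambda>n. (\<Sum>k\<le>n. cw_mass (tilt t n) n k * g n k) /
        cw_total (tilt t n) n) \<longlonglongrightarrow>
      (\<Sum>a\<in>G. tilted_int a t (H a)) / (\<Sum>a\<in>G. tilted_int a t (\<lambda>_. 1))"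
proof -
  have "(\<lambda>n. N n / real n * (\<Sum>k\<le>n. local_term t v n k * g n k)) \<longlonglongrightarrow> (\<Sum>a\<in>G. tilted_int a t (H a))"
    unfolding tilted_int_def by (rule global_laplace(2)[OF G H C g lim])
  moreover have "(\<lambda>n. N n / real n * (\<Sum>k\<le>n. local_term t v n k * 1)) \<longlonglongrightarrow> (\<Sum>a\<in>G. tilted_int a t (\<lambda>_. 1))"
    unfolding tilted_int_def
    by (rule global_laplace(2)[OF G, where g = "\<lambda>_ _. 1" and C = 1])
      (auto intro!: mult_nonneg_nonneg less_imp_le[of 0 "N _"] N_pos)
  moreover have "(\<Sum>a\<in>G. tilted_int a t (\<lambda>_. 1)) \<noteq> 0"
  proof -
    have "(\<Sum>a\<in>G. tilted_int a t (\<lambda>_. 1)) > 0"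
      using G finite_subset[OF G(1) finite_M] by (intro sum_pos tilted_int_pos) auto
    then show ?thesis by simp
  qed
  ultimately have "(\<lambda>n. N n / real n * (\<Sum>k\<le>n. local_term t v n k * g n k) / (N n / real n * (\<Sum>k\<le>n. local_term t v n k * 1))) \<longlonglongrightarrow>
      (\<Sum>a\<in>G. tilted_int a t (H a)) / (\<Sum>a\<in>G. tilted_int a t (\<lambda>_. 1))"
    by (rule tendsto_divide)
  then show ?thesis
    by (rule Lim_transform_eventually)
      (use eventually_ge_at_top[of 1] in eventually_elim, rule local_term_ratio[symmetric])
qed

text \<open>Applied with \<open>g = N * (f - v)\<close>, whose growth is linear by the Lipschitz
  bound. The strict inequality off \<open>G\<close> forces \<open>G = M\<close> when
  \<open>t = 0\<close>, so that case is available only if \<open>f\<close> is constant on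
  \<open>M\<close>.\<close>

lemma mean_limit:
  assumes G: "G \<subseteq> M" "G \<noteq> {}" "\<And>a. a \<in> G \<Longrightarrow> f a = v" "\<And>a. a \<in> M - G \<Longrightarrow> t * f a < t * v"
  shows "(\<lambda>n. N n * (cw_mean (tilt t n) n f - v)) \<longlonglongrightarrow>
    (\<Sum>a\<in>G. tilted_int a t (\<lambda>y. f' a * y)) / (\<Sum>a\<in>G. tilted_int a t (\<lambda>_. 1))"
proof (rule Lim_transform_eventually)
  show "(\<lambda>n. (\<Sum>k\<le>n. cw_mass (tilt t n) n k * (N n * (f (real k / real n) - v))) /
        cw_total (tilt t n) n) \<longlonglongrightarrow>
    (\<Sum>a\<in>G. tilted_int a t (\<lambda>y. f' a * y)) / (\<Sum>a\<in>G. tilted_int a t (\<lambda>_. 1))"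
  proof (rule ratio_limit[OF G(1,2) _ G(4), where C = "\<bar>L\<bar>"])
    fix n k :: nat and a :: real assume n: "n \<ge> 1" "k \<le> n" "a \<in> G"
    then have "real k / real n \<in> {0..1}" "a \<in> {0..1}" "f a = v" using G(1,3) M_interior by auto
    then have "\<bar>f (real k / real n) - v\<bar> \<le> L * \<bar>real k / real n - a\<bar>"
      using f_lipschitz[of "real k / real n" a] by simp
    then have "N n * \<bar>f (real k / real n) - v\<bar> \<le> N n * (L * \<bar>real k / real n - a\<bar>)"
      using N_pos[OF n(1)] by (intro mult_left_mono) auto
    also have "\<dots> \<le> \<bar>L\<bar> * (N n * \<bar>real k / real n - a\<bar>)"
      using N_pos[OF n(1)] mult_right_mono[OF abs_ge_self[of L], of "N n * \<bar>real k / real n - a\<bar>"]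
      by (simp add: ac_simps)
    also have "\<dots> \<le> \<bar>L\<bar> * (1 + N n * \<bar>real k / real n - a\<bar>)"
      by (intro mult_left_mono) auto
    finally show "\<bar>N n * (f (real k / real n) - v)\<bar> \<le> \<bar>L\<bar> * (1 + N n * \<bar>real k / real n - a\<bar>)"
      using N_pos[OF n(1)] by (simp add: abs_mult)
  next
    fix a assume "a \<in> G"
    then show "AE y in lborel. \<forall>k. (\<lambda>n. N n * (real (k n) / real n - a)) \<longlonglongrightarrow> y \<longrightarrow>
        (\<lambda>n. N n * (f (real (k n) / real n) - v)) \<longlonglongrightarrow> f' a * y"
      using f_scaled_tendsto[where a = a] G(3) by auto
  qed (use G in auto)
  show "\<forall>\<^sub>F n in sequentially.
      (\<Sum>k\<le>n. cw_mass (tilt t n) n k * (N n * (f (real k / real n) - v))) /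
        cw_total (tilt t n) n =
      N n * (cw_mean (tilt t n) n f - v)"
  proof (intro always_eventually allI)
    fix n
    define W where "W = cw_mass (tilt t n) n"
    define T where "T = cw_total (tilt t n) n"
    have T: "T = (\<Sum>k\<le>n. W k)" "T \<noteq> 0"
      using cw_total_pos[of "tilt t n" n] by (auto simp: T_def W_def cw_total_def)
    have "(\<Sum>k\<le>n. W k * (N n * (f (real k / real n) - v))) = N n * ((\<Sum>k\<le>n. W k * f (real k / real n)) - v * T)"
      by (simp add: T(1) sum_distrib_left sum_subtractf algebra_simps)
    then have "(\<Sum>k\<le>n. W k * (N n * (f (real k / real n) - v))) / T = N n * ((\<Sum>k\<le>n. W k * f (real k / real n)) / T - v)"
      using T(2) by (simp add: diff_divide_distrib right_diff_distrib)
    then show "(\<Sum>k\<le>n. cw_mass (tilt t n) n k * (N n * (f (real k / real n) - v))) /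
        cw_total (tilt t n) n =
      N n * (cw_mean (tilt t n) n f - v)"
      by (simp only: W_def T_def cw_mean_def)
  qed
qed

lemma prob_ratio_limit:
  assumes H: "\<And>a. H a \<in> borel_measurable borel"
    and lim: "\<And>a. a \<in> M \<Longrightarrow> AE y in lborel. \<forall>k. (\<lambda>n. N n * (real (k n) / real n - a)) \<longlonglongrightarrow> y \<longrightarrow>
      (\<lambda>n. of_bool (P n (k n))) \<longlonglongrightarrow> H a y"
  shows "(\<lambda>n. cw_prob F n (P n)) \<longlonglongrightarrow> (\<Sum>a\<in>M. tilted_int a 0 (H a)) / (\<Sum>a\<in>M. tilted_int a 0 (\<lambda>_. 1))"
proof -
  have 1: "1 \<le> 1 + N n * \<bar>u\<bar>" if "n \<ge> 1" for n u
    using N_pos[OF that] by simp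
  have "(\<lambda>n. (\<Sum>k\<le>n. cw_mass (\<lambda>x. F x + 0 * N n / real n * f x) n k * of_bool (P n k)) /
        cw_total (\<lambda>x. F x + 0 * N n / real n * f x) n) \<longlonglongrightarrow>
      (\<Sum>a\<in>M. tilted_int a 0 (H a)) / (\<Sum>a\<in>M. tilted_int a 0 (\<lambda>_. 1))"
    by (rule ratio_limit[where v = 0 and C = 1, OF _ M_nonempty _ _ H _ _ lim])
      (use 1 in \<open>auto simp: of_bool_def intro: order_trans[OF zero_le_one]\<close>)
  then show ?thesis by (simp add: cw_prob_def)
qed

text \<open>The threshold differs from \<open>v\<close> by about \<open>w / N\<close>. A maximizer
  with \<open>f a \<noteq> v\<close> lies on a definite side of it, whereas at
  \<open>f a = v\<close> the fluctuations of \<open>f\<close> have the size of that difference and a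
  nontrivial event survives.\<close>

lemma prob_limit:
  assumes \<theta>: "(\<lambda>n. N n * (\<theta> n - v)) \<longlonglongrightarrow> w"
  shows "(\<lambda>n. cw_prob F n (\<lambda>k. f (real k / real n) \<le> \<theta> n)) \<longlonglongrightarrow>
    (\<Sum>a\<in>M. tilted_int a 0 (\<lambda>y. of_bool (if f a = v then f' a * y \<le> w else f a < v))) /
    (\<Sum>a\<in>M. tilted_int a 0 (\<lambda>_. 1))"
proof (rule prob_ratio_limit)
  fix a assume a: "a \<in> M"
  have "(\<lambda>n. N n * (\<theta> n - v) / N n) \<longlonglongrightarrow> 0"
    using \<theta> by (rule real_tendsto_divide_at_top[OF _ N_at_top])
  then have "(\<lambda>n. \<theta> n - v) \<longlonglongrightarrow> 0"
    by (rule Lim_transform_eventually)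
      (use eventually_ge_at_top[of 1] in eventually_elim, use N_pos in force)
  then have \<theta>v: "\<theta> \<longlonglongrightarrow> v" by (simp add: LIM_zero_iff)
  \<comment> \<open>The limiting event is undecided only where \<open>f' a * y = w\<close>; since
    \<open>f' a\<close> is nonzero, this is one point.\<close>
  have "AE y in lborel. y \<noteq> w / f' a" by (rule AE_lborel_singleton)
  then show "AE y in lborel. \<forall>k. (\<lambda>n. N n * (real (k n) / real n - a)) \<longlonglongrightarrow> y \<longrightarrow>
      (\<lambda>n. of_bool (f (real (k n) / real n) \<le> \<theta> n)) \<longlonglongrightarrow>
        (of_bool (if f a = v then f' a * y \<le> w else f a < v) :: real)"
  proof eventually_elim
    case (elim y)
    show ?case
    proof (intro allI impI)
      fix k assume z: "(\<lambda>n. N n * (real (k n) / real n - a)) \<longlonglongrightarrow> y"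
      have fk: "(\<lambda>n. f (real (k n) / real n)) \<longlonglongrightarrow> f a"
        using f_isCont ratio_tendsto[OF z] by (rule isCont_tendsto_compose)
      have "\<forall>\<^sub>F n in sequentially. of_bool (f (real (k n) / real n) \<le> \<theta> n) =
          (of_bool (if f a = v then f' a * y \<le> w else f a < v) :: real)"
      proof (cases "f a = v")
        case True
        have ne: "f' a * y \<noteq> w" using elim f'_nonzero[OF a] by (auto simp: field_simps)
        have d: "(\<lambda>n. N n * (f (real (k n) / real n) - v) - N n * (\<theta> n - v)) \<longlonglongrightarrow> f' a * y - w"
          using f_scaled_tendsto[OF z] \<theta> True by (intro tendsto_diff) auto
        have eq: "N n * (f (real (k n) / real n) - v) - N n * (\<theta> n - v) \<le> 0 \<longleftrightarrow> f (real (k n) / real n) \<le> \<theta> n" if "n \<ge> 1" for n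
          using N_pos[OF that] by (simp add: mult_le_cancel_left_pos)
        show ?thesis
        proof (cases "f' a * y \<le> w")
          case le: True
          then have "\<forall>\<^sub>F n in sequentially. N n * (f (real (k n) / real n) - v) - N n * (\<theta> n - v) < 0"
            using ne by (intro order_tendstoD(2)[OF d]) auto
          then show ?thesis using eventually_ge_at_top[of 1]
          proof eventually_elim
            case (elim n)
            then have "f (real (k n) / real n) \<le> \<theta> n" using eq[of n] by linarith
            then show ?case using True le by simp
          qed
        next
          case False
          then have "\<forall>\<^sub>F n in sequentially. N n * (f (real (k n) / real n) - v) - N n * (\<theta> n - v) > 0"
            by (intro order_tendstoD(1)[OF d]) auto
          then show ?thesis using eventually_ge_at_top[of 1]
          proof eventually_elim
            case (elim n)
            then have "\<not> f (real (k n) / real n) \<le> \<theta> n" using eq[of n] by linarith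
            then show ?case using True False by simp
          qed
        qed
      next
        case False
        have d: "(\<lambda>n. f (real (k n) / real n) - \<theta> n) \<longlonglongrightarrow> f a - v" by (intro tendsto_diff fk \<theta>v)
        show ?thesis
        proof (cases "f a < v")
          case True
          then have "\<forall>\<^sub>F n in sequentially. f (real (k n) / real n) - \<theta> n < 0"
            by (intro order_tendstoD(2)[OF d]) auto
          then show ?thesis by eventually_elim (use True False in auto)
        next
          case ge: False
          then have "\<forall>\<^sub>F n in sequentially. f (real (k n) / real n) - \<theta> n > 0"
            using False by (intro order_tendstoD(1)[OF d]) auto
          then show ?thesis by eventually_elim (use ge False in auto)
        qed
      qed
      then show "(\<lambda>n. of_bool (f (real (k n) / real n) \<le> \<theta> n)) \<longlonglongrightarrow>
        (of_bool (if f a = v then f' a * y \<le> w else f a < v) :: real)"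
        by (rule tendsto_eventually)
    qed
  qed
qed simp

text \<open>Exactly the condition under which the moment equation is known to have a root for the
  observation \<open>k\<close>; for an extremal observation the estimator is an unspecified
  value.\<close>

definition straddled :: "nat \<Rightarrow> nat \<Rightarrow> bool" where
  "straddled n k \<longleftrightarrow> (\<exists>i\<le>n. \<exists>j\<le>n. f (real i / real n) < f (real k / real n) \<and> f (real k / real n) < f (real j / real n))"

text \<open>As \<open>f' a\<close> is nonzero and \<open>f'\<close> is continuous, \<open>f\<close>
  is strictly monotone near \<open>a\<close>, and the lattice neighbours \<open>k - 1\<close> and
  \<open>k + 1\<close> supply a smaller and a larger value. The sign \<open>s\<close> treats
  increasing and decreasing \<open>f\<close> together.\<close>

lemma straddled_near:
  assumes "a \<in> M"
  obtains \<delta> where "\<delta> > 0" "\<And>n k. n \<ge> 1 \<Longrightarrow> 1 / real n < \<delta> \<Longrightarrow> \<bar>real k / real n - a\<bar> < \<delta> \<Longrightarrow> straddled n k"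
proof -
  have a: "0 < a" "a < 1" using assms M_interior by auto
  define s where "s = sgn (f' a)"
  have "isCont (\<lambda>x. s * f' x) a" unfolding s_def by (intro continuous_intros f'_cont)
  moreover have sa: "s * f' a > 0" using f'_nonzero[OF assms] by (simp add: s_def sgn_if)
  ultimately have "\<forall>\<^sub>F x in at a. s * f' x > 0"
    unfolding isCont_def by (rule order_tendstoD(1))
  then obtain e0 where e0: "e0 > 0" "\<And>x. x \<noteq> a \<Longrightarrow> \<bar>x - a\<bar> < e0 \<Longrightarrow> s * f' x > 0"
    unfolding eventually_at by (auto simp: dist_real_def)
  define e where "e = min e0 (min a (1 - a))"
  have e: "e > 0" "\<And>x. \<bar>x - a\<bar> < e \<Longrightarrow> s * f' x > 0 \<and> 0 < x \<and> x < 1"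
  proof -
    show "e > 0" using e0 a by (simp add: e_def)
    fix x assume "\<bar>x - a\<bar> < e"
    then show "s * f' x > 0 \<and> 0 < x \<and> x < 1"
      using e0(2)[of x] sa by (cases "x = a") (use a in \<open>auto simp: e_def abs_less_iff\<close>)
  qed
  have incr: "s * f x < s * f y" if "x < y" "\<bar>x - a\<bar> < e" "\<bar>y - a\<bar> < e" for x y
  proof (rule DERIV_pos_imp_increasing[OF that(1)])
    fix u assume "x \<le> u" "u \<le> y"
    then have "\<bar>u - a\<bar> < e" using that by linarith
    then show "\<exists>z. ((\<lambda>x. s * f x) has_real_derivative z) (at u) \<and> 0 < z"
      using e(2)[of u] DERIV_cmult[OF f_deriv, of s u] by blast
  qed
  have s: "s = 1 \<or> s = - 1" using f'_nonzero[OF assms] by (auto simp: s_def sgn_if)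
  show ?thesis
  proof (rule that[of "e / 2"])
    show "e / 2 > 0" using e by simp
    fix n k :: nat assume n: "n \<ge> 1" "1 / real n < e / 2" and k: "\<bar>real k / real n - a\<bar> < e / 2"
    have kn: "0 < real k / real n" "real k / real n < 1" using e k by auto
    then have k0: "k \<ge> 1" "k < n" using n by (auto simp: zero_less_divide_iff)
    have r: "real (k - 1) / real n = real k / real n - 1 / real n" "real (k + 1) / real n = real k / real n + 1 / real n"
      using k0 by (auto simp: diff_divide_distrib add_divide_distrib of_nat_diff)
    have n0: "1 / real n > 0" using n by simp
    have "s * f (real (k - 1) / real n) < s * f (real k / real n)" "s * f (real k / real n) < s * f (real (k + 1) / real n)"
      unfolding r by (rule incr; use n0 n k in linarith)+
    moreover have "k - 1 \<le> n" "k + 1 \<le> n" using k0 by auto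
    ultimately show "straddled n k"
      using s unfolding straddled_def by fastforce
  qed
qed

text \<open>The law concentrates near the maximizers, where every observation is straddled once the
  lattice is fine enough.\<close>

lemma extremal_negligible: "(\<lambda>n. cw_prob F n (\<lambda>k. \<not> straddled n k)) \<longlonglongrightarrow> 0"
proof -
  have "(\<lambda>n. cw_prob F n (\<lambda>k. \<not> straddled n k)) \<longlonglongrightarrow>
      (\<Sum>a\<in>M. tilted_int a 0 (\<lambda>_. 0)) / (\<Sum>a\<in>M. tilted_int a 0 (\<lambda>_. 1))"
  proof (rule prob_ratio_limit)
    fix a assume a: "a \<in> M"
    obtain \<delta> where \<delta>: "\<delta> > 0" "\<And>n k. n \<ge> 1 \<Longrightarrow> 1 / real n < \<delta> \<Longrightarrow> \<bar>real k / real n - a\<bar> < \<delta> \<Longrightarrow> straddled n k"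
      using straddled_near[OF a] by blast
    have small: "\<forall>\<^sub>F n in sequentially. 1 / real n < \<delta>"
      using \<delta>(1) by (intro order_tendstoD(2)[OF lim_1_over_n])
    have "(\<lambda>n. of_bool (\<not> straddled n (k n)) :: real) \<longlonglongrightarrow> 0"
      if "(\<lambda>n. N n * (real (k n) / real n - a)) \<longlonglongrightarrow> y" for k y
    proof (rule tendsto_eventually)
      have "\<forall>\<^sub>F n in sequentially. \<bar>real (k n) / real n - a\<bar> < \<delta>"
        using ratio_tendsto[OF that] \<delta>(1) by (simp add: tendsto_iff dist_real_def)
      then show "\<forall>\<^sub>F n in sequentially. of_bool (\<not> straddled n (k n)) = (0 :: real)"
        using small eventually_ge_at_top[of 1] by eventually_elim (use \<delta>(2) in simp)
    qed
    then show "AE y in lborel. \<forall>k. (\<lambda>n. N n * (real (k n) / real n - a)) \<longlonglongrightarrow> y \<longrightarrow>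
        (\<lambda>n. of_bool (\<not> straddled n (k n)) :: real) \<longlonglongrightarrow> 0" by auto
  qed simp
  then show ?thesis by (simp add: tilted_int_def)
qed

text \<open>The threshold \<open>w\<close> is computed with the tilt \<open>t\<close> and involves
  only the selected group \<open>G\<close>; the probability is computed without tilt, so every
  maximizer enters with its own weight. The normalisation is \<open>n / N\<close>, so a rescaled
  error \<open>t\<close> is a parameter shift by \<open>t * N / n\<close>.\<close>

lemma mle_limit:
  assumes F: "F = (\<lambda>x. F0 x + \<gamma> * f x)"
    and G: "G \<subseteq> M" "G \<noteq> {}" "\<And>a. a \<in> G \<Longrightarrow> f a = v" "\<And>a. a \<in> M - G \<Longrightarrow> t * f a < t * v"
  defines "w \<equiv> (\<Sum>a\<in>G. tilted_int a t (\<lambda>y. f' a * y)) / (\<Sum>a\<in>G. tilted_int a t (\<lambda>_. 1))"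
  shows "(\<lambda>n. cw_prob F n (\<lambda>k. real n powr (1 - 1 / (2 * real m)) * (cw_mle F0 f n (f (real k / real n)) - \<gamma>) \<le> t)) \<longlonglongrightarrow>
    (\<Sum>a\<in>M. tilted_int a 0 (\<lambda>y. of_bool (if f a = v then f' a * y \<le> w else f a < v))) /
    (\<Sum>a\<in>M. tilted_int a 0 (\<lambda>_. 1))"
proof -
  define \<theta> where "\<theta> n = cw_mean (tilt t n) n f" for n
  define P where "P n k \<longleftrightarrow> real n powr (1 - 1 / (2 * real m)) * (cw_mle F0 f n (f (real k / real n)) - \<gamma>) \<le> t" for n k
  have Q: "(\<lambda>n. cw_prob F n (\<lambda>k. f (real k / real n) \<le> \<theta> n)) \<longlonglongrightarrow>
    (\<Sum>a\<in>M. tilted_int a 0 (\<lambda>y. of_bool (if f a = v then f' a * y \<le> w else f a < v))) /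
    (\<Sum>a\<in>M. tilted_int a 0 (\<lambda>_. 1))"
    unfolding w_def \<theta>_def by (rule prob_limit, rule mean_limit[OF G])
  have eq: "P n k \<longleftrightarrow> f (real k / real n) \<le> \<theta> n" if n: "n \<ge> 1" and s: "straddled n k" for n k
  proof -
    have pw: "real n powr (1 - 1 / (2 * real m)) = real n / N n"
      using n by (simp add: powr_diff N_def)
    have "P n k \<longleftrightarrow> cw_mle F0 f n (f (real k / real n)) \<le> \<gamma> + t * N n / real n"
      unfolding P_def pw using n N_pos[OF n] by (simp add: field_simps)
    also have "\<dots> \<longleftrightarrow> f (real k / real n) \<le> cw_mean (\<lambda>x. F0 x + (\<gamma> + t * N n / real n) * f x) n f"
    proof -
      obtain i j where "i \<le> n" "j \<le> n" "f (real i / real n) < f (real k / real n)" "f (real k / real n) < f (real j / real n)"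
        using s unfolding straddled_def by blast
      then show ?thesis by (rule cw_mle_le_iff[OF _ _ _ _ n])
    qed
    also have "(\<lambda>x. F0 x + (\<gamma> + t * N n / real n) * f x) = (tilt t n)"
      unfolding F by (simp add: fun_eq_iff distrib_right)
    finally show ?thesis by (simp add: \<theta>_def)
  qed
  have "(\<lambda>n. cw_prob F n (P n) - cw_prob F n (\<lambda>k. f (real k / real n) \<le> \<theta> n)) \<longlonglongrightarrow> 0"
  proof (rule Lim_null_comparison[OF _ extremal_negligible])
    show "\<forall>\<^sub>F n in sequentially. norm (cw_prob F n (P n) - cw_prob F n (\<lambda>k. f (real k / real n) \<le> \<theta> n)) \<le>
        cw_prob F n (\<lambda>k. \<not> straddled n k)"
      using eventually_ge_at_top[of 1]
      by eventually_elim (use eq in \<open>auto intro!: cw_prob_diff\<close>)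
  qed
  from tendsto_add[OF this Q] show ?thesis unfolding P_def by simp
qed

end

section \<open>Limit laws\<close>

lemma measure_density_lborel:
  fixes g :: "real \<Rightarrow> real"
  assumes "integrable lborel g" "\<And>x. 0 \<le> g x" "S \<in> sets borel"
  shows "measure (density lborel (\<lambda>x. ennreal (g x))) S = (\<integral>x. g x * indicator S x \<partial>lborel)"
proof -
  have [measurable]: "g \<in> borel_measurable borel" using assms(1) by simp
  have int: "integrable lborel (\<lambda>x. g x * indicator S x)"
    using integrable_mult_indicator[OF _ assms(1), of S] assms(3) by (simp add: mult.commute)
  have "emeasure (density lborel (\<lambda>x. ennreal (g x))) S = (\<integral>\<^sup>+x. ennreal (g x * indicator S x) \<partial>lborel)"
    using assms(3) by (subst emeasure_density) (auto intro!: nn_integral_cong split: split_indicator)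
  also have "\<dots> = ennreal (\<integral>x. g x * indicator S x \<partial>lborel)"
    using assms(2) by (intro nn_integral_eq_integral int) auto
  finally show ?thesis
    using assms(2) by (simp add: measure_def integral_nonneg)
qed

subsection \<open>Gaussian limits\<close>

lemma real_distribution_normal_law:
  assumes "v > 0"
  shows "real_distribution (normal_law v)"
proof -
  interpret prob_space "normal_law v"
    unfolding normal_law_def using assms by (intro prob_space_normal_density) simp
  show ?thesis by unfold_locales (simp_all add: normal_law_def)
qed

lemma measure_normal_law:
  "S \<in> sets borel \<Longrightarrow> measure (normal_law v) S = (\<integral>x. normal_density 0 (sqrt v) x * indicator S x \<partial>lborel)"
  if "v > 0"
  unfolding normal_law_def using that by (intro measure_density_lborel) auto

lemma exp_square_eq_normal_density:
  fixes c d t :: real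
  assumes "c < 0"
  defines "s \<equiv> sqrt (- 1 / (2 * c))"
  shows "exp (c * y\<^sup>2 + t * d * y) =
    (exp (- c * (t * d * s\<^sup>2)\<^sup>2) * sqrt (2 * pi * s\<^sup>2)) * normal_density (t * d * s\<^sup>2) s y"
proof -
  define \<mu> where "\<mu> = t * d * s\<^sup>2"
  have s2: "s\<^sup>2 = - 1 / (2 * c)" using assms by (simp add: s_def)
  have s: "s > 0" using assms by (simp add: s_def divide_neg_neg)
  have "2 * c * \<mu> = - (t * d)" using assms by (simp add: \<mu>_def s2)
  then have "2 * c * \<mu> * y = - (t * d) * y" by simp
  then have "c * y\<^sup>2 + t * d * y = - c * \<mu>\<^sup>2 + c * (y - \<mu>)\<^sup>2"
    by (simp add: power2_eq_square algebra_simps)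
  moreover have "c * (y - \<mu>)\<^sup>2 = - (y - \<mu>)\<^sup>2 / (2 * s\<^sup>2)"
    using assms by (simp add: s2)
  ultimately have "exp (c * y\<^sup>2 + t * d * y) = exp (- c * \<mu>\<^sup>2) * exp (- (y - \<mu>)\<^sup>2 / (2 * s\<^sup>2))"
    by (simp only: exp_add)
  then show ?thesis
    using s by (simp add: normal_density_def \<mu>_def [symmetric])
qed

text \<open>Completing the square moves the mean to \<open>t * d\<close> times the variance
  \<open>- 1 / (2 * c)\<close>. The mean of \<open>d * y\<close> is thus \<open>t * V\<close>,
  linear in \<open>t\<close>, with \<open>V\<close> the variance of \<open>d * y\<close>; this
  linearity makes the limit normal.\<close>

lemma gauss_mean:
  fixes c d t :: real
  assumes "c < 0"
  shows "(\<integral>y. exp (c * y\<^sup>2 + t * d * y) * (d * y) \<partial>lborel) =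
    t * (d\<^sup>2 / (- 2 * c)) * (\<integral>y. exp (c * y\<^sup>2 + t * d * y) \<partial>lborel)"
proof -
  define s where "s = sqrt (- 1 / (2 * c))"
  have s: "s > 0" "s\<^sup>2 = 1 / (- 2 * c)" using assms by (auto simp: s_def divide_neg_neg)
  define \<mu> where "\<mu> = t * d * s\<^sup>2"
  define K where "K = exp (- c * \<mu>\<^sup>2) * sqrt (2 * pi * s\<^sup>2)"
  have e: "exp (c * y\<^sup>2 + t * d * y) = K * normal_density \<mu> s y" for y
    unfolding K_def \<mu>_def s_def by (rule exp_square_eq_normal_density[OF assms])
  have "(\<integral>y. exp (c * y\<^sup>2 + t * d * y) * (d * y) \<partial>lborel) = (\<integral>y. (K * d) * (normal_density \<mu> s y * y) \<partial>lborel)"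
    by (simp only: e) (simp add: ac_simps)
  also have "\<dots> = K * d * \<mu>"
    using s(1) by (simp add: integral_normal_moment_nz_1)
  also have "\<dots> = t * (d\<^sup>2 / (- 2 * c)) * K"
    unfolding \<mu>_def s(2) by (simp add: power2_eq_square)
  also have "K = (\<integral>y. exp (c * y\<^sup>2 + t * d * y) \<partial>lborel)"
    using s(1) by (simp only: e) simp
  finally show ?thesis .
qed

text \<open>The limiting variance is the reciprocal of \<open>V\<close>, because the estimator
  divides a fluctuation of variance \<open>V\<close> by the response rate \<open>V\<close>.\<close>

lemma gauss_cdf:
  fixes c d t :: real
  assumes c: "c < 0" and d: "d \<noteq> 0"
  defines "V \<equiv> d\<^sup>2 / (- 2 * c)"
  shows "(\<integral>y. exp (c * y\<^sup>2) * of_bool (d * y \<le> t * V) \<partial>lborel) =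
    cdf (normal_law (1 / V)) t * (\<integral>y. exp (c * y\<^sup>2) \<partial>lborel)"
proof -
  define s where "s = sqrt (- 1 / (2 * c))"
  have s: "s > 0" "s\<^sup>2 = 1 / (- 2 * c)" using assms by (auto simp: s_def divide_neg_neg)
  have V: "V > 0" "V = d\<^sup>2 * s\<^sup>2" using c d by (auto simp: V_def s(2) divide_pos_neg)
  define K where "K = sqrt (2 * pi * s\<^sup>2)"
  have e: "exp (c * y\<^sup>2) = K * normal_density 0 s y" for y
    using exp_square_eq_normal_density[OF c, of y 0 d] by (simp add: K_def s_def)
  \<comment> \<open>The substitution \<open>y = q * x\<close> turns \<open>d * y \<le> t * V\<close>
    into \<open>x \<le> t\<close> whatever the sign of \<open>d\<close>; the Jacobian
    \<open>\<bar>q\<bar>\<close> matches the two densities since \<open>q\<close> squared equals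
    \<open>V\<close> times the original variance.\<close>
  define q where "q = V / d"
  have q: "q \<noteq> 0" "d * q = V" using V d by (auto simp: q_def)
  have nd: "\<bar>q\<bar> * normal_density 0 s (q * x) = normal_density 0 (sqrt (1 / V)) x" for x
  proof -
    have q2: "q\<^sup>2 = V * s\<^sup>2" using d by (simp add: q_def V(2) power2_eq_square)
    have qs: "\<bar>q\<bar> = sqrt V * s" using q2 s(1) V(1) by (metis abs_of_pos real_sqrt_abs real_sqrt_mult)
    have "(q * x)\<^sup>2 / (2 * s\<^sup>2) = x\<^sup>2 / (2 * (1 / V))"
      using s(1) V(1) by (simp add: power_mult_distrib q2)
    moreover have "\<bar>q\<bar> / sqrt (2 * pi * s\<^sup>2) = 1 / sqrt (2 * pi * (1 / V))"
      using s(1) V(1) by (simp add: qs real_sqrt_mult real_sqrt_divide)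
    moreover have "(sqrt (1 / V))\<^sup>2 = 1 / V" using V(1) by simp
    moreover have "\<bar>q\<bar> * normal_density 0 s (q * x) = \<bar>q\<bar> / sqrt (2 * pi * s\<^sup>2) * exp (- ((q * x)\<^sup>2 / (2 * s\<^sup>2)))"
      by (simp add: normal_density_def)
    moreover have "normal_density 0 (sqrt (1 / V)) x =
        1 / sqrt (2 * pi * (sqrt (1 / V))\<^sup>2) * exp (- (x\<^sup>2 / (2 * (sqrt (1 / V))\<^sup>2)))"
      by (simp add: normal_density_def)
    ultimately show ?thesis by (simp only:)
  qed
  have "(\<integral>y. normal_density 0 s y * of_bool (d * y \<le> t * V) \<partial>lborel) =
      \<bar>q\<bar> * (\<integral>x. normal_density 0 s (0 + q * x) * of_bool (d * (0 + q * x) \<le> t * V) \<partial>lborel)"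
    using lborel_integral_real_affine[OF q(1), of "\<lambda>y. normal_density 0 s y * of_bool (d * y \<le> t * V)" 0] by simp
  also have "\<dots> = (\<integral>x. normal_density 0 (sqrt (1 / V)) x * indicator {..t} x \<partial>lborel)"
  proof -
    have "d * (q * x) \<le> t * V \<longleftrightarrow> x \<le> t" for x
      using V(1) by (simp add: q(2) mult.assoc[symmetric] mult.commute[of V])
    then show ?thesis
      by (simp add: nd[symmetric] indicator_def of_bool_def mult.assoc flip: integral_mult_right_zero)
  qed
  also have "\<dots> = cdf (normal_law (1 / V)) t"
    using V(1) by (simp add: cdf_def measure_normal_law)
  finally have 1: "(\<integral>y. normal_density 0 s y * of_bool (d * y \<le> t * V) \<partial>lborel) = cdf (normal_law (1 / V)) t" .
  have "(\<integral>y. exp (c * y\<^sup>2) * of_bool (d * y \<le> t * V) \<partial>lborel) = K * cdf (normal_law (1 / V)) t"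
    by (simp add: e 1 [symmetric] mult.assoc)
  moreover have "(\<integral>y. exp (c * y\<^sup>2) \<partial>lborel) = K"
    using s(1) by (simp add: e)
  ultimately show ?thesis by (simp add: mult.commute)
qed

lemma measure_normal_law_atLeast:
  assumes "v > 0"
  shows "measure (normal_law v) {t..} = cdf (normal_law v) (- t)"
proof -
  have "measure (normal_law v) {t..} = (\<integral>x. normal_density 0 (sqrt v) x * indicator {t..} x \<partial>lborel)"
    using assms by (simp add: measure_normal_law)
  also have "\<dots> = (\<integral>x. normal_density 0 (sqrt v) (0 + - 1 * x) * indicator {t..} (0 + - 1 * x) \<partial>lborel)"
    by (subst lborel_integral_real_affine[of "- 1" _ 0]) auto
  also have "\<dots> = (\<integral>x. normal_density 0 (sqrt v) x * indicator {..- t} x \<partial>lborel)"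
    by (intro Bochner_Integration.integral_cong) (auto simp: normal_density_def indicator_def)
  also have "\<dots> = cdf (normal_law v) (- t)"
    using assms by (simp add: cdf_def measure_normal_law)
  finally show ?thesis .
qed

lemma cdf_normal_minus:
  assumes "v > 0"
  shows "cdf (normal_minus v) t = (if t < 0 then 2 * cdf (normal_law v) t else 1)"
proof -
  interpret real_distribution "normal_law v" by (rule real_distribution_normal_law[OF assms])
  have "cdf (normal_minus v) t = measure (normal_law v) {z. - \<bar>z\<bar> \<le> t}"
    unfolding cdf_def normal_minus_def by (subst measure_distr) (auto intro!: arg_cong[of _ _ "measure _"])
  also have "\<dots> = (if t < 0 then 2 * cdf (normal_law v) t else 1)"
  proof (cases "t < 0")
    case True
    then have "{z. - \<bar>z\<bar> \<le> t} = {..t} \<union> {- t..}" by auto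
    moreover have "measure (normal_law v) ({..t} \<union> {- t..}) = measure (normal_law v) {..t} + measure (normal_law v) {- t..}"
      using True by (intro finite_measure_Union) auto
    ultimately show ?thesis
      using True measure_normal_law_atLeast[OF assms, of "- t"] by (simp add: cdf_def)
  next
    case False
    then have "{z. - \<bar>z\<bar> \<le> t} = UNIV" by auto
    then show ?thesis using False prob_space by simp
  qed
  finally show ?thesis .
qed

lemma cdf_normal_plus:
  assumes "v > 0"
  shows "cdf (normal_plus v) t = (if t < 0 then 0 else 2 * cdf (normal_law v) t - 1)"
proof -
  interpret real_distribution "normal_law v" by (rule real_distribution_normal_law[OF assms])
  have "cdf (normal_plus v) t = measure (normal_law v) {z. \<bar>z\<bar> \<le> t}"
    unfolding cdf_def normal_plus_def by (subst measure_distr) (auto intro!: arg_cong[of _ _ "measure _"])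
  also have "\<dots> = (if t < 0 then 0 else 2 * cdf (normal_law v) t - 1)"
  proof (cases "t < 0")
    case True
    then have "{z. \<bar>z\<bar> \<le> t} = {}" by auto
    then show ?thesis using True by simp
  next
    case False
    then have "{z. \<bar>z\<bar> \<le> t} = {..t} - (UNIV - {- t..})" by auto
    moreover have "measure (normal_law v) ({..t} - (UNIV - {- t..})) = measure (normal_law v) {..t} - measure (normal_law v) (UNIV - {- t..})"
      using False by (intro finite_measure_Diff) auto
    moreover have "measure (normal_law v) (UNIV - {- t..}) = 1 - measure (normal_law v) {- t..}"
      using prob_compl[of "{- t..}"] by simp
    ultimately show ?thesis
      using False measure_normal_law_atLeast[OF assms, of "- t"] by (simp add: cdf_def)
  qed
  finally show ?thesis .
qed

lemma prob_space_half_normal: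
  assumes "v > 0"
  shows "prob_space (normal_minus v)" "prob_space (normal_plus v)"
proof -
  interpret real_distribution "normal_law v" by (rule real_distribution_normal_law[OF assms])
  show "prob_space (normal_minus v)" "prob_space (normal_plus v)"
    unfolding normal_minus_def normal_plus_def by (auto intro!: prob_space_distr)
qed

text \<open>\<open>measure_of\<close> returns the given set function only if it is positive and
  countably additive, so these properties have to be checked before the cdf can be read off.\<close>

lemma cdf_half_normal_mixture:
  assumes "vm > 0" "vp > 0" "pm \<ge> 0" "pp \<ge> 0" "pm + pp \<le> 1"
  shows "cdf (half_normal_mixture pm vm pp vp) t =
    pm * cdf (normal_minus vm) t + pp * cdf (normal_plus vp) t + (1 - pm - pp) * of_bool (0 \<le> t)"
proof -
  interpret m: prob_space "normal_minus vm" by (rule prob_space_half_normal[OF assms(1)])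
  interpret p: prob_space "normal_plus vp" by (rule prob_space_half_normal[OF assms(2)])
  define \<mu> where "\<mu> = (\<lambda>S. ennreal pm * emeasure (normal_minus vm) S + ennreal pp * emeasure (normal_plus vp) S +
     ennreal (1 - pm - pp) * emeasure (return borel (0::real)) S)"
  have sets: "sets (normal_minus vm) = sets borel" "sets (normal_plus vp) = sets borel"
    by (simp_all add: normal_minus_def normal_plus_def)
  have "emeasure (half_normal_mixture pm vm pp vp) {..t} = \<mu> {..t}"
  proof (rule emeasure_measure_of)
    show "half_normal_mixture pm vm pp vp = measure_of UNIV (sets borel) \<mu>"
      by (simp add: half_normal_mixture_def \<mu>_def)
    have s: "sets (half_normal_mixture pm vm pp vp) = sets borel"
      by (simp add: half_normal_mixture_def sets.sigma_sets_eq[of borel, simplified])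
    then show "{..t} \<in> sets (half_normal_mixture pm vm pp vp)" by simp
    show "positive (sets (half_normal_mixture pm vm pp vp)) \<mu>"
      by (simp add: positive_def \<mu>_def)
    show "countably_additive (sets (half_normal_mixture pm vm pp vp)) \<mu>"
      unfolding countably_additive_def s
    proof (intro allI impI)
      fix B :: "nat \<Rightarrow> real set" assume B: "range B \<subseteq> sets borel" "disjoint_family B"
      show "(\<Sum>i. \<mu> (B i)) = \<mu> (\<Union>i. B i)"
      proof -
        have "(\<Sum>i. emeasure Q (B i)) = emeasure Q (\<Union>i. B i)" if "sets Q = sets borel" for Q
          using B that by (intro suminf_emeasure) auto
        then have "(\<Sum>i. emeasure (normal_minus vm) (B i)) = emeasure (normal_minus vm) (\<Union>i. B i)"
          "(\<Sum>i. emeasure (normal_plus vp) (B i)) = emeasure (normal_plus vp) (\<Union>i. B i)"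
          "(\<Sum>i. emeasure (return borel (0::real)) (B i)) = emeasure (return borel 0) (\<Union>i. B i)"
          using sets by auto
        then show ?thesis
          unfolding \<mu>_def by (simp add: suminf_add[symmetric] ennreal_suminf_cmult del: emeasure_return)
      qed
    qed
  qed simp
  also have "\<mu> {..t} = ennreal (pm * cdf (normal_minus vm) t + pp * cdf (normal_plus vp) t + (1 - pm - pp) * of_bool (0 \<le> t))"
    using assms by (simp add: \<mu>_def m.emeasure_eq_measure p.emeasure_eq_measure cdf_def ennreal_mult' indicator_def)
  finally have "emeasure (half_normal_mixture pm vm pp vp) {..t} =
    ennreal (pm * cdf (normal_minus vm) t + pp * cdf (normal_plus vp) t + (1 - pm - pp) * of_bool (0 \<le> t))" .
  moreover have "0 \<le> pm * cdf (normal_minus vm) t + pp * cdf (normal_plus vp) t + (1 - pm - pp) * of_bool (0 \<le> t)"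
    using assms by (intro add_nonneg_nonneg mult_nonneg_nonneg) (auto simp: cdf_def)
  ultimately show ?thesis
    by (simp add: cdf_def[of "half_normal_mixture pm vm pp vp"] measure_def[of "half_normal_mixture pm vm pp vp"])
qed

text \<open>If the limit is continuous at 0, monotonicity squeezes the value at 0 between those at
  nearby points on both sides; if it jumps there, weak convergence asks for nothing. This replaces a
  direct analysis at \<open>t = 0\<close>, where no tilt separates the maximizers.\<close>

lemma weak_conv_except_zero:
  assumes mono: "\<And>n s t. s \<le> t \<Longrightarrow> F n s \<le> F n t" and lim: "\<And>t. t \<noteq> 0 \<Longrightarrow> (\<lambda>n. F n t) \<longlonglongrightarrow> F' t"
  shows "weak_conv F (F' :: real \<Rightarrow> real)"
  unfolding weak_conv_def
proof (intro allI impI)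
  fix t assume cont: "isCont F' t"
  show "(\<lambda>n. F n t) \<longlonglongrightarrow> F' t"
  proof (cases "t = 0")
    case True
    show ?thesis
    proof (rule tendstoI)
      fix e :: real assume e: "e > 0"
      obtain s where s: "s > 0" "\<And>u. \<bar>u - t\<bar> < s \<Longrightarrow> \<bar>F' u - F' t\<bar> < e / 2"
        using cont e unfolding continuous_at_eps_delta by (metis dist_real_def half_gt_zero)
      have "\<forall>\<^sub>F n in sequentially. dist (F n (s / 2)) (F' (s / 2)) < e / 2"
        "\<forall>\<^sub>F n in sequentially. dist (F n (- s / 2)) (F' (- s / 2)) < e / 2"
        using s(1) e by (intro tendstoD[OF lim]; simp)+
      then show "\<forall>\<^sub>F n in sequentially. dist (F n t) (F' t) < e"
      proof eventually_elim
        case (elim n)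
        have "F n t \<le> F n (s / 2)" "F n (- s / 2) \<le> F n t"
          using mono s(1) True by auto
        moreover have "\<bar>F' (s / 2) - F' t\<bar> < e / 2" "\<bar>F' (- s / 2) - F' t\<bar> < e / 2"
          using s True by auto
        ultimately show ?case
          using elim unfolding dist_real_def abs_less_iff by linarith
      qed
    qed
  qed (use lim in auto)
qed

subsection \<open>The quartic limit\<close>

definition quartic_int :: "real \<Rightarrow> real \<Rightarrow> (real \<Rightarrow> real) \<Rightarrow> real" where
  "quartic_int c b h = (\<integral>y. exp (c * y ^ 4 + b * y) * h y \<partial>lborel)"

text \<open>The majorant is uniform over a bounded range of tilts, as needed for continuity in
  \<open>b\<close> by dominated convergence.\<close>

lemma quartic_dominated:
  assumes "c < 0" "B \<ge> 0"
  obtains w :: "real \<Rightarrow> real" where "integrable lborel w"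
    "\<And>b y. \<bar>b\<bar> \<le> B \<Longrightarrow> exp (c * y ^ 4 + b * y) * (1 + \<bar>y\<bar>) \<le> w y"
proof -
  obtain C where C: "C > 0" "\<And>y z. \<bar>z - y\<bar> \<le> 1 \<Longrightarrow>
      exp (- (- c) * z ^ (2 * 2) + B * \<bar>z\<bar>) * (1 + \<bar>z\<bar>) \<le> C * exp (- (- c / 4) * y\<^sup>2)"
    using even_power_tail_bound[of "- c" B 2] assms by auto
  show ?thesis
  proof (rule that)
    show "integrable lborel (\<lambda>y. C * exp (- (- c / 4) * y\<^sup>2))"
      using assms by (intro integrable_mult_right integrable_exp_neg_square) simp
    fix b y :: real assume b: "\<bar>b\<bar> \<le> B"
    have "b * y \<le> \<bar>b\<bar> * \<bar>y\<bar>" by (metis abs_ge_self abs_mult)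
    also have "\<dots> \<le> B * \<bar>y\<bar>" using b by (intro mult_right_mono) auto
    finally have "exp (c * y ^ 4 + b * y) * (1 + \<bar>y\<bar>) \<le> exp (- (- c) * y ^ (2 * 2) + B * \<bar>y\<bar>) * (1 + \<bar>y\<bar>)"
      by (intro mult_right_mono) auto
    also have "\<dots> \<le> C * exp (- (- c / 4) * y\<^sup>2)" by (rule C(2)) simp
    finally show "exp (c * y ^ 4 + b * y) * (1 + \<bar>y\<bar>) \<le> C * exp (- (- c / 4) * y\<^sup>2)" .
  qed
qed

lemma quartic_integrable:
  fixes c b :: real and h :: "real \<Rightarrow> real"
  assumes "c < 0" "h \<in> borel_measurable borel" "\<And>y. \<bar>h y\<bar> \<le> C * (1 + \<bar>y\<bar>)"
  shows "integrable lborel (\<lambda>y. exp (c * y ^ 4 + b * y) * h y)"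
proof -
  obtain w where w: "integrable lborel w"
    "\<And>b' y. \<bar>b'\<bar> \<le> \<bar>b\<bar> \<Longrightarrow> exp (c * y ^ 4 + b' * y) * (1 + \<bar>y\<bar>) \<le> w y"
    using quartic_dominated[OF assms(1) abs_ge_zero[of b]] by metis
  note [measurable] = assms(2)
  have C: "C \<ge> 0" using assms(3)[of 0] by (auto intro: order_trans[OF abs_ge_zero])
  show ?thesis
  proof (rule Bochner_Integration.integrable_bound[of _ "\<lambda>y. C * w y"])
    show "AE y in lborel. norm (exp (c * y ^ 4 + b * y) * h y) \<le> norm (C * w y)"
    proof (intro AE_I2)
      fix y
      have "norm (exp (c * y ^ 4 + b * y) * h y) \<le> exp (c * y ^ 4 + b * y) * (C * (1 + \<bar>y\<bar>))"
        using assms(3)[of y] by (simp add: abs_mult)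
      also have "\<dots> = C * (exp (c * y ^ 4 + b * y) * (1 + \<bar>y\<bar>))" by simp
      also have "\<dots> \<le> C * w y" using C by (intro mult_left_mono w) auto
      finally show "norm (exp (c * y ^ 4 + b * y) * h y) \<le> norm (C * w y)" by simp
    qed
  qed (use w in auto)
qed

lemma quartic_int_continuous:
  assumes "c < 0" "h \<in> borel_measurable borel" "\<And>y. \<bar>h y\<bar> \<le> C * (1 + \<bar>y\<bar>)"
  shows "isCont (\<lambda>b. quartic_int c b h) b"
  unfolding continuous_at_sequentially o_def
proof (intro allI impI)
  fix u assume u: "u \<longlonglongrightarrow> b"
  then obtain B where B: "\<And>n. \<bar>u n\<bar> \<le> B"
    using convergent_imp_Bseq[of u] by (auto simp: convergent_def Bseq_def)
  then have "B \<ge> 0" using order_trans[OF abs_ge_zero] by blast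
  then obtain w where w: "integrable lborel w"
    "\<And>b y. \<bar>b\<bar> \<le> B \<Longrightarrow> exp (c * y ^ 4 + b * y) * (1 + \<bar>y\<bar>) \<le> w y"
    using quartic_dominated[OF assms(1)] by metis
  note [measurable] = assms(2)
  have C: "C \<ge> 0" using assms(3)[of 0] by (auto intro: order_trans[OF abs_ge_zero])
  show "(\<lambda>n. quartic_int c (u n) h) \<longlonglongrightarrow> quartic_int c b h"
    unfolding quartic_int_def
  proof (rule integral_dominated_convergence[where w = "\<lambda>y. C * w y"])
    show "AE y in lborel. (\<lambda>n. exp (c * y ^ 4 + u n * y) * h y) \<longlonglongrightarrow> exp (c * y ^ 4 + b * y) * h y"
      by (intro AE_I2 tendsto_intros u)
    fix n
    show "AE y in lborel. norm (exp (c * y ^ 4 + u n * y) * h y) \<le> C * w y"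
    proof (intro AE_I2)
      fix y
      have "norm (exp (c * y ^ 4 + u n * y) * h y) \<le> exp (c * y ^ 4 + u n * y) * (C * (1 + \<bar>y\<bar>))"
        using assms(3)[of y] by (simp add: abs_mult)
      also have "\<dots> = C * (exp (c * y ^ 4 + u n * y) * (1 + \<bar>y\<bar>))" by simp
      also have "\<dots> \<le> C * w y" using C B by (intro mult_left_mono w) auto
      finally show "norm (exp (c * y ^ 4 + u n * y) * h y) \<le> C * w y" .
    qed
  qed (use w in auto)
qed

lemma quartic_int_indicator_pos:
  assumes "c < 0" "a < b" "{a..b} \<subseteq> S" "S \<in> sets borel"
  shows "quartic_int c u (indicator S) > 0"
proof -
  have int: "integrable lborel (\<lambda>y. exp (c * y ^ 4 + u * y) * indicator S y)"
    using assms(4) by (intro quartic_integrable[OF assms(1), where C = 1]) (auto simp: indicator_def)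
  have "quartic_int c u (indicator S) \<noteq> 0"
  proof
    assume "quartic_int c u (indicator S) = 0"
    then have "AE y in lborel. exp (c * y ^ 4 + u * y) * indicator S y = 0"
      unfolding quartic_int_def using int by (subst (asm) integral_nonneg_eq_0_iff_AE) auto
    then have "AE y in lborel. y \<notin> {a..b}"
      by eventually_elim (use assms(3) in \<open>auto simp: indicator_def split: if_splits\<close>)
    then have "{a..b} \<in> null_sets lborel" by (subst AE_iff_null_sets) auto
    then show False using assms(2) by (simp add: null_sets_def)
  qed
  moreover have "quartic_int c u (indicator S) \<ge> 0"
    unfolding quartic_int_def by (intro Bochner_Integration.integral_nonneg) auto
  ultimately show ?thesis by simp
qed

definition quartic_mu :: "real \<Rightarrow> real \<Rightarrow> real" where
  "quartic_mu c b = quartic_int c b (\<lambda>y. y) / quartic_int c b (\<lambda>_. 1)"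

lemma quartic_int_1_pos:
  assumes "c < 0"
  shows "quartic_int c b (\<lambda>_. 1) > 0"
  using quartic_int_indicator_pos[OF assms, of 0 1 UNIV b] by (simp add: indicator_def[abs_def])

lemma quartic_mu_continuous:
  assumes "c < 0"
  shows "isCont (quartic_mu c) b"
proof -
  have "isCont (\<lambda>b. quartic_int c b (\<lambda>y. y) / quartic_int c b (\<lambda>_. 1)) b"
    using quartic_int_1_pos[OF assms, of b]
    by (intro continuous_intros quartic_int_continuous[OF assms, where C = 1]) auto
  then show ?thesis by (simp add: quartic_mu_def[abs_def])
qed

text \<open>Replaces a comparison of quotients by the sign of a single integral, to which pointwise
  inequalities apply.\<close>

lemma le_quartic_mu_iff:
  assumes "c < 0"
  shows "x \<le> quartic_mu c b \<longleftrightarrow> 0 \<le> quartic_int c b (\<lambda>y. y - x)"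
proof -
  have "quartic_int c b (\<lambda>y. y - x) = quartic_int c b (\<lambda>y. y) - x * quartic_int c b (\<lambda>_. 1)"
    using quartic_integrable[OF assms, of "\<lambda>y. y" 1 b] quartic_integrable[OF assms, of "\<lambda>y. 1" 1 b]
    unfolding quartic_int_def by (simp add: right_diff_distrib mult.commute[of _ x])
  then show ?thesis
    using quartic_int_1_pos[OF assms, of b] by (simp add: quartic_mu_def pos_le_divide_eq)
qed

text \<open>Tilting by \<open>exp (s (y - x))\<close> increases \<open>y - x\<close> pointwise, which gives monotonicity and the
  divergence of the mean.\<close>

lemma quartic_int_tilt:
  assumes c: "c < 0" and s: "s \<ge> 0"
  shows "exp (s * x) * (quartic_int c b (\<lambda>y. y - x) + s * quartic_int c b (indicator {x + 1..}))
    \<le> quartic_int c (b + s) (\<lambda>y. y - x)"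
proof -
  have lin: "\<bar>y - x\<bar> \<le> (1 + \<bar>x\<bar>) * (1 + \<bar>y\<bar>)" for y
  proof -
    have "\<bar>y - x\<bar> \<le> \<bar>y\<bar> + \<bar>x\<bar>" by (rule abs_triangle_ineq4)
    also have "\<dots> \<le> (1 + \<bar>x\<bar>) * (1 + \<bar>y\<bar>)" by (simp add: algebra_simps)
    finally show ?thesis .
  qed
  note i1 = quartic_integrable[OF c _ lin]
  have i2: "integrable lborel (\<lambda>y. exp (c * y ^ 4 + b * y) * indicator {x + 1..} y)"
    by (intro quartic_integrable[OF c, where C = 1]) (auto simp: indicator_def)
  \<comment> \<open>For \<open>u \<ge> 0\<close> use \<open>exp (s * u) \<ge> 1 + s * u\<close>; for
    \<open>u < 0\<close> the exponential is at most 1. The indicator records a gain linear in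
    \<open>s\<close>, which later forces the mean to diverge.\<close>
  have key: "u + s * indicator {1..} u \<le> u * exp (s * u)" for u :: real
  proof (cases "u \<ge> 0")
    case True
    have "u * (1 + s * u) \<le> u * exp (s * u)"
      using True exp_ge_add_one_self[of "s * u"] by (intro mult_left_mono) auto
    moreover have "s * indicator {1..} u \<le> s * (u * u)"
      using True s mult_mono[of 1 u 1 u] by (intro mult_left_mono) (auto simp: indicator_def)
    ultimately show ?thesis by (simp add: algebra_simps)
  next
    case False
    then have "s * u \<le> 0" using s by (simp add: mult_nonneg_nonpos)
    then have "u * 1 \<le> u * exp (s * u)" using False by (intro mult_left_mono_neg) auto
    then show ?thesis using False by (simp add: indicator_def)
  qed
  have "exp (s * x) * (quartic_int c b (\<lambda>y. y - x) + s * quartic_int c b (indicator {x + 1..})) =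
      (\<integral>y. exp (s * x) * (exp (c * y ^ 4 + b * y) * (y - x) + s * (exp (c * y ^ 4 + b * y) * indicator {x + 1..} y)) \<partial>lborel)"
    unfolding quartic_int_def using i1 i2 by simp
  also have "\<dots> \<le> quartic_int c (b + s) (\<lambda>y. y - x)"
    unfolding quartic_int_def
  proof (rule integral_mono)
    fix y
    have "indicator {x + 1..} y = (indicator {1..} (y - x) :: real)" by (auto simp: indicator_def)
    then have "exp (s * x) * (exp (c * y ^ 4 + b * y) * (y - x) + s * (exp (c * y ^ 4 + b * y) * indicator {x + 1..} y)) =
        exp (s * x) * exp (c * y ^ 4 + b * y) * ((y - x) + s * indicator {1..} (y - x))"
      by (simp add: algebra_simps)
    also have "\<dots> \<le> exp (s * x) * exp (c * y ^ 4 + b * y) * ((y - x) * exp (s * (y - x)))"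
      by (intro mult_left_mono key) auto
    also have "\<dots> = (exp (s * x) * exp (c * y ^ 4 + b * y) * exp (s * (y - x))) * (y - x)"
      by simp
    also have "exp (s * x) * exp (c * y ^ 4 + b * y) * exp (s * (y - x)) = exp (c * y ^ 4 + (b + s) * y)"
      by (simp add: exp_add[symmetric] algebra_simps)
    finally show "exp (s * x) * (exp (c * y ^ 4 + b * y) * (y - x) + s * (exp (c * y ^ 4 + b * y) * indicator {x + 1..} y))
      \<le> exp (c * y ^ 4 + (b + s) * y) * (y - x)" .
  qed (use i1 i2 in auto)
  finally show ?thesis .
qed

lemma quartic_mu_mono:
  assumes c: "c < 0" and "b \<le> b'"
  shows "quartic_mu c b \<le> quartic_mu c b'"
proof -
  define x where "x = quartic_mu c b"
  have "0 \<le> quartic_int c b (\<lambda>y. y - x)" using le_quartic_mu_iff[OF c, of x b] by (simp add: x_def)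
  moreover have "0 \<le> quartic_int c b (indicator {x + 1..})"
    using quartic_int_indicator_pos[OF c, of "x + 1" "x + 2" "{x + 1..}" b] by simp
  ultimately have "0 \<le> exp ((b' - b) * x) * (quartic_int c b (\<lambda>y. y - x) + (b' - b) * quartic_int c b (indicator {x + 1..}))"
    using assms(2) by simp
  also have "\<dots> \<le> quartic_int c b' (\<lambda>y. y - x)"
    using quartic_int_tilt[OF c, of "b' - b" x b] assms(2) by simp
  finally show ?thesis using le_quartic_mu_iff[OF c, of x b'] by (simp add: x_def)
qed

lemma quartic_mu_at_top:
  assumes c: "c < 0"
  shows "filterlim (quartic_mu c) at_top at_top"
  unfolding filterlim_at_top
proof
  fix x
  define P where "P = quartic_int c 0 (indicator {x + 1..})"
  define K where "K = quartic_int c 0 (\<lambda>y. y - x)"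
  have P: "P > 0" unfolding P_def by (rule quartic_int_indicator_pos[OF c, of "x + 1" "x + 2"]) auto
  have "x \<le> quartic_mu c s" if "max 0 (\<bar>K\<bar> / P) \<le> s" for s
  proof -
    have "\<bar>K\<bar> \<le> s * P" using that P by (simp add: pos_divide_le_eq)
    then have "0 \<le> exp (s * x) * (K + s * P)" by simp
    also have "\<dots> \<le> quartic_int c (0 + s) (\<lambda>y. y - x)"
      unfolding K_def P_def using that by (intro quartic_int_tilt[OF c]) auto
    finally show ?thesis using le_quartic_mu_iff[OF c] by simp
  qed
  then show "\<forall>\<^sub>F s in at_top. x \<le> quartic_mu c s"
    using eventually_ge_at_top by (rule eventually_mono[rotated])
qed

lemma quartic_mu_minus: "quartic_mu c (- b) = - quartic_mu c b"
proof -
  have r: "quartic_int c (- b) h = quartic_int c b (\<lambda>y. h (- y))" for h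
    unfolding quartic_int_def
    by (subst lborel_integral_real_affine[of "- 1" _ 0]) auto
  have "quartic_int c b uminus = - quartic_int c b (\<lambda>y. y)"
    by (simp add: quartic_int_def)
  then show ?thesis by (simp add: quartic_mu_def r)
qed

lemma quartic_law_eq:
  "quartic_law c d t = density lborel (\<lambda>y. ennreal (exp (c * y ^ 4 + t * d * y) / quartic_int c (t * d) (\<lambda>_. 1)))"
  by (simp add: quartic_law_def quartic_int_def)

lemma measure_quartic_law:
  assumes c: "c < 0" and S: "S \<in> sets borel"
  shows "measure (quartic_law c d t) S = quartic_int c (t * d) (indicator S) / quartic_int c (t * d) (\<lambda>_. 1)"
proof -
  define Z where "Z = quartic_int c (t * d) (\<lambda>_. 1)"
  have Z: "Z > 0" unfolding Z_def by (rule quartic_int_1_pos[OF c])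
  have "integrable lborel (\<lambda>y. exp (c * y ^ 4 + t * d * y) * 1)"
    by (rule quartic_integrable[OF c, where C = 1]) auto
  then have "measure (quartic_law c d t) S = (\<integral>y. exp (c * y ^ 4 + t * d * y) / Z * indicator S y \<partial>lborel)"
    unfolding quartic_law_eq Z_def[symmetric] using S Z by (intro measure_density_lborel) auto
  also have "\<dots> = quartic_int c (t * d) (indicator S) / Z"
    by (simp add: quartic_int_def)
  finally show ?thesis by (simp add: Z_def)
qed

lemma quartic_mean_eq:
  assumes c: "c < 0"
  shows "quartic_mean c d t = quartic_mu c (t * d)"
proof -
  define Z where "Z = quartic_int c (t * d) (\<lambda>_. 1)"
  have Z: "Z > 0" unfolding Z_def by (rule quartic_int_1_pos[OF c])
  have "quartic_mean c d t = (\<integral>y. exp (c * y ^ 4 + t * d * y) / Z * y \<partial>lborel)"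
    unfolding quartic_mean_def quartic_law_eq Z_def[symmetric]
    using Z by (subst integral_density) (auto simp: less_imp_le)
  then show ?thesis by (simp add: quartic_mu_def quartic_int_def Z_def)
qed

lemma prob_space_quartic_law:
  assumes c: "c < 0"
  shows "prob_space (quartic_law c d t)"
proof
  have sp: "space (quartic_law c d t) = UNIV" by (simp add: quartic_law_def)
  have "measure (quartic_law c d t) UNIV = 1"
    using measure_quartic_law[OF c, of UNIV d t] quartic_int_1_pos[OF c, of "t * d"]
    by (simp add: indicator_def[abs_def])
  then show "emeasure (quartic_law c d t) (space (quartic_law c d t)) = 1"
    unfolding sp by (cases "emeasure (quartic_law c d t) UNIV" rule: ennreal_cases) (auto simp: measure_def)
qed

text \<open>That the limiting formula is a cdf at all needs proof. It is the cdf of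
  \<open>d * Y(0)\<close> composed with \<open>t \<mapsto> d * E Y(t)\<close>, so it suffices that
  the outer function is continuous and the inner one continuous, nondecreasing and unbounded in both
  directions.\<close>

lemma quartic_limit_law:
  assumes c: "c < 0" and d: "d \<noteq> 0"
  obtains Z where "real_distribution Z"
    "\<And>t. cdf Z t = measure (quartic_law c d 0) {y. d * y \<le> d * quartic_mean c d t}"
proof -
  define Q where "Q = distr (quartic_law c d 0) borel (\<lambda>y. d * y)"
  have sets: "sets (quartic_law c d 0) = sets borel" "space (quartic_law c d 0) = UNIV"
    by (simp_all add: quartic_law_def)
  have m: "(\<lambda>y. d * y) \<in> measurable (quartic_law c d 0) borel"
    by (simp add: measurable_cong_sets[OF sets(1) refl])
  interpret L: prob_space "quartic_law c d 0" by (rule prob_space_quartic_law[OF c])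
  interpret Q: real_distribution Q
    unfolding Q_def by (intro L.real_distribution_distr m)
  have cdfQ: "cdf Q x = measure (quartic_law c d 0) {y. d * y \<le> x}" for x
    unfolding cdf_def Q_def using m sets
    by (subst measure_distr) (auto intro!: arg_cong[of _ _ "measure _"])
  \<comment> \<open>Without atoms the outer cdf is continuous, hence so is the composition, and
    right continuity follows.\<close>
  have "measure Q {x} = 0" for x
  proof -
    have "measure Q {x} = measure (quartic_law c d 0) {x / d}"
      unfolding Q_def using m sets d
      by (subst measure_distr) (auto intro!: arg_cong[of _ _ "measure _"] simp: field_simps)
    also have "\<dots> = 0"
    proof -
      have "quartic_int c (0 * d) (indicator {x / d}) = 0"
        unfolding quartic_int_def
        by (rule integral_eq_zero_AE) (use AE_lborel_singleton[of "x / d"] in eventually_elim, simp)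
      then show ?thesis by (simp add: measure_quartic_law[OF c])
    qed
    finally show ?thesis .
  qed
  then have contQ: "isCont (cdf Q) x" for x by (simp add: Q.isCont_cdf)
  \<comment> \<open>The mean is odd in the tilt, so \<open>d * E Y(t)\<close> depends on
    \<open>d\<close> only through \<open>\<bar>d\<bar>\<close>; in particular it is nondecreasing in
    \<open>t\<close> for either sign of \<open>d\<close>.\<close>
  define M where "M t = \<bar>d\<bar> * quartic_mu c (\<bar>d\<bar> * t)" for t
  have M: "d * quartic_mean c d t = M t" for t
    using quartic_mu_minus[of c "\<bar>d\<bar> * t"]
    by (cases "d > 0") (simp_all add: M_def quartic_mean_eq[OF c] mult.commute[of t])
  have dpos: "\<bar>d\<bar> > 0" using d by simp
  have M_mono: "M s \<le> M t" if "s \<le> t" for s t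
    unfolding M_def using that by (intro mult_left_mono quartic_mu_mono[OF c]) auto
  have M_cont: "isCont M t" for t
    unfolding M_def by (intro continuous_intros isCont_o2[OF _ quartic_mu_continuous[OF c]])
  have M_top: "filterlim M at_top at_top"
    unfolding M_def using dpos
    by (intro filterlim_tendsto_pos_mult_at_top[OF tendsto_const] filterlim_compose[OF quartic_mu_at_top[OF c]] filterlim_ident)
  have M_minus: "M (- t) = - M t" for t
    using quartic_mu_minus[of c "\<bar>d\<bar> * t"] by (simp add: M_def)
  have M_bot: "filterlim M at_bot at_bot"
    unfolding filterlim_at_bot_mirror filterlim_uminus_at_bot M_minus using M_top by simp
  define F where "F t = cdf Q (M t)" for t
  have F: "\<And>s t. s \<le> t \<Longrightarrow> F s \<le> F t" "\<And>t. continuous (at_right t) F" "(F \<longlongrightarrow> 0) at_bot" "(F \<longlongrightarrow> 1) at_top"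
  proof -
    show "F s \<le> F t" if "s \<le> t" for s t
      unfolding F_def by (intro Q.cdf_nondecreasing M_mono that)
    show "continuous (at_right t) F" for t
    proof -
      have "isCont F t" unfolding F_def by (rule isCont_o2[OF M_cont contQ])
      then show ?thesis by (rule continuous_within_subset) simp
    qed
    show "(F \<longlongrightarrow> 0) at_bot" unfolding F_def by (rule filterlim_compose[OF Q.cdf_lim_at_bot M_bot])
    show "(F \<longlongrightarrow> 1) at_top" unfolding F_def by (rule filterlim_compose[OF Q.cdf_lim_at_top_prob M_top])
  qed
  show ?thesis
  proof (rule that)
    show "real_distribution (interval_measure F)" by (rule real_distribution_interval_measure[OF F])
    fix t show "cdf (interval_measure F) t = measure (quartic_law c d 0) {y. d * y \<le> d * quartic_mean c d t}"
      using cdf_interval_measure[OF F(1-3)] by (simp add: F_def cdfQ M)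
  qed
qed

section \<open>The variational problem\<close>

text \<open>Closed forms for the derivatives of \<open>h * f_h + I_ent\<close>, valid inside the
  unit interval; the linear term is visible only in orders 0 and 1.\<close>

fun dI :: "real \<Rightarrow> nat \<Rightarrow> real \<Rightarrow> real" where
  "dI h 0 x = h * (2 * x - 1) + I_ent x"
| "dI h (Suc 0) x = 2 * h - ln x + ln (1 - x)"
| "dI h (Suc (Suc k)) x = (- 1) ^ Suc k * fact k / x ^ Suc k - fact k / (1 - x) ^ Suc k"

text \<open>The falling factorial is a product of real factors, so it vanishes for
  \<open>k > p\<close> and neutralises the truncated exponent \<open>p - k\<close>.\<close>

definition dA :: "nat \<Rightarrow> real \<Rightarrow> real \<Rightarrow> nat \<Rightarrow> real \<Rightarrow> real" where
  "dA p \<beta> h k x = \<beta> * 2 ^ k * (\<Prod>i<k. real p - real i) * (2 * x - 1) ^ (p - k) + dI h k x"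

lemma dA_0: "dA p \<beta> h 0 x = A_cw p \<beta> h x"
  by (simp add: dA_def A_cw_def f_cw_def f_beta_def f_h_def)

lemma dI_deriv:
  assumes "0 < x" "x < 1"
  shows "(dI h k has_real_derivative dI h (Suc k) x) (at x)"
proof (cases "(h, k, x)" rule: dI.cases)
  case (1 h' x')
  have "((\<lambda>x. h * (2 * x - 1) + I_ent x) has_real_derivative
      h * 2 + (- 1 * ln x + (1 / x) * (- x)) - (- 1 * ln (1 - x) + (- 1 / (1 - x)) * (1 - x))) (at x)"
    unfolding I_ent_def using assms by (auto intro!: derivative_eq_intros)
  moreover have "h * 2 + (- 1 * ln x + (1 / x) * (- x)) - (- 1 * ln (1 - x) + (- 1 / (1 - x)) * (1 - x)) = dI h (Suc 0) x"
    using assms by simp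
  moreover have "dI h 0 = (\<lambda>x. h * (2 * x - 1) + I_ent x)" by (simp add: fun_eq_iff)
  moreover have "k = 0" using 1 by simp
  ultimately show ?thesis by (simp only:)
next
  case (2 h' x')
  have "((\<lambda>x. 2 * h - ln x + ln (1 - x)) has_real_derivative dI h (Suc (Suc 0)) x) (at x)"
    using assms by (auto intro!: derivative_eq_intros simp: field_simps)
  moreover have "dI h (Suc 0) = (\<lambda>x. 2 * h - ln x + ln (1 - x))" by (simp add: fun_eq_iff)
  ultimately show ?thesis using 2 by simp
next
  case (3 h' j x')
  have inv: "((\<lambda>x. inverse (g x ^ Suc j)) has_real_derivative - (real (Suc j) * g x ^ j * g' * inverse (g x ^ Suc j) ^ 2)) (at x)"
    if "(g has_real_derivative g') (at x)" "g x \<noteq> 0" for g g'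
  proof -
    have "((\<lambda>x. g x ^ Suc j) has_real_derivative real (Suc j) * g x ^ j * g') (at x)"
      using DERIV_power[OF that(1), of "Suc j"] by (simp add: ac_simps)
    from DERIV_inverse'[OF this] show ?thesis using that(2) by (simp add: power2_eq_square ac_simps)
  qed
  have "((\<lambda>x. (- 1) ^ Suc j * fact j * inverse (x ^ Suc j) - fact j * inverse ((1 - x) ^ Suc j))
      has_real_derivative
      ((- 1) ^ Suc j * fact j * (- (real (Suc j) * x ^ j * 1 * inverse (x ^ Suc j) ^ 2))
       - fact j * (- (real (Suc j) * (1 - x) ^ j * (- 1) * inverse ((1 - x) ^ Suc j) ^ 2)))) (at x)"
    using assms by (intro DERIV_diff DERIV_cmult inv) (auto intro!: derivative_eq_intros)
  also have "((- 1) ^ Suc j * fact j * (- (real (Suc j) * x ^ j * 1 * inverse (x ^ Suc j) ^ 2))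
       - fact j * (- (real (Suc j) * (1 - x) ^ j * (- 1) * inverse ((1 - x) ^ Suc j) ^ 2))) = dI h (Suc (Suc (Suc j))) x"
  proof -
    define s where "s = real (Suc j)"
    have pw: "s * y ^ j * z * inverse (y ^ Suc j) ^ 2 = z * (s / y ^ Suc (Suc j))" if "y \<noteq> 0" for y z :: real
      using that by (simp add: power2_eq_square divide_inverse)
    have fs: "(fact (Suc j) :: real) = s * fact j" by (simp add: s_def)
    have "x \<noteq> 0" "1 - x \<noteq> 0" using assms by auto
    note pw1 = pw[OF this(1), of 1] and pw2 = pw[OF this(2), of "- 1"]
    show ?thesis
      unfolding dI.simps fs s_def [symmetric] pw1 pw2 by (simp add: mult.commute)
  qed
  also have "(\<lambda>x. (- 1) ^ Suc j * fact j * inverse (x ^ Suc j) - fact j * inverse ((1 - x) ^ Suc j)) = dI h (Suc (Suc j))"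
    by (simp add: fun_eq_iff divide_inverse)
  finally have "(dI h (Suc (Suc j)) has_real_derivative dI h (Suc (Suc (Suc j))) x) (at x)" .
  moreover have "k = Suc (Suc j)" using 3 by simp
  ultimately show ?thesis by (simp only:)
qed

lemma dA_deriv:
  assumes "0 < x" "x < 1"
  shows "(dA p \<beta> h k has_real_derivative dA p \<beta> h (Suc k) x) (at x)"
proof -
  define q where "q = (\<Prod>i<k. real p - real i)"
  \<comment> \<open>For \<open>k > p\<close> natural subtraction gives 0 instead of a negative
    number, but then \<open>q\<close> contains the factor \<open>p - p\<close> and vanishes.\<close>
  have q: "q * real (p - k) = q * (real p - real k)"
  proof (cases "k \<le> p")
    case False
    then have "q = 0" unfolding q_def by (intro prod_zero) auto
    then show ?thesis by simp
  qed (simp add: of_nat_diff)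
  have "((\<lambda>x. \<beta> * 2 ^ k * q * (2 * x - 1) ^ (p - k) + dI h k x) has_real_derivative
     \<beta> * 2 ^ k * q * (real (p - k) * (2 * x - 1) ^ (p - k - Suc 0) * 2) + dI h (Suc k) x) (at x)"
    using dI_deriv[OF assms] by (auto intro!: derivative_eq_intros)
  also have "\<beta> * 2 ^ k * q * (real (p - k) * (2 * x - 1) ^ (p - k - Suc 0) * 2) =
      \<beta> * 2 ^ Suc k * (q * real (p - k)) * (2 * x - 1) ^ (p - Suc k)"
    by simp
  also have "\<dots> + dI h (Suc k) x = dA p \<beta> h (Suc k) x"
    unfolding q by (simp add: dA_def q_def)
  also have "(\<lambda>x. \<beta> * 2 ^ k * q * (2 * x - 1) ^ (p - k) + dI h k x) = dA p \<beta> h k"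
    by (simp add: fun_eq_iff dA_def q_def)
  finally show ?thesis .
qed

lemma deriv_A_cw:
  assumes "0 < x" "x < 1"
  shows "(deriv ^^ k) (A_cw p \<beta> h) x = dA p \<beta> h k x"
  using assms
proof (induction k arbitrary: x)
  case (Suc k)
  \<comment> \<open>The closed form is known only inside the unit interval; agreement on a
    neighbourhood is enough, because \<open>deriv\<close> is local.\<close>
  have "\<forall>\<^sub>F y in nhds x. y \<in> {0<..<1}"
    using Suc.prems by (intro eventually_nhds_in_open) auto
  then have "\<forall>\<^sub>F y in nhds x. (deriv ^^ k) (A_cw p \<beta> h) y = dA p \<beta> h k y"
    by eventually_elim (simp add: Suc.IH)
  then have "deriv ((deriv ^^ k) (A_cw p \<beta> h)) x = deriv (dA p \<beta> h k) x"
    by (rule deriv_cong_ev) simp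
  then show ?case
    using DERIV_imp_deriv[OF dA_deriv[OF Suc.prems]] by simp
qed (simp add: dA_0)

text \<open>Lagrange's remainder puts the quotient equal to the \<open>n\<close>-th derivative at an
  intermediate point, and that derivative is continuous.\<close>

lemma taylor_ratio:
  assumes a: "0 < a" "a < 1" and n: "n \<ge> 1" and z: "\<And>k. k \<in> {1..<n} \<Longrightarrow> dA p \<beta> h k a = 0"
  shows "((\<lambda>x. (A_cw p \<beta> h (a + x) - A_cw p \<beta> h a) / x ^ n) \<longlongrightarrow> dA p \<beta> h n a / fact n) (at 0)"
proof (rule tendstoI)
  fix e :: real assume e: "e > 0"
  have "isCont (\<lambda>x. dA p \<beta> h n x / fact n) a"
    by (intro continuous_intros DERIV_isCont[OF dA_deriv[OF a]]) simp
  then obtain d where d: "d > 0" "\<And>x. \<bar>x - a\<bar> < d \<Longrightarrow> \<bar>dA p \<beta> h n x / fact n - dA p \<beta> h n a / fact n\<bar> < e"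
    using e unfolding continuous_at_eps_delta by (auto simp: dist_real_def)
  \<comment> \<open>Keeps both \<open>a - \<bar>x\<bar>\<close> and \<open>a + \<bar>x\<bar>\<close>
    inside the unit interval and the intermediate point within the continuity radius
    \<open>d\<close>.\<close>
  define r where "r = min d (min a (1 - a))"
  have r: "r > 0" using d a by (simp add: r_def)
  have "dist ((A_cw p \<beta> h (a + x) - A_cw p \<beta> h a) / x ^ n) (dA p \<beta> h n a / fact n) < e"
    if x: "x \<noteq> 0" "\<bar>x\<bar> < r" for x
  proof -
    define lo where "lo = a - \<bar>x\<bar>"
    define hi where "hi = a + \<bar>x\<bar>"
    have lh: "0 < lo" "hi < 1" using x by (auto simp: lo_def hi_def r_def)
    have "\<exists>t. (if a + x < a then a + x < t \<and> t < a else a < t \<and> t < a + x) \<and>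
        dA p \<beta> h 0 (a + x) = (\<Sum>j<n. (dA p \<beta> h j a / fact j) * (a + x - a) ^ j) +
        (dA p \<beta> h n t / fact n) * (a + x - a) ^ n"
      by (rule Taylor[where diff = "dA p \<beta> h" and a = lo and b = hi])
        (use n x lh in \<open>auto simp: lo_def hi_def intro!: dA_deriv\<close>)
    then obtain t where t0: "if a + x < a then a + x < t \<and> t < a else a < t \<and> t < a + x"
      and eq: "dA p \<beta> h 0 (a + x) = (\<Sum>j<n. (dA p \<beta> h j a / fact j) * x ^ j) + (dA p \<beta> h n t / fact n) * x ^ n"
      by auto
    have t: "\<bar>t - a\<bar> < \<bar>x\<bar>" using t0 by (auto split: if_splits)
    have "(\<Sum>j<n. (dA p \<beta> h j a / fact j) * x ^ j) = dA p \<beta> h 0 a"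
    proof -
      have "(\<Sum>j<n. (dA p \<beta> h j a / fact j) * x ^ j) = (\<Sum>j\<in>{0}. (dA p \<beta> h j a / fact j) * x ^ j)"
        using n z by (intro sum.mono_neutral_right) auto
      then show ?thesis by simp
    qed
    then have "(A_cw p \<beta> h (a + x) - A_cw p \<beta> h a) / x ^ n = dA p \<beta> h n t / fact n"
      using eq x by (simp add: dA_0)
    moreover have "\<bar>t - a\<bar> < d" using t x by (simp add: r_def)
    ultimately show ?thesis using d(2) by (simp add: dist_real_def)
  qed
  then show "\<forall>\<^sub>F x in at 0. dist ((A_cw p \<beta> h (a + x) - A_cw p \<beta> h a) / x ^ n) (dA p \<beta> h n a / fact n) < e"
    using r unfolding eventually_at by (auto simp: dist_real_def)
qed

text \<open>Near a maximizer the numerator of the Taylor quotient is nonpositive. Approaching from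
  the right gives the sign of the first possibly nonzero derivative; for odd order, approaching from
  the left gives the opposite sign.\<close>

lemma maximizer_derivatives:
  assumes a: "a \<in> maximizers p \<beta> h" "0 < a" "a < 1" and n: "n \<ge> 1"
    and z: "\<And>k. k \<in> {1..<n} \<Longrightarrow> dA p \<beta> h k a = 0"
  shows "dA p \<beta> h n a \<le> 0" and "odd n \<Longrightarrow> dA p \<beta> h n a = 0"
proof -
  note lim = taylor_ratio[OF a(2,3) n z, unfolded filterlim_at_split]
  have le: "A_cw p \<beta> h (a + x) - A_cw p \<beta> h a \<le> 0" if "\<bar>x\<bar> < min a (1 - a)" for x
    using a(1) that by (auto simp: maximizers_def abs_less_iff)
  have pos: "min a (1 - a) > 0" using a by simp
  have "dA p \<beta> h n a / fact n \<le> 0"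
  proof (rule tendsto_upperbound)
    show "((\<lambda>x. (A_cw p \<beta> h (a + x) - A_cw p \<beta> h a) / x ^ n) \<longlongrightarrow> dA p \<beta> h n a / fact n) (at_right 0)"
      using lim by blast
    show "\<forall>\<^sub>F x in at_right 0. (A_cw p \<beta> h (a + x) - A_cw p \<beta> h a) / x ^ n \<le> 0"
      using pos le unfolding eventually_at_right_field
      by (intro exI[of _ "min a (1 - a)"]) (auto intro!: divide_nonpos_pos)
  qed simp
  then show *: "dA p \<beta> h n a \<le> 0" by (metis divide_le_0_iff fact_gt_zero not_le)
  assume odd: "odd n"
  have "dA p \<beta> h n a / fact n \<ge> 0"
  proof (rule tendsto_lowerbound)
    show "((\<lambda>x. (A_cw p \<beta> h (a + x) - A_cw p \<beta> h a) / x ^ n) \<longlongrightarrow> dA p \<beta> h n a / fact n) (at_left 0)"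
      using lim by blast
    have "0 \<le> (A_cw p \<beta> h (a + x) - A_cw p \<beta> h a) / x ^ n" if "- min a (1 - a) < x" "x < 0" for x
    proof -
      have "x ^ n < 0" using odd that by (simp add: power_less_zero_eq)
      moreover have "A_cw p \<beta> h (a + x) - A_cw p \<beta> h a \<le> 0"
        using that by (intro le) (auto simp: abs_if min_def split: if_splits)
      ultimately show ?thesis by (rule divide_nonpos_neg[rotated])
    qed
    then show "\<forall>\<^sub>F x in at_left 0. 0 \<le> (A_cw p \<beta> h (a + x) - A_cw p \<beta> h a) / x ^ n"
      using pos unfolding eventually_at_left_field
      by (intro exI[of _ "- min a (1 - a)"]) auto
  qed simp
  then have "0 \<le> dA p \<beta> h n a" by (metis zero_le_divide_iff fact_gt_zero not_le)
  then show "dA p \<beta> h n a = 0" using * by simp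
qed

lemma dA_2: "dA p \<beta> h 2 x = 4 * \<beta> * real p * (real p - 1) * (2 * x - 1) ^ (p - 2) - 1 / x - 1 / (1 - x)"
  by (simp add: dA_def numeral_2_eq_2)

lemma dA_3: "dA p \<beta> h 3 x = 8 * \<beta> * real p * (real p - 1) * (real p - 2) * (2 * x - 1) ^ (p - 3) + 1 / x\<^sup>2 - 1 / (1 - x)\<^sup>2"
  by (simp add: dA_def eval_nat_numeral)

lemma dA_4: "dA p \<beta> h 4 x = 16 * \<beta> * real p * (real p - 1) * (real p - 2) * (real p - 3) * (2 * x - 1) ^ (p - 4)
    - 2 / x ^ 3 - 2 / (1 - x) ^ 3"
  by (simp add: dA_def eval_nat_numeral)

text \<open>In the variable \<open>x = 2 a - 1\<close> a degenerate maximizer has \<open>p x\<^sup>2 = p - 2\<close>, the point where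
  \<open>\<bar>x\<bar> ^ (p - 2) * (1 - x\<^sup>2)\<close> attains its maximum.\<close>

lemma degenerate_point:
  assumes a: "0 < a" "a < 1" and \<beta>: "\<beta> > 0" and d2: "dA p \<beta> h 2 a = 0" and d3: "dA p \<beta> h 3 a = 0"
  defines "x \<equiv> 2 * a - 1"
  shows "p \<ge> 2" "real p * x\<^sup>2 = real p - 2" "\<beta> * real p * (real p - 1) * x ^ (p - 2) * (1 - x\<^sup>2) = 1"
    "dA p \<beta> h 4 a < 0"
proof -
  define B where "B = \<beta> * real p * (real p - 1)"
  define u where "u = 1 - x\<^sup>2"
  have ux: "u = 4 * a * (1 - a)" by (simp add: u_def x_def power2_eq_square algebra_simps)
  have u: "u > 0" using a by (simp add: ux)
  have e2: "1 / a + 1 / (1 - a) = 4 / u" using a by (simp add: ux field_simps)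
  have H2: "B * x ^ (p - 2) * u = 1"
  proof -
    have "4 * B * x ^ (p - 2) = 4 / u" using d2 e2 by (simp add: dA_2 B_def x_def)
    then show ?thesis using u by (simp add: field_simps)
  qed
  then show "\<beta> * real p * (real p - 1) * x ^ (p - 2) * (1 - x\<^sup>2) = 1" by (simp add: B_def u_def)
  have "B \<noteq> 0" using H2 by auto
  then have "p \<noteq> 0" "p \<noteq> 1" by (auto simp: B_def)
  then show p: "p \<ge> 2" by simp
  have e3: "1 / a\<^sup>2 - 1 / (1 - a)\<^sup>2 = - 16 * x / u\<^sup>2"
  proof -
    have "a\<^sup>2 * (1 - a)\<^sup>2 = u\<^sup>2 / 16" by (simp add: ux power_mult_distrib)
    moreover have "1 / a\<^sup>2 - 1 / (1 - a)\<^sup>2 = ((1 - a)\<^sup>2 - a\<^sup>2) / (a\<^sup>2 * (1 - a)\<^sup>2)"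
      using a by (simp add: field_simps)
    moreover have "(1 - a)\<^sup>2 - a\<^sup>2 = - x" by (simp add: x_def power2_eq_square algebra_simps)
    ultimately have "1 / a\<^sup>2 - 1 / (1 - a)\<^sup>2 = - x / (u\<^sup>2 / 16)" by (simp only:)
    then show ?thesis by simp
  qed
  have H3: "B * (real p - 2) * x ^ (p - 3) = 2 * x / u\<^sup>2"
  proof -
    have "8 * (B * (real p - 2) * x ^ (p - 3)) + (1 / a\<^sup>2 - 1 / (1 - a)\<^sup>2) = 0"
      using d3 by (simp add: dA_3 B_def x_def mult.assoc)
    then have "8 * (B * (real p - 2) * x ^ (p - 3)) + (- 16 * x / u\<^sup>2) = 0"
      unfolding e3 .
    then show ?thesis by simp
  qed
  \<comment> \<open>Eliminating \<open>B\<close> between the second and the third order equations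
    leaves a relation in \<open>x\<close> alone. For \<open>p = 2\<close> the third order equation
    itself says \<open>x = 0\<close>.\<close>
  have H3x: "(real p - 2) * u = 2 * x\<^sup>2"
  proof (cases "p = 2")
    case True
    then show ?thesis using H3 u by simp
  next
    case False
    then have "p - 2 = Suc (p - 3)" using p by simp
    then have "(real p - 2) * (B * x ^ (p - 2) * u) * u = B * (real p - 2) * x ^ (p - 3) * x * u\<^sup>2"
      by (simp add: power2_eq_square)
    then show ?thesis unfolding H2 H3 using u by (simp add: power2_eq_square)
  qed
  then show px: "real p * x\<^sup>2 = real p - 2" by (simp add: u_def algebra_simps)
  have e4: "2 / a ^ 3 + 2 / (1 - a) ^ 3 = 16 * (2 + 6 * x\<^sup>2) / u ^ 3"
  proof -
    have "a ^ 3 * (1 - a) ^ 3 = u ^ 3 / 64" by (simp add: ux power_mult_distrib)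
    moreover have "2 / a ^ 3 + 2 / (1 - a) ^ 3 = 2 * ((1 - a) ^ 3 + a ^ 3) / (a ^ 3 * (1 - a) ^ 3)"
      using a by (simp add: field_simps)
    moreover have "(1 - a) ^ 3 + a ^ 3 = (2 + 6 * x\<^sup>2) / 8"
      by (simp add: x_def power2_eq_square power3_eq_cube algebra_simps)
    ultimately have "2 / a ^ 3 + 2 / (1 - a) ^ 3 = 2 * ((2 + 6 * x\<^sup>2) / 8) / (u ^ 3 / 64)" by (simp only:)
    also have "\<dots> = 16 * (2 + 6 * x\<^sup>2) / u ^ 3" using u by (simp add: field_simps)
    finally show ?thesis .
  qed
  have D4: "dA p \<beta> h 4 a = 16 * (B * (real p - 2) * (real p - 3) * x ^ (p - 4) - (2 + 6 * x\<^sup>2) / u ^ 3)"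
    using e4 by (simp add: dA_4 B_def x_def)
  have pos: "(2 + 6 * x\<^sup>2) / u ^ 3 > 0" using u by (intro divide_pos_pos) (auto intro: add_pos_nonneg)
  show "dA p \<beta> h 4 a < 0"
  proof (cases "p \<le> 3")
    case True
    then have "p = 2 \<or> p = 3" using p by auto
    then have "(real p - 2) * (real p - 3) = 0" by auto
    then have "B * (real p - 2) * (real p - 3) * x ^ (p - 4) = 0" by auto
    then have "dA p \<beta> h 4 a = - (16 * ((2 + 6 * x\<^sup>2) / u ^ 3))" unfolding D4 by (simp only:) simp
    moreover have "16 * ((2 + 6 * x\<^sup>2) / u ^ 3) > 0" using pos by (rule mult_pos_pos[rotated]) simp
    ultimately show ?thesis by (simp only: neg_less_0_iff_less)
  next
    case False
    then have p4: "real p \<ge> 4" by simp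
    have "p - 2 = (p - 4) + 2" using False by simp
    then have "x ^ (p - 2) = x ^ (p - 4) * x\<^sup>2" by (simp add: power_add[symmetric])
    then have Tx: "B * (real p - 2) * (real p - 3) * x ^ (p - 4) * x\<^sup>2 * u = (real p - 2) * (real p - 3)"
      using H2 by (simp add: ac_simps)
    \<comment> \<open>Multiplying by this nonnegative quantity clears the denominators and the power
      of \<open>x\<close>, so that \<open>B\<close> can be eliminated with the second order
      equation; only the sign is wanted.\<close>
    have "dA p \<beta> h 4 a * (x\<^sup>2 * u ^ 3) = 16 * ((real p - 2) * (real p - 3) * u\<^sup>2 - (2 + 6 * x\<^sup>2) * x\<^sup>2)"
    proof -
      define T where "T = B * (real p - 2) * (real p - 3) * x ^ (p - 4)"
      define K where "K = (2 + 6 * x\<^sup>2) / u ^ 3"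
      have T: "T * x\<^sup>2 * u = (real p - 2) * (real p - 3)" using Tx by (simp only: T_def)
      have K: "K * u ^ 3 = 2 + 6 * x\<^sup>2" using u by (simp add: K_def)
      have "16 * (T - K) * (x\<^sup>2 * u ^ 3) = 16 * ((T * x\<^sup>2 * u) * u\<^sup>2 - (K * u ^ 3) * x\<^sup>2)"
        by (simp add: algebra_simps power2_eq_square power3_eq_cube)
      then show ?thesis unfolding D4 T K T_def [symmetric] K_def [symmetric] .
    qed
    also have "\<dots> < 0"
    proof -
      have x2: "x\<^sup>2 = (real p - 2) / real p" and u2: "u = 2 / real p"
        using px p4 by (auto simp: u_def field_simps)
      have "(real p - 2) * (real p - 3) * u\<^sup>2 - (2 + 6 * x\<^sup>2) * x\<^sup>2 = - 4 * (real p - 2) / real p"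
        unfolding x2 u2 using p4 by (simp add: field_simps power2_eq_square)
      also have "\<dots> < 0" using p4 by (simp add: divide_neg_pos)
      finally show ?thesis by simp
    qed
    finally have "dA p \<beta> h 4 a * (x\<^sup>2 * u ^ 3) < 0" .
    moreover have "x\<^sup>2 * u ^ 3 \<ge> 0" using u by simp
    ultimately show ?thesis by (meson mult_nonneg_nonneg not_less)
  qed
qed

text \<open>In \<open>z = 2 b - 1\<close>, negativity of the second derivative means
  \<open>B * z ^ (p - 2) * (1 - z^2) < 1\<close>. At the degenerate point the left side equals 1 and
  its absolute value is maximal; the maximum is attained only where \<open>z^2\<close> has the same
  value.\<close>

lemma degenerate_concave:
  assumes a: "0 < a" "a < 1" and \<beta>: "\<beta> > 0" and d2: "dA p \<beta> h 2 a = 0" and d3: "dA p \<beta> h 3 a = 0"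
    and b: "0 < b" "b < 1" and ne: "(2 * b - 1)\<^sup>2 \<noteq> (2 * a - 1)\<^sup>2"
  shows "dA p \<beta> h 2 b < 0"
proof -
  define x where "x = 2 * a - 1"
  define z where "z = 2 * b - 1"
  define B where "B = \<beta> * real p * (real p - 1)"
  note deg = degenerate_point[OF a \<beta> d2 d3, folded x_def B_def]
  have z2: "1 - z\<^sup>2 = 4 * b * (1 - b)" by (simp add: z_def power2_eq_square algebra_simps)
  have x2: "1 - x\<^sup>2 = 4 * a * (1 - a)" by (simp add: x_def power2_eq_square algebra_simps)
  have zp: "1 - z\<^sup>2 > 0" "1 - x\<^sup>2 > 0" using a b by (simp_all add: z2 x2)
  have "B * z ^ (p - 2) * (1 - z\<^sup>2) < 1"
  proof (cases "p = 2")
    case True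
    then have "x = 0" "B * (1 - x\<^sup>2) = 1" using deg by auto
    then show ?thesis using True ne zp by (simp add: x_def[symmetric] z_def[symmetric])
  next
    case False
    then have p: "real p \<ge> 3" "p - 2 > 0" using deg(1) by auto
    show ?thesis
    proof (cases "z = 0")
      case True
      then show ?thesis using p by (simp add: power_0_left)
    next
      case z0: False
      have x0: "x\<^sup>2 = (real p - 2) / real p" "1 - x\<^sup>2 = 2 / real p" using deg(2) p by (auto simp: field_simps)
      define r where "r = z\<^sup>2 / x\<^sup>2"
      define s where "s = (1 - z\<^sup>2) / (1 - x\<^sup>2)"
      have xp: "x\<^sup>2 > 0" using p x0 by simp
      have rs: "r > 0" "s > 0" "r \<noteq> 1" using xp z0 zp ne by (auto simp: r_def s_def x_def z_def)
      \<comment> \<open>Uniqueness of the maximum by weighted arithmetic and geometric means: with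
        weights \<open>p - 2\<close> and 2 the numbers \<open>r\<close> and \<open>s\<close> have
        average 1, and \<open>r \<noteq> 1\<close> makes the inequality strict.\<close>
      have "ln r < r - 1"
        using ln_le_minus_one[OF rs(1)] ln_eq_minus_one[OF rs(1)] rs(3) by linarith
      then have "(real p - 2) * ln r + 2 * ln s < (real p - 2) * (r - 1) + 2 * (s - 1)"
        using ln_le_minus_one[OF rs(2)] p by (intro add_less_le_mono mult_strict_left_mono) auto
      also have "\<dots> = 0"
        unfolding r_def s_def x0 using p by (simp add: field_simps)
      finally have "ln (r ^ (p - 2) * s\<^sup>2) < 0"
        using rs p by (simp add: ln_mult ln_realpow of_nat_diff)
      then have lt: "r ^ (p - 2) * s\<^sup>2 < 1"
        using rs by (simp add: ln_less_zero_iff)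
      \<comment> \<open>Squaring removes the sign of \<open>z ^ (p - 2)\<close>, which may be
        negative for odd \<open>p\<close>.\<close>
      have "(B * z ^ (p - 2) * (1 - z\<^sup>2))\<^sup>2 = (B * x ^ (p - 2) * (1 - x\<^sup>2))\<^sup>2 * (r ^ (p - 2) * s\<^sup>2)"
        using xp zp by (simp add: r_def s_def power_mult_distrib power_divide power_mult [symmetric] mult.commute[of 2])
      then have "(B * z ^ (p - 2) * (1 - z\<^sup>2))\<^sup>2 < 1\<^sup>2" using lt deg(3) by simp
      then show ?thesis by (rule power_less_imp_less_base) simp
    qed
  qed
  then have "B * z ^ (p - 2) < 1 / (1 - z\<^sup>2)" using zp by (simp add: field_simps)
  moreover have "1 / b + 1 / (1 - b) = 4 * (1 / (1 - z\<^sup>2))" unfolding z2 using b by (simp add: field_simps)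
  ultimately show ?thesis by (simp add: dA_2 B_def[symmetric] z_def[symmetric] mult.assoc[of 4])
qed

lemma maximizer_critical:
  assumes "a \<in> maximizers p \<beta> h" "0 < a" "a < 1"
  shows "dA p \<beta> h 1 a = 0" "dA p \<beta> h 2 a \<le> 0" "dA p \<beta> h 2 a = 0 \<Longrightarrow> dA p \<beta> h 3 a = 0"
proof -
  show 1: "dA p \<beta> h 1 a = 0" using maximizer_derivatives(2)[OF assms, of 1] by simp
  show "dA p \<beta> h 2 a \<le> 0"
  proof (rule maximizer_derivatives(1)[OF assms])
    fix k :: nat assume "k \<in> {1..<2}"
    then have "k = 1" by auto
    then show "dA p \<beta> h k a = 0" using 1 by simp
  qed simp
  assume 2: "dA p \<beta> h 2 a = 0"
  show "dA p \<beta> h 3 a = 0"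
  proof (rule maximizer_derivatives(2)[OF assms])
    fix k :: nat assume "k \<in> {1..<3}"
    then have "k = 1 \<or> k = 2" by auto
    then show "dA p \<beta> h k a = 0" using 1 2 by auto
  qed simp_all
qed

text \<open>If one maximizer were degenerate, the second derivative would be negative except at
  \<open>a\<close> and possibly at \<open>1 - a\<close>. The first derivative would then be
  nonincreasing while vanishing at both maximizers, hence zero between them, and the second
  derivative would vanish on an interval.\<close>

lemma maximizer_nondegenerate:
  assumes \<beta>: "\<beta> > 0"
    and a: "a \<in> maximizers p \<beta> h" "0 < a" "a < 1" and b: "b \<in> maximizers p \<beta> h" "0 < b" "b < 1"
    and "a \<noteq> b"
  shows "dA p \<beta> h 2 a < 0"
proof (rule ccontr)
  assume "\<not> dA p \<beta> h 2 a < 0"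
  then have d2: "dA p \<beta> h 2 a = 0" using maximizer_critical(2)[OF a] by simp
  have d3: "dA p \<beta> h 3 a = 0" using maximizer_critical(3)[OF a d2] .
  define lo where "lo = min a b"
  define hi where "hi = max a b"
  have lh: "lo < hi" "0 < lo" "hi < 1" and zero: "dA p \<beta> h 1 lo = 0" "dA p \<beta> h 1 hi = 0"
    using assms maximizer_critical(1) by (auto simp: lo_def hi_def min_def max_def)
  \<comment> \<open>The strict inequality leaves out \<open>a\<close> and \<open>1 - a\<close>;
    continuity gives the weak one at these points as well.\<close>
  have nonpos: "dA p \<beta> h 2 z \<le> 0" if "0 < z" "z < 1" for z
  proof -
    have "\<forall>\<^sub>F y in at z. dA p \<beta> h 2 y \<le> 0"
    proof -
      have "\<forall>\<^sub>F y in at z. y \<in> {0<..<1}"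
        using that by (intro eventually_at_in_open'[OF open_greaterThanLessThan]) auto
      moreover have "\<forall>\<^sub>F y in at z. y \<noteq> a" "\<forall>\<^sub>F y in at z. y \<noteq> 1 - a"
        by (rule eventually_neq_at_within)+
      ultimately show ?thesis
      proof eventually_elim
        case (elim y)
        have "(2 * y - 1)\<^sup>2 \<noteq> (2 * a - 1)\<^sup>2"
          using elim by (auto simp: power2_eq_iff)
        then show ?case using degenerate_concave[OF a(2,3) \<beta> d2 d3, of y] elim by auto
      qed
    qed
    moreover have "(dA p \<beta> h 2 \<longlongrightarrow> dA p \<beta> h 2 z) (at z)"
      using DERIV_isCont[OF dA_deriv[OF that]] by (simp add: isCont_def)
    ultimately show ?thesis by (intro tendsto_upperbound[of _ _ "at z"]) auto
  qed
  have mono: "dA p \<beta> h 1 y \<le> dA p \<beta> h 1 x" if "lo \<le> x" "x \<le> y" "y \<le> hi" for x y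
  proof (rule DERIV_nonpos_imp_nonincreasing[OF that(2)])
    fix z assume "x \<le> z" "z \<le> y"
    then have "0 < z" "z < 1" using that lh by auto
    then show "\<exists>w. (dA p \<beta> h 1 has_real_derivative w) (at z) \<and> w \<le> 0"
      using dA_deriv[of z p \<beta> h 1] nonpos[of z] by (auto simp: numeral_2_eq_2)
  qed
  have flat: "dA p \<beta> h 1 z = 0" if "lo \<le> z" "z \<le> hi" for z
    using mono[of lo z] mono[of z hi] that zero by auto
  have sq: "(2 * z - 1)\<^sup>2 = (2 * a - 1)\<^sup>2" if z: "lo < z" "z < hi" for z
  proof (rule ccontr)
    assume "(2 * z - 1)\<^sup>2 \<noteq> (2 * a - 1)\<^sup>2"
    then have "dA p \<beta> h 2 z < 0" using z lh by (intro degenerate_concave[OF a(2,3) \<beta> d2 d3]) auto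
    moreover have "dA p \<beta> h (Suc 1) z = 0"
    proof (rule DERIV_local_const)
      show "(dA p \<beta> h 1 has_real_derivative dA p \<beta> h (Suc 1) z) (at z)"
        using z lh by (intro dA_deriv) auto
      show "0 < min (z - lo) (hi - z)" using z by simp
      show "\<forall>y. \<bar>z - y\<bar> < min (z - lo) (hi - z) \<longrightarrow> dA p \<beta> h 1 z = dA p \<beta> h 1 y"
        using z flat by (auto simp: abs_less_iff)
    qed
    ultimately show False by (simp add: numeral_2_eq_2)
  qed
  \<comment> \<open>Three equally spaced points inside the interval give a contradiction, since a
    square takes each value at most twice.\<close>
  define e where "e = (hi - lo) / 4"
  have e: "e > 0" "hi = lo + 4 * e" using lh by (auto simp: e_def field_simps)
  have "(2 * (lo + e) - 1)\<^sup>2 = (2 * (lo + 2 * e) - 1)\<^sup>2" "(2 * (lo + 2 * e) - 1)\<^sup>2 = (2 * (lo + 3 * e) - 1)\<^sup>2"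
    using sq[of "lo + e"] sq[of "lo + 2 * e"] sq[of "lo + 3 * e"] e by auto
  then show False unfolding power2_eq_iff using e by auto
qed

section \<open>Lipschitz bounds, location and finiteness of the maximizers\<close>

lemma f_beta_lipschitz:
  assumes "x \<in> {0..1}" "y \<in> {0..1}"
  shows "\<bar>f_beta p x - f_beta p y\<bar> \<le> 2 * real p * \<bar>x - y\<bar>"
proof -
  have "norm ((2 * x - 1) ^ p - (2 * y - 1) ^ p) \<le> real p * norm ((2 * x - 1) - (2 * y - 1))"
    using assms by (intro norm_power_diff) (auto simp: abs_le_iff)
  moreover have "norm ((2 * x - 1) - (2 * y - 1)) = 2 * \<bar>x - y\<bar>"
  proof -
    have "(2 * x - 1) - (2 * y - 1) = 2 * (x - y)" by simp
    then show ?thesis by (simp only: real_norm_def abs_mult abs_numeral)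
  qed
  ultimately show ?thesis by (simp add: f_beta_def)
qed

lemma f_h_lipschitz: "\<bar>f_h x - f_h y\<bar> \<le> 2 * \<bar>x - y\<bar>"
proof -
  have "f_h x - f_h y = 2 * (x - y)" by (simp add: f_h_def)
  then show ?thesis by (simp only: abs_mult abs_numeral order_refl)
qed

lemma f_cw_lipschitz:
  assumes "x \<in> {0..1}" "y \<in> {0..1}"
  shows "\<bar>f_cw p \<beta> h x - f_cw p \<beta> h y\<bar> \<le> (\<bar>\<beta>\<bar> * (2 * real p) + \<bar>h\<bar> * 2) * \<bar>x - y\<bar>"
proof -
  have "\<bar>f_cw p \<beta> h x - f_cw p \<beta> h y\<bar> = \<bar>\<beta> * (f_beta p x - f_beta p y) + h * (f_h x - f_h y)\<bar>"
    by (simp add: f_cw_def algebra_simps)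
  also have "\<dots> \<le> \<bar>\<beta>\<bar> * \<bar>f_beta p x - f_beta p y\<bar> + \<bar>h\<bar> * \<bar>f_h x - f_h y\<bar>"
    using abs_triangle_ineq[of "\<beta> * (f_beta p x - f_beta p y)" "h * (f_h x - f_h y)"] by (simp only: abs_mult)
  also have "\<dots> \<le> \<bar>\<beta>\<bar> * (2 * real p * \<bar>x - y\<bar>) + \<bar>h\<bar> * (2 * \<bar>x - y\<bar>)"
    by (intro add_mono mult_left_mono f_beta_lipschitz f_h_lipschitz assms) auto
  finally show ?thesis by (simp add: algebra_simps)
qed

lemma I_ent_ge:
  assumes "0 < e" "e < 1"
  shows "I_ent e \<ge> - e * ln e" "I_ent (1 - e) \<ge> - e * ln e"
proof -
  have "(1 - e) * ln (1 - e) \<le> 0" using assms by (intro mult_nonneg_nonpos) auto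
  then show "I_ent e \<ge> - e * ln e" "I_ent (1 - e) \<ge> - e * ln e" by (auto simp: I_ent_def algebra_simps)
qed

text \<open>The entropy has infinite slope at both endpoints while the field is Lipschitz, so a
  small step inward always increases \<open>A_cw\<close>.\<close>

lemma maximizers_interior: "maximizers p \<beta> h \<subseteq> {0<..<1}"
proof -
  define K where "K = \<bar>\<beta>\<bar> * (2 * real p) + \<bar>h\<bar> * 2"
  \<comment> \<open>Chosen so that \<open>- e * ln e = (K + 1) * e\<close>, which exceeds the
    Lipschitz loss \<open>K * e\<close> by \<open>e\<close>.\<close>
  define e where "e = exp (- K - 1)"
  have K: "K \<ge> 0" by (simp add: K_def)
  then have e: "0 < e" "e < 1" by (auto simp: e_def)
  have gain: "- e * ln e - K * e = e" by (simp add: e_def algebra_simps)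
  have "A_cw p \<beta> h e > A_cw p \<beta> h 0"
    using f_cw_lipschitz[of e 0 p \<beta> h, folded K_def] I_ent_ge(1)[OF e] gain e
    by (simp add: A_cw_def I_ent_def[of 0] abs_le_iff)
  then have "0 \<notin> maximizers p \<beta> h"
    using e by (auto simp: maximizers_def not_le intro!: bexI[of _ e])
  moreover have "A_cw p \<beta> h (1 - e) > A_cw p \<beta> h 1"
    using f_cw_lipschitz[of "1 - e" 1 p \<beta> h, folded K_def] I_ent_ge(2)[OF e] gain e
    by (simp add: A_cw_def I_ent_def[of 1] abs_le_iff)
  then have "1 \<notin> maximizers p \<beta> h"
    using e by (auto simp: maximizers_def not_le intro!: bexI[of _ "1 - e"])
  ultimately show ?thesis
    by (auto simp: maximizers_def less_le)
qed

lemma continuous_on_A_cw: "continuous_on {0..1} (A_cw p \<beta> h)"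
proof -
  have 0: "continuous_on {0..1} (\<lambda>x::real. x * ln x)"
    unfolding continuous_on_def
  proof
    fix x :: real assume x: "x \<in> {0..1}"
    show "((\<lambda>x. x * ln x) \<longlongrightarrow> x * ln x) (at x within {0..1})"
    proof (cases "x = 0")
      case True
      have "((\<lambda>x::real. x * ln x) \<longlongrightarrow> 0) (at_right 0)" by real_asymp
      moreover have "at (0::real) within {0..1} = at_right 0"
        by (rule at_within_Icc_at_right) simp
      ultimately show ?thesis using True by simp
    next
      case False
      then show ?thesis using x by (intro tendsto_intros) auto
    qed
  qed
  have 1: "continuous_on {0..1} (\<lambda>x::real. (1 - x) * ln (1 - x))"
  proof -
    have "continuous_on {0..1} (\<lambda>x::real. 1 - x)" by (intro continuous_intros)
    from continuous_on_compose2[OF 0 this] show ?thesis by auto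
  qed
  have "continuous_on {0..1} (\<lambda>x. f_cw p \<beta> h x + (- (x * ln x) - (1 - x) * ln (1 - x)))"
    unfolding f_cw_def f_beta_def f_h_def by (intro continuous_intros 0 1)
  then show ?thesis by (simp add: A_cw_def[abs_def] I_ent_def)
qed

text \<open>An accumulation point of maximizers would itself be a maximizer by continuity, and the
  second order Taylor quotient along the sequence would be identically zero, against a negative
  second derivative.\<close>

lemma finite_maximizers:
  assumes "\<And>a. a \<in> maximizers p \<beta> h \<Longrightarrow> dA p \<beta> h 2 a < 0"
  shows "finite (maximizers p \<beta> h)"
proof -
  let ?M = "maximizers p \<beta> h"
  have "\<not> z islimpt ?M" if z: "z \<in> {0..1}" for z
  proof
    assume lim: "z islimpt ?M"
    then obtain u where u: "\<And>n. u n \<in> ?M - {z}" "u \<longlonglongrightarrow> z"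
      unfolding islimpt_sequential by blast
    have "(\<lambda>n. A_cw p \<beta> h (u n)) \<longlonglongrightarrow> A_cw p \<beta> h z"
      using continuous_on_A_cw z u(2) u(1) unfolding continuous_on_sequentially
      by (auto simp: maximizers_def o_def)
    then have "A_cw p \<beta> h b \<le> A_cw p \<beta> h z" if "b \<in> {0..1}" for b
      by (rule tendsto_lowerbound) (use u(1) that in \<open>auto simp: maximizers_def\<close>)
    then have zM: "z \<in> ?M" using z by (auto simp: maximizers_def)
    then have z01: "0 < z" "z < 1" using maximizers_interior[of p \<beta> h] by auto
    have "((\<lambda>x. (A_cw p \<beta> h (z + x) - A_cw p \<beta> h z) / x ^ 2) \<longlongrightarrow> dA p \<beta> h 2 z / fact 2) (at 0)"
    proof (rule taylor_ratio[OF z01])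
      fix k :: nat assume "k \<in> {1..<2}"
      then have "k = 1" by auto
      then show "dA p \<beta> h k z = 0" using maximizer_critical(1)[OF zM z01] by simp
    qed simp
    moreover have "filterlim (\<lambda>n. u n - z) (at 0) sequentially"
      using u by (auto simp: filterlim_at LIM_zero_iff)
    ultimately have "(\<lambda>n. (A_cw p \<beta> h (z + (u n - z)) - A_cw p \<beta> h z) / (u n - z) ^ 2) \<longlonglongrightarrow> dA p \<beta> h 2 z / fact 2"
      by (rule filterlim_compose)
    moreover have "A_cw p \<beta> h (u n) = A_cw p \<beta> h z" for n
      using u(1)[of n] zM by (auto simp: maximizers_def intro!: antisym)
    ultimately have "dA p \<beta> h 2 z = 0" by (simp add: LIMSEQ_const_iff)
    then show False using assms[OF zM] by simp
  qed
  then have "finite ({0..1} \<inter> ?M)"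
    by (intro finite_not_islimpt_in_compact) auto
  moreover have "?M \<subseteq> {0..1}" by (auto simp: maximizers_def)
  ultimately show ?thesis by (simp add: inf.absorb2)
qed

section \<open>Limit laws of the estimators\<close>

context cw_laplace
begin

text \<open>\<open>v\<close> is the value of \<open>f\<close> that the tilt favours. A common
  \<open>V\<close> on its group makes the threshold exactly \<open>t * V\<close>, although it is a
  quotient of sums. Maximizers with smaller \<open>f\<close> then lie below the threshold with full
  mass, and those with larger \<open>f\<close> contribute nothing.\<close>

lemma gaussian_limit:
  assumes m1: "m = 1" and F: "F = (\<lambda>x. F0 x + \<gamma> * f x)"
    and \<mu>: "\<And>n t. cdf (\<mu> n) t = cw_prob F n (\<lambda>k. real n powr (1 / 2) * (cw_mle F0 f n (f (real k / real n)) - \<gamma>) \<le> t)"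
    and v: "v \<in> f ` M" and off: "\<And>a. a \<in> M \<Longrightarrow> f a \<noteq> v \<Longrightarrow> t * f a < t * v"
    and V: "\<And>a. a \<in> M \<Longrightarrow> f a = v \<Longrightarrow> (f' a)\<^sup>2 / (- 2 * c a) = V"
  defines "T \<equiv> \<lambda>a. tilted_int a 0 (\<lambda>_. 1)"
  shows "(\<lambda>n. cdf (\<mu> n) t) \<longlonglongrightarrow>
    (sum T {a \<in> M. f a < v} + sum T {a \<in> M. f a = v} * cdf (normal_law (1 / V)) t) / sum T M"
proof -
  define G where "G = {a \<in> M. f a = v}"
  have G: "G \<subseteq> M" "G \<noteq> {}" "\<And>a. a \<in> G \<Longrightarrow> f a = v" "\<And>a. a \<in> M - G \<Longrightarrow> t * f a < t * v"
    using v off by (auto simp: G_def)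
  define w where "w = (\<Sum>a\<in>G. tilted_int a t (\<lambda>y. f' a * y)) / (\<Sum>a\<in>G. tilted_int a t (\<lambda>_. 1))"
  have "(\<Sum>a\<in>G. tilted_int a t (\<lambda>y. f' a * y)) = (\<Sum>a\<in>G. t * V * tilted_int a t (\<lambda>_. 1))"
  proof (rule sum.cong)
    fix a assume a: "a \<in> G"
    then have "a \<in> M" "(f' a)\<^sup>2 / (- 2 * c a) = V" using G(1) V by (auto simp: G_def)
    then show "tilted_int a t (\<lambda>y. f' a * y) = t * V * tilted_int a t (\<lambda>_. 1)"
      using gauss_mean[OF c_neg, of a t "f' a"] unfolding tilted_int_def by (simp add: m1)
  qed simp
  also have "\<dots> = t * V * (\<Sum>a\<in>G. tilted_int a t (\<lambda>_. 1))"
    by (rule sum_distrib_left[symmetric])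
  moreover have "(\<Sum>a\<in>G. tilted_int a t (\<lambda>_. 1)) > 0"
    using G finite_subset[OF G(1) finite_M] by (intro sum_pos tilted_int_pos) auto
  ultimately have w: "w = t * V" by (simp add: w_def)
  have tint: "tilted_int a 0 (\<lambda>y. of_bool (if f a = v then f' a * y \<le> w else f a < v)) =
      (if f a = v then T a * cdf (normal_law (1 / V)) t else if f a < v then T a else 0)" if a: "a \<in> M" for a
  proof (cases "f a = v")
    case True
    then show ?thesis
      using gauss_cdf[OF c_neg[OF a] f'_nonzero[OF a], of t, unfolded V[OF a True]]
      unfolding tilted_int_def T_def by (simp add: m1 w)
  qed (simp add: tilted_int_def T_def)
  have "(\<Sum>a\<in>M. tilted_int a 0 (\<lambda>y. of_bool (if f a = v then f' a * y \<le> w else f a < v))) =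
      (\<Sum>a\<in>M. (if f a < v then T a else 0) + (if f a = v then T a * cdf (normal_law (1 / V)) t else 0))"
    by (intro sum.cong) (auto simp: tint)
  also have "\<dots> = sum T {a \<in> M. f a < v} + sum T {a \<in> M. f a = v} * cdf (normal_law (1 / V)) t"
    by (simp add: sum.distrib sum.inter_filter[OF finite_M, symmetric] sum_distrib_right)
  finally have sum: "(\<Sum>a\<in>M. tilted_int a 0 (\<lambda>y. of_bool (if f a = v then f' a * y \<le> w else f a < v))) =
    sum T {a \<in> M. f a < v} + sum T {a \<in> M. f a = v} * cdf (normal_law (1 / V)) t" .
  have pw: "1 - 1 / (2 * real m) = 1 / 2" by (simp add: m1)
  show ?thesis
    using mle_limit[OF F G, folded w_def] unfolding sum pw \<mu> T_def .
qed

lemma curvature_pos: "a \<in> M \<Longrightarrow> (f' a)\<^sup>2 / (- 2 * c a) > 0"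
  using c_neg[of a] f'_nonzero[of a] by (intro divide_pos_pos) auto

lemma normal_limit:
  assumes m1: "m = 1" and F: "F = (\<lambda>x. F0 x + \<gamma> * f x)" and Ma: "M = {a}"
    and \<mu>: "\<And>n t. cdf (\<mu> n) t = cw_prob F n (\<lambda>k. real n powr (1 / 2) * (cw_mle F0 f n (f (real k / real n)) - \<gamma>) \<le> t)"
  shows "\<exists>\<sigma>>0. weak_conv_m \<mu> (normal_law \<sigma>)"
proof -
  define V where "V = (f' a)\<^sup>2 / (- 2 * c a)"
  have V: "V > 0" using curvature_pos[of a] Ma by (simp add: V_def)
  have "(\<lambda>n. cdf (\<mu> n) t) \<longlonglongrightarrow> cdf (normal_law (1 / V)) t" for t
  proof -
    have 1: "{b \<in> M. f b < f a} = {}" and 2: "{b \<in> M. f b = f a} = {a}" using Ma by auto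
    have T: "tilted_int a 0 (\<lambda>_. 1) > 0" using Ma by (intro tilted_int_pos) simp
    have "(\<lambda>n. cdf (\<mu> n) t) \<longlonglongrightarrow>
        ((\<Sum>b\<in>{b \<in> M. f b < f a}. tilted_int b 0 (\<lambda>_. 1)) +
         (\<Sum>b\<in>{b \<in> M. f b = f a}. tilted_int b 0 (\<lambda>_. 1)) * cdf (normal_law (1 / V)) t) /
        (\<Sum>b\<in>M. tilted_int b 0 (\<lambda>_. 1))"
      by (rule gaussian_limit[OF m1 F \<mu>]) (use Ma in \<open>auto simp: V_def\<close>)
    then show ?thesis unfolding 1 2 unfolding Ma using T by simp
  qed
  then show ?thesis
    using V by (intro exI[of _ "1 / V"]) (simp add: weak_conv_m_def weak_conv_def)
qed

text \<open>A negative \<open>t\<close> favours the smallest value of \<open>f\<close> on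
  \<open>M\<close>, a positive \<open>t\<close> the largest, so different groups govern the two half
  lines; intermediate groups, and half of each extremal one, end up in the atom.\<close>

lemma mixture_limit:
  assumes m1: "m = 1" and F: "F = (\<lambda>x. F0 x + \<gamma> * f x)"
    and same: "\<And>a b. a \<in> M \<Longrightarrow> b \<in> M \<Longrightarrow> f a = f b \<Longrightarrow> (f' a)\<^sup>2 / (- 2 * c a) = (f' b)\<^sup>2 / (- 2 * c b)"
    and \<mu>: "\<And>n t. cdf (\<mu> n) t = cw_prob F n (\<lambda>k. real n powr (1 / 2) * (cw_mle F0 f n (f (real k / real n)) - \<gamma>) \<le> t)"
  shows "\<exists>pm>0. \<exists>pp>0. \<exists>\<sigma>m>0. \<exists>\<sigma>p>0. pm + pp \<le> 1 \<and> weak_conv_m \<mu> (half_normal_mixture pm \<sigma>m pp \<sigma>p)"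
proof -
  define T where "T a = tilted_int a 0 (\<lambda>_. 1)" for a
  have T: "a \<in> M \<Longrightarrow> T a > 0" for a unfolding T_def by (rule tilted_int_pos)
  have fin: "finite (f ` M)" "f ` M \<noteq> {}" using finite_M M_nonempty by auto
  define lo where "lo = Min (f ` M)"
  define hi where "hi = Max (f ` M)"
  have lohi: "lo \<in> f ` M" "hi \<in> f ` M" "\<And>a. a \<in> M \<Longrightarrow> lo \<le> f a" "\<And>a. a \<in> M \<Longrightarrow> f a \<le> hi"
    using fin by (auto simp: lo_def hi_def)
  obtain al ah where a: "al \<in> M" "f al = lo" "ah \<in> M" "f ah = hi" using lohi by auto
  define Vl where "Vl = (f' al)\<^sup>2 / (- 2 * c al)"
  define Vh where "Vh = (f' ah)\<^sup>2 / (- 2 * c ah)"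
  have V: "Vl > 0" "Vh > 0" using a curvature_pos by (auto simp: Vl_def Vh_def)
  have S: "sum T M > 0" using finite_M M_nonempty T by (intro sum_pos) auto
  define pl where "pl = sum T {a \<in> M. f a = lo} / sum T M"
  define ph where "ph = sum T {a \<in> M. f a = hi} / sum T M"
  have part: "sum T {a \<in> M. f a = v} / sum T M > 0 \<and> sum T {a \<in> M. f a = v} / sum T M \<le> 1" if "v \<in> f ` M" for v
  proof -
    have "sum T {a \<in> M. f a = v} > 0" using that finite_M T by (intro sum_pos) auto
    moreover have "sum T {a \<in> M. f a = v} \<le> sum T M"
      using finite_M T by (intro sum_mono2) (auto intro: less_imp_le)
    ultimately show ?thesis using S by simp
  qed
  have p: "pl > 0" "pl \<le> 1" "ph > 0" "ph \<le> 1"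
    using part[OF lohi(1)] part[OF lohi(2)] by (auto simp: pl_def ph_def)
  \<comment> \<open>The limit on the negative half line is \<open>pl\<close> times a normal cdf. A
    half normal law doubles the density on its side, hence the weights \<open>pl / 2\<close> and
    \<open>ph / 2\<close>. If \<open>f\<close> is constant on \<open>M\<close>, both
    \<open>pl\<close> and \<open>ph\<close> are 1 and the atom disappears.\<close>
  define Q where "Q = half_normal_mixture (pl / 2) (1 / Vl) (ph / 2) (1 / Vh)"
  have Q: "cdf Q t = pl / 2 * (if t < 0 then 2 * cdf (normal_law (1 / Vl)) t else 1) +
      ph / 2 * (if t < 0 then 0 else 2 * cdf (normal_law (1 / Vh)) t - 1) + (1 - pl / 2 - ph / 2) * of_bool (0 \<le> t)" for t
    unfolding Q_def using p V by (subst cdf_half_normal_mixture) (auto simp: cdf_normal_minus cdf_normal_plus)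
  have "weak_conv (\<lambda>n. cdf (\<mu> n)) (cdf Q)"
  proof (rule weak_conv_except_zero)
    fix n s t assume st: "s \<le> (t::real)"
    have tot: "cw_total F n > 0" by (rule cw_total_pos)
    show "cdf (\<mu> n) s \<le> cdf (\<mu> n) t"
      unfolding \<mu> cw_prob_def using st tot
      by (intro divide_right_mono sum_mono mult_left_mono cw_mass_nonneg) (auto simp: of_bool_def)
  next
    fix t :: real assume t: "t \<noteq> 0"
    show "(\<lambda>n. cdf (\<mu> n) t) \<longlonglongrightarrow> cdf Q t"
    proof (cases "t < 0")
      case True
      have "(\<lambda>n. cdf (\<mu> n) t) \<longlonglongrightarrow>
        (sum T {a \<in> M. f a < lo} + sum T {a \<in> M. f a = lo} * cdf (normal_law (1 / Vl)) t) / sum T M"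
        unfolding T_def
      proof (rule gaussian_limit[OF m1 F \<mu> lohi(1)])
        fix b assume b: "b \<in> M"
        show "t * f b < t * lo" if "f b \<noteq> lo"
          using True lohi(3)[OF b] that by (simp add: mult_less_cancel_left_neg)
        show "(f' b)\<^sup>2 / (- 2 * c b) = Vl" if "f b = lo"
          unfolding Vl_def using that a b by (intro same) auto
      qed
      moreover have "{a \<in> M. f a < lo} = {}" using lohi(3) by (auto simp: not_less)
      ultimately have "(\<lambda>n. cdf (\<mu> n) t) \<longlonglongrightarrow> pl * cdf (normal_law (1 / Vl)) t"
        by (simp add: pl_def)
      then show ?thesis using True by (simp add: Q)
    next
      case False
      then have t0: "t > 0" using t by simp
      have "(\<lambda>n. cdf (\<mu> n) t) \<longlonglongrightarrow>
        (sum T {a \<in> M. f a < hi} + sum T {a \<in> M. f a = hi} * cdf (normal_law (1 / Vh)) t) / sum T M"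
        unfolding T_def
      proof (rule gaussian_limit[OF m1 F \<mu> lohi(2)])
        fix b assume b: "b \<in> M"
        show "t * f b < t * hi" if "f b \<noteq> hi"
          using t0 lohi(4)[OF b] that by simp
        show "(f' b)\<^sup>2 / (- 2 * c b) = Vh" if "f b = hi"
          unfolding Vh_def using that a b by (intro same) auto
      qed
      moreover have "sum T {a \<in> M. f a < hi} = sum T M - sum T {a \<in> M. f a = hi}"
      proof -
        have "{a \<in> M. f a < hi} = M - {a \<in> M. f a = hi}" using lohi(4) by force
        then show ?thesis using finite_M by (simp add: sum_diff)
      qed
      ultimately have "(\<lambda>n. cdf (\<mu> n) t) \<longlonglongrightarrow> 1 - ph + ph * cdf (normal_law (1 / Vh)) t"
        using S by (simp add: ph_def add_divide_distrib diff_divide_distrib)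
      also have "1 - ph + ph * cdf (normal_law (1 / Vh)) t = cdf Q t"
        using t0 by (simp add: Q algebra_simps)
      finally show ?thesis .
    qed
  qed
  then have "weak_conv_m \<mu> (half_normal_mixture (pl / 2) (1 / Vl) (ph / 2) (1 / Vh))"
    by (simp add: weak_conv_m_def Q_def)
  moreover have "pl / 2 > 0" "ph / 2 > 0" "1 / Vl > 0" "1 / Vh > 0" "pl / 2 + ph / 2 \<le> 1"
    using p V by auto
  ultimately show ?thesis by blast
qed

text \<open>The error exponent is \<open>1 - 1 / (2 * 2) = 3 / 4\<close>. The factor
  \<open>f' a\<close> stays on both sides of the event, since its sign decides the direction of the
  inequality after division.\<close>

lemma quartic_limit:
  assumes m2: "m = 2" and F: "F = (\<lambda>x. F0 x + \<gamma> * f x)" and Ma: "M = {a}"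
    and \<mu>: "\<And>n t. cdf (\<mu> n) t = cw_prob F n (\<lambda>k. real n powr (3 / 4) * (cw_mle F0 f n (f (real k / real n)) - \<gamma>) \<le> t)"
  shows "\<exists>Z. real_distribution Z \<and>
    (\<forall>t. cdf Z t = measure (quartic_law (c a) (f' a) 0) {y. f' a * y \<le> f' a * quartic_mean (c a) (f' a) t}) \<and>
    weak_conv_m \<mu> Z"
proof -
  have a: "a \<in> M" using Ma by simp
  have ca: "c a < 0" and d: "f' a \<noteq> 0" and lw: "laplace_weight a > 0"
    using a c_neg f'_nonzero M_interior by (auto intro!: laplace_weight_pos)
  obtain Z where Z: "real_distribution Z"
    "\<And>t. cdf Z t = measure (quartic_law (c a) (f' a) 0) {y. f' a * y \<le> f' a * quartic_mean (c a) (f' a) t}"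
    using quartic_limit_law[OF ca d] by blast
  have ti: "tilted_int a t h = laplace_weight a * quartic_int (c a) (t * f' a) h" for t h
    unfolding tilted_int_def quartic_int_def by (simp add: m2)
  have "(\<lambda>n. cdf (\<mu> n) t) \<longlonglongrightarrow> cdf Z t" for t
  proof -
    define w where "w = (\<Sum>a\<in>{a}. tilted_int a t (\<lambda>y. f' a * y)) / (\<Sum>a\<in>{a}. tilted_int a t (\<lambda>_. 1))"
    have w: "w = f' a * quartic_mean (c a) (f' a) t"
    proof -
      have "quartic_int (c a) (t * f' a) (\<lambda>y. f' a * y) = f' a * quartic_int (c a) (t * f' a) (\<lambda>y. y)"
        by (simp add: quartic_int_def mult.left_commute[of _ "f' a"])
      then show ?thesis
        using lw by (simp add: w_def ti quartic_mean_eq[OF ca] quartic_mu_def)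
    qed
    have "(\<lambda>n. cw_prob F n (\<lambda>k. real n powr (1 - 1 / (2 * real m)) * (cw_mle F0 f n (f (real k / real n)) - \<gamma>) \<le> t)) \<longlonglongrightarrow>
      (\<Sum>b\<in>M. tilted_int b 0 (\<lambda>y. of_bool (if f b = f a then f' b * y \<le> w else f b < f a))) /
      (\<Sum>b\<in>M. tilted_int b 0 (\<lambda>_. 1))"
      unfolding w_def by (rule mle_limit[OF F, of "{a}"]) (use Ma in auto)
    moreover have "1 - 1 / (2 * real m) = 3 / 4" by (simp add: m2)
    moreover have "(\<lambda>y. of_bool (f' a * y \<le> w)) = (indicator {y. f' a * y \<le> w} :: real \<Rightarrow> real)"
      by (auto simp: indicator_def)
    ultimately show ?thesis
      using lw by (simp add: \<mu> Z(2) Ma ti w measure_quartic_law[OF ca])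
  qed
  then have "weak_conv_m \<mu> Z" by (simp add: weak_conv_m_def weak_conv_def)
  then show ?thesis using Z by blast
qed

end

text \<open>Connects derivatives with the locale: once all derivatives below order
  \<open>2 * m\<close> vanish, Taylor's formula supplies the expansion with \<open>c\<close> equal
  to the next derivative over its factorial.\<close>

lemma cw_laplace_maximizers:
  assumes M: "finite (maximizers p \<beta> h)" "maximizers p \<beta> h \<noteq> {}" and m: "m \<ge> 1"
    and crit: "\<And>a k. a \<in> maximizers p \<beta> h \<Longrightarrow> k \<in> {1..<2 * m} \<Longrightarrow> dA p \<beta> h k a = 0"
    and neg: "\<And>a. a \<in> maximizers p \<beta> h \<Longrightarrow> dA p \<beta> h (2 * m) a < 0"
    and f: "\<And>x. (f has_real_derivative f' x) (at x)" "\<And>x. isCont f' x"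
      "\<And>x y. x \<in> {0..1} \<Longrightarrow> y \<in> {0..1} \<Longrightarrow> \<bar>f x - f y\<bar> \<le> L * \<bar>x - y\<bar>"
    and nz: "\<And>a. a \<in> maximizers p \<beta> h \<Longrightarrow> f' a \<noteq> 0"
  shows "\<exists>Amax. cw_laplace (f_cw p \<beta> h) f f' (maximizers p \<beta> h) m (\<lambda>a. dA p \<beta> h (2 * m) a / fact (2 * m)) Amax L"
proof -
  obtain a0 where a0: "a0 \<in> maximizers p \<beta> h" using M(2) by blast
  have max: "A_cw p \<beta> h a = A_cw p \<beta> h a0" if "a \<in> maximizers p \<beta> h" for a
    using that a0 by (auto simp: maximizers_def intro!: antisym)
  have "cw_laplace (f_cw p \<beta> h) f f' (maximizers p \<beta> h) m (\<lambda>a. dA p \<beta> h (2 * m) a / fact (2 * m)) (A_cw p \<beta> h a0) L"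
  proof
    show "continuous_on {0..1} (\<lambda>x. f_cw p \<beta> h x + I_ent x)"
      using continuous_on_A_cw[of p \<beta> h] by (simp add: A_cw_def[abs_def])
    show "f_cw p \<beta> h a + I_ent a = A_cw p \<beta> h a0" if "a \<in> maximizers p \<beta> h" for a
      using max[OF that] by (simp add: A_cw_def)
    show "f_cw p \<beta> h b + I_ent b < A_cw p \<beta> h a0" if "b \<in> {0..1} - maximizers p \<beta> h" for b
    proof -
      have "\<exists>x\<in>{0..1}. A_cw p \<beta> h b < A_cw p \<beta> h x" using that by (auto simp: maximizers_def not_le)
      then obtain x where "x \<in> {0..1}" "A_cw p \<beta> h b < A_cw p \<beta> h x" by blast
      then have "A_cw p \<beta> h b < A_cw p \<beta> h a0" using a0 by (force simp: maximizers_def)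
      then show ?thesis by (simp add: A_cw_def)
    qed
    show "dA p \<beta> h (2 * m) a / fact (2 * m) < 0" if "a \<in> maximizers p \<beta> h" for a
      using neg[OF that] by (simp add: divide_neg_pos)
    show "((\<lambda>x. (f_cw p \<beta> h (a + x) + I_ent (a + x) - A_cw p \<beta> h a0) / x ^ (2 * m)) \<longlongrightarrow> dA p \<beta> h (2 * m) a / fact (2 * m)) (at 0)"
      if a: "a \<in> maximizers p \<beta> h" for a
      using taylor_ratio[of a "2 * m" p \<beta> h] crit[OF a] m maximizers_interior[of p \<beta> h] a max[OF a]
      by (auto simp: A_cw_def)
  qed (use assms maximizers_interior in auto)
  then show ?thesis by blast
qed

section \<open>The two statistics and the exceptional parameters\<close>

lemma f_h_deriv: "(f_h has_real_derivative 2) (at x)"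
  unfolding f_h_def[abs_def] by (auto intro!: derivative_eq_intros)

definition f_beta' :: "nat \<Rightarrow> real \<Rightarrow> real" where
  "f_beta' p x = 2 * real p * (2 * x - 1) ^ (p - 1)"

lemma f_beta_deriv: "(f_beta p has_real_derivative f_beta' p x) (at x)"
  unfolding f_beta_def[abs_def] f_beta'_def by (auto intro!: derivative_eq_intros)

lemma f_beta'_cont: "isCont (f_beta' p) x"
  unfolding f_beta'_def[abs_def] by (intro continuous_intros)

lemma I_ent_half: "I_ent (1 / 2) = ln 2"
  by (simp add: I_ent_def ln_div)

lemma I_ent_flip: "I_ent (1 - x) = I_ent x"
  by (simp add: I_ent_def algebra_simps)

lemma bdd_above_A_cw: "bdd_above (A_cw p \<beta> h ` {0..1})"
  by (intro compact_imp_bounded[THEN bounded_imp_bdd_above] compact_continuous_image continuous_on_A_cw) simp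

lemma sup_A_cw:
  assumes "a \<in> maximizers p \<beta> h"
  shows "(SUP x\<in>{0..1}. A_cw p \<beta> h x) = A_cw p \<beta> h a"
  using assms by (intro cSup_eq_maximum) (auto simp: maximizers_def)

text \<open>At the endpoint 1 the entropy vanishes and the statistic is 1, so the supremum is at
  least \<open>b\<close>.\<close>

lemma bdd_above_beta_tilde: "bdd_above {b. b \<ge> 0 \<and> (SUP a\<in>{0..1}. A_cw p b 0 a) = ln 2}"
proof (rule bdd_aboveI)
  fix b assume b: "b \<in> {b. b \<ge> 0 \<and> (SUP a\<in>{0..1}. A_cw p b 0 a) = ln 2}"
  have "A_cw p b 0 1 \<le> (SUP a\<in>{0..1}. A_cw p b 0 a)"
    by (intro cSUP_upper bdd_above_A_cw) simp
  then show "b \<le> ln 2" using b by (simp add: A_cw_def f_cw_def f_beta_def I_ent_def)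
qed

text \<open>The slope of \<open>f_beta\<close> vanishes only at 1/2, where the first derivative of
  \<open>A_cw\<close> is \<open>2 * h\<close>; criticality gives \<open>h = 0\<close>, and the
  maximal value is then the entropy \<open>ln 2\<close>. So the slope can vanish only on the removed
  segment.\<close>

lemma stationary_f_beta:
  assumes p: "p \<ge> 1" and \<beta>: "\<beta> > 0" and a: "a \<in> maximizers p \<beta> h" and f': "f_beta' p a = 0"
  shows "a = 1 / 2" "p \<ge> 2" "h = 0" "A_cw p \<beta> 0 (1 / 2) = ln 2" "\<beta> \<le> beta_tilde p"
proof -
  show half: "a = 1 / 2" and p2: "p \<ge> 2" using f' p by (auto simp: f_beta'_def)
  have a01: "0 < a" "a < 1" using half by auto
  have "dA p \<beta> h 1 a = 0" by (rule maximizer_critical(1)[OF a a01])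
  then show h: "h = 0" using p2 by (simp add: dA_def half power_0_left)
  show A: "A_cw p \<beta> 0 (1 / 2) = ln 2"
    using p2 by (simp add: A_cw_def f_cw_def f_beta_def I_ent_half power_0_left)
  have "(SUP x\<in>{0..1}. A_cw p \<beta> 0 x) = ln 2" using sup_A_cw[OF a] A half h by simp
  then show "\<beta> \<le> beta_tilde p"
    unfolding beta_tilde_def using \<beta> by (intro cSup_upper bdd_above_beta_tilde) auto
qed

text \<open>At a second maximizer \<open>b\<close> the statistic is positive, so any larger \<beta>
  lifts \<open>A_cw\<close> at \<open>b\<close> above \<open>ln 2\<close>; hence \<beta> is the
  critical value itself.\<close>

lemma stationary_f_beta_R2:
  assumes p: "p \<ge> 1" and \<beta>: "\<beta> > 0" and a: "a \<in> maximizers p \<beta> h" and f': "f_beta' p a = 0"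
    and b: "b \<in> maximizers p \<beta> h" "b \<noteq> a"
  shows "(\<beta>, h) = (beta_tilde p, 0)"
proof -
  note st = stationary_f_beta[OF p \<beta> a f']
  have max: "A_cw p \<beta> 0 x \<le> ln 2" if "x \<in> {0..1}" for x
    using a st that by (auto simp: maximizers_def)
  have b01: "b \<in> {0..1}" using b by (simp add: maximizers_def)
  have "A_cw p \<beta> h (1 / 2) \<le> A_cw p \<beta> h b" using b(1) by (simp add: maximizers_def)
  then have Ab: "A_cw p \<beta> 0 b = ln 2" using max[OF b01] st(3,4) by simp
  have y: "(2 * b - 1) ^ p > 0"
  proof (cases "even p")
    case True
    then show ?thesis using b(2) st(1) by (simp add: zero_less_power_eq)
  next
    \<comment> \<open>For odd \<open>p\<close> a negative statistic at \<open>b\<close> is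
      impossible: the reflected point \<open>1 - b\<close> has the same entropy and the opposite
      statistic, and would do better.\<close>
    case False
    have "A_cw p \<beta> 0 (1 - b) \<le> ln 2" using b01 by (intro max) auto
    moreover have "A_cw p \<beta> 0 (1 - b) = - \<beta> * (2 * b - 1) ^ p + I_ent b"
    proof -
      have "2 * (1 - b) - 1 = - (2 * b - 1)" by simp
      then have "(2 * (1 - b) - 1) ^ p = - ((2 * b - 1) ^ p)" by (simp only: power_minus_odd[OF False])
      then show ?thesis unfolding A_cw_def f_cw_def f_beta_def I_ent_flip by simp
    qed
    ultimately have "- \<beta> * (2 * b - 1) ^ p \<le> \<beta> * (2 * b - 1) ^ p"
      using Ab by (simp add: A_cw_def f_cw_def f_beta_def)
    then have "0 \<le> \<beta> * (2 * b - 1) ^ p" by simp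
    then have "0 \<le> (2 * b - 1) ^ p" using \<beta> by (simp add: zero_le_mult_iff)
    moreover have "(2 * b - 1) ^ p \<noteq> 0" using b(2) st(1) by simp
    ultimately show ?thesis by (metis order_le_less)
  qed
  have "beta_tilde p \<le> \<beta>"
    unfolding beta_tilde_def
  proof (rule cSup_least)
    have "(SUP x\<in>{0..1}. A_cw p \<beta> 0 x) = ln 2" using sup_A_cw[OF a] st by simp
    then show "{b. b \<ge> 0 \<and> (SUP a\<in>{0..1}. A_cw p b 0 a) = ln 2} \<noteq> {}" using \<beta> by (auto intro!: exI[of _ \<beta>])
    fix b' assume b': "b' \<in> {b. b \<ge> 0 \<and> (SUP a\<in>{0..1}. A_cw p b 0 a) = ln 2}"
    have "A_cw p b' 0 b \<le> (SUP a\<in>{0..1}. A_cw p b' 0 a)"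
      using b01 by (intro cSUP_upper bdd_above_A_cw)
    then have "b' * (2 * b - 1) ^ p \<le> \<beta> * (2 * b - 1) ^ p"
      using b' Ab by (simp add: A_cw_def f_cw_def f_beta_def)
    then show "b' \<le> \<beta>" using y by simp
  qed
  then show ?thesis using st by simp
qed

text \<open>Equal statistics at distinct maximizers force \<open>p\<close> even and
  \<open>b = 1 - a\<close>, and reflection preserves both the squared slope and the curvature. Hence
  maximizers in one group share the same \<open>V\<close>.\<close>

lemma equal_f_beta:
  assumes p: "p \<ge> 1" and a: "a \<in> maximizers p \<beta> h" and b: "b \<in> maximizers p \<beta> h" and eq: "f_beta p a = f_beta p b"
  shows "(f_beta' p a)\<^sup>2 = (f_beta' p b)\<^sup>2 \<and> dA p \<beta> h 2 a = dA p \<beta> h 2 b"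
proof (cases "a = b")
  case False
  have "\<bar>2 * a - 1\<bar> ^ p = \<bar>2 * b - 1\<bar> ^ p" using eq unfolding f_beta_def power_abs [symmetric] by (rule arg_cong)
  then have "\<bar>2 * a - 1\<bar> = \<bar>2 * b - 1\<bar>" by (rule power_eq_imp_eq_base) (use p in auto)
  then have ab: "2 * a - 1 = - (2 * b - 1)" using False by (auto simp: abs_eq_iff)
  have ev: "even p"
  proof (rule ccontr)
    assume "odd p"
    then have "(2 * a - 1) ^ p = - ((2 * b - 1) ^ p)" unfolding ab by (rule power_minus_odd)
    then have "(2 * b - 1) ^ p = 0" using eq by (simp add: f_beta_def)
    then show False using ab False p by simp
  qed
  have a1: "a = 1 - b" using ab by simp
  have "even (p - 2)" using ev by simp
  then have "(2 * a - 1) ^ (p - 2) = (2 * b - 1) ^ (p - 2)" unfolding ab by (rule power_minus_even)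
  then have "dA p \<beta> h 2 a = dA p \<beta> h 2 b"
    unfolding dA_2 by (simp add: a1)
  moreover have "(f_beta' p a)\<^sup>2 = (f_beta' p b)\<^sup>2"
  proof -
    have "((2 * a - 1) ^ (p - 1))\<^sup>2 = ((2 * a - 1)\<^sup>2) ^ (p - 1)" by (simp add: power_mult[symmetric] mult.commute)
    also have "(2 * a - 1)\<^sup>2 = (2 * b - 1)\<^sup>2" unfolding ab by (rule power2_minus)
    also have "((2 * b - 1)\<^sup>2) ^ (p - 1) = ((2 * b - 1) ^ (p - 1))\<^sup>2" by (simp add: power_mult[symmetric] mult.commute)
    finally show ?thesis by (simp add: f_beta'_def power_mult_distrib)
  qed
  ultimately show ?thesis by simp
qed simp

lemma f_cw_split_beta: "f_cw p \<beta> h = (\<lambda>x. f_cw p 0 h x + \<beta> * f_beta p x)"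
  by (simp add: f_cw_def fun_eq_iff)

lemma f_cw_split_h: "f_cw p \<beta> h = (\<lambda>x. f_cw p \<beta> 0 x + h * f_h x)"
  by (simp add: f_cw_def fun_eq_iff)

section \<open>The three regions as instances of the locale\<close>

lemma R1_laplace:
  assumes "(\<beta>, h) \<in> R1 p"
    and f: "\<And>x. (f has_real_derivative f' x) (at x)" "\<And>x. isCont f' x"
      "\<And>x y. x \<in> {0..1} \<Longrightarrow> y \<in> {0..1} \<Longrightarrow> \<bar>f x - f y\<bar> \<le> L * \<bar>x - y\<bar>"
    and nz: "\<And>a. a \<in> maximizers p \<beta> h \<Longrightarrow> f' a \<noteq> 0"
  shows "\<exists>a c Amax. cw_laplace (f_cw p \<beta> h) f f' {a} 1 c Amax L"
proof -
  obtain a where a: "0 < a" "a < 1" "maximizers p \<beta> h = {a}" "even_regular p \<beta> h 1 a"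
    using assms(1) by (auto simp: R1_def)
  have "(deriv ^^ 2) (A_cw p \<beta> h) a < 0" using a(4) by (simp add: even_regular_def)
  then have d2: "dA p \<beta> h (2 * 1) a < 0" using a deriv_A_cw[of a 2 p \<beta> h] by simp
  have d1: "dA p \<beta> h k a = 0" if "k \<in> {1..<2 * 1}" for k
  proof -
    have "k = 1" using that by auto
    then show ?thesis using maximizer_critical(1)[of a p \<beta> h] a by simp
  qed
  have "\<exists>Amax. cw_laplace (f_cw p \<beta> h) f f' (maximizers p \<beta> h) 1 (\<lambda>a. dA p \<beta> h (2 * 1) a / fact (2 * 1)) Amax L"
    by (rule cw_laplace_maximizers[OF _ _ _ _ _ f nz]) (use a(3) d1 d2 in auto)
  then show ?thesis using a(3) by auto
qed

lemma R2_laplace: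
  assumes R2: "(\<beta>, h) \<in> R2 p"
    and f: "\<And>x. (f has_real_derivative f' x) (at x)" "\<And>x. isCont f' x"
      "\<And>x y. x \<in> {0..1} \<Longrightarrow> y \<in> {0..1} \<Longrightarrow> \<bar>f x - f y\<bar> \<le> L * \<bar>x - y\<bar>"
    and nz: "\<And>a. a \<in> maximizers p \<beta> h \<Longrightarrow> f' a \<noteq> 0"
  shows "\<exists>Amax. cw_laplace (f_cw p \<beta> h) f f' (maximizers p \<beta> h) 1 (\<lambda>a. dA p \<beta> h 2 a / 2) Amax L"
proof -
  obtain a b where ab: "\<beta> > 0" "a \<noteq> b" "a \<in> maximizers p \<beta> h" "b \<in> maximizers p \<beta> h"
    using R2 by (auto simp: R2_def)
  have int: "0 < x" "x < 1" if "x \<in> maximizers p \<beta> h" for x using maximizers_interior[of p \<beta> h] that by auto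
  have neg: "dA p \<beta> h 2 x < 0" if x: "x \<in> maximizers p \<beta> h" for x
  proof -
    obtain y where y: "y \<in> maximizers p \<beta> h" "x \<noteq> y" using ab by metis
    show ?thesis by (rule maximizer_nondegenerate[OF ab(1) x int[OF x] y(1) int[OF y(1)] y(2)])
  qed
  have "\<exists>Amax. cw_laplace (f_cw p \<beta> h) f f' (maximizers p \<beta> h) 1 (\<lambda>a. dA p \<beta> h (2 * 1) a / fact (2 * 1)) Amax L"
  proof (rule cw_laplace_maximizers[OF _ _ _ _ _ f nz])
    show "finite (maximizers p \<beta> h)" using neg by (rule finite_maximizers)
    fix x and k :: nat assume x: "x \<in> maximizers p \<beta> h" and "k \<in> {1..<2 * 1}"
    then have "k = 1" by auto
    then show "dA p \<beta> h k x = 0" using maximizer_critical(1)[OF x int[OF x]] by simp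
  qed (use ab neg in auto)
  then show ?thesis by simp
qed

lemma R3_laplace:
  assumes R3: "(\<beta>, h) \<in> R3 p" and a: "a \<in> maximizers p \<beta> h"
    and f: "\<And>x. (f has_real_derivative f' x) (at x)" "\<And>x. isCont f' x"
      "\<And>x y. x \<in> {0..1} \<Longrightarrow> y \<in> {0..1} \<Longrightarrow> \<bar>f x - f y\<bar> \<le> L * \<bar>x - y\<bar>"
    and nz: "f' a \<noteq> 0"
  shows "\<exists>Amax. cw_laplace (f_cw p \<beta> h) f f' {a} 2 (\<lambda>a. (deriv ^^ 4) (A_cw p \<beta> h) a / 24) Amax L"
proof -
  have M: "maximizers p \<beta> h = {a}" and \<beta>: "\<beta> > 0" and d2: "(deriv ^^ 2) (A_cw p \<beta> h) a = 0"
    using R3 a by (auto simp: R3_def)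
  have a01: "0 < a" "a < 1" using a maximizers_interior[of p \<beta> h] by auto
  have d2: "dA p \<beta> h 2 a = 0" using d2 deriv_A_cw[OF a01, of 2 p \<beta> h] by simp
  note d1 = maximizer_critical(1)[OF a a01] and d3 = maximizer_critical(3)[OF a a01 d2]
  have d4: "dA p \<beta> h 4 a < 0" by (rule degenerate_point(4)[OF a01 \<beta> d2 d3])
  have "\<exists>Amax. cw_laplace (f_cw p \<beta> h) f f' (maximizers p \<beta> h) 2 (\<lambda>a. dA p \<beta> h (2 * 2) a / fact (2 * 2)) Amax L"
  proof (rule cw_laplace_maximizers[OF _ _ _ _ _ f])
    fix x and k :: nat assume x: "x \<in> maximizers p \<beta> h" and "k \<in> {1..<2 * 2}"
    then have "x = a" "k = 1 \<or> k = 2 \<or> k = 3" using M by auto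
    then show "dA p \<beta> h k x = 0" using d1 d2 d3 by auto
  qed (use M d4 nz in auto)
  then obtain Amax where L: "cw_laplace (f_cw p \<beta> h) f f' {a} 2 (\<lambda>a. dA p \<beta> h 4 a / 24) Amax L"
    using M by (auto simp: fact_numeral)
  \<comment> \<open>The iterated derivative agrees with its closed form inside the unit interval,
    and the locale reads the coefficient only at \<open>a\<close>, so the two can be
    exchanged.\<close>
  have "cw_laplace (f_cw p \<beta> h) f f' {a} 2 (\<lambda>a. (deriv ^^ 4) (A_cw p \<beta> h) a / 24) Amax L"
  proof -
    interpret cw_laplace "f_cw p \<beta> h" f f' "{a}" 2 "\<lambda>a. dA p \<beta> h 4 a / 24" Amax L by (rule L)
    have eq: "(deriv ^^ 4) (A_cw p \<beta> h) a = dA p \<beta> h 4 a" by (rule deriv_A_cw[OF a01])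
    show ?thesis
      by unfold_locales
        (use cont_A M_interior A_max A_less c_neg expansion f'_nonzero f in \<open>auto simp: eq\<close>)
  qed
  then show ?thesis by blast
qed

text \<open>In \<open>R3\<close> the limiting event is that the slope of the statistic times
  \<open>Y(0)\<close> is at most the slope times \<open>E Y(t)\<close>, so a negative slope reverses
  the inequality; for \<open>f_beta\<close> this occurs when \<open>p\<close> is even and
  \<open>a < 1 / 2\<close>. A zero slope there means \<open>p = 2\<close>, \<open>a = 1 / 2\<close>
  and \<open>h = 0\<close>, where \<open>f_beta\<close> responds only to second order, and no limit
  is asserted for its estimator.\<close>

theorem theorem5p2:
  fixes p :: nat and \<beta> h :: real
  assumes "p \<ge> 1"
  shows
    "((\<beta>, h) \<in> R1 p \<longrightarrow>
        (\<exists>\<sigma>>0. weak_conv_m (err_h p \<beta> h (1/2)) (normal_law \<sigma>))) \<and>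
     ((\<beta>, h) \<in> R1 p - {(b, 0) | b. b \<le> beta_tilde p} \<longrightarrow>
        (\<exists>\<sigma>>0. weak_conv_m (err_beta p \<beta> h (1/2)) (normal_law \<sigma>))) \<and>
     ((\<beta>, h) \<in> R2 p \<longrightarrow>
        (\<exists>pm>0. \<exists>pp>0. \<exists>\<sigma>m>0. \<exists>\<sigma>p>0. pm + pp \<le> 1 \<and>
           weak_conv_m (err_h p \<beta> h (1/2)) (half_normal_mixture pm \<sigma>m pp \<sigma>p))) \<and>
     ((\<beta>, h) \<in> R2 p - {(beta_tilde p, 0)} \<longrightarrow>
        (\<exists>pm>0. \<exists>pp>0. \<exists>\<sigma>m>0. \<exists>\<sigma>p>0. pm + pp \<le> 1 \<and>
           weak_conv_m (err_beta p \<beta> h (1/2)) (half_normal_mixture pm \<sigma>m pp \<sigma>p))) \<and>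
     ((\<beta>, h) \<in> R3 p \<longrightarrow>
        (\<forall>a \<in> maximizers p \<beta> h.
           let c = (deriv ^^ 4) (A_cw p \<beta> h) a / 24; dh = deriv f_h a; db = deriv (f_beta p) a in
           (\<exists>Z. real_distribution Z \<and>
              (\<forall>t. cdf Z t = measure (quartic_law c dh 0) {y. y \<le> quartic_mean c dh t}) \<and>
              weak_conv_m (err_h p \<beta> h (3/4)) Z) \<and>
           (db > 0 \<longrightarrow> (\<exists>Z. real_distribution Z \<and>
              (\<forall>t. cdf Z t = measure (quartic_law c db 0) {y. y \<le> quartic_mean c db t}) \<and>
              weak_conv_m (err_beta p \<beta> h (3/4)) Z)) \<and>
           (db < 0 \<longrightarrow> (\<exists>Z. real_distribution Z \<and>
              (\<forall>t. cdf Z t = measure (quartic_law c db 0) {y. y \<ge> quartic_mean c db t}) \<and>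
              weak_conv_m (err_beta p \<beta> h (3/4)) Z))))"
proof (intro conjI impI ballI)
  have ex_R1_h: "\<exists>a c Amax. cw_laplace (f_cw p \<beta> h) f_h (\<lambda>_. 2) {a} 1 c Amax 2" if "(\<beta>, h) \<in> R1 p"
    by (rule R1_laplace[OF that f_h_deriv]) (use f_h_lipschitz in auto)
  have ex_R2_h: "\<exists>Amax. cw_laplace (f_cw p \<beta> h) f_h (\<lambda>_. 2) (maximizers p \<beta> h) 1 (\<lambda>a. dA p \<beta> h 2 a / 2) Amax 2"
    if "(\<beta>, h) \<in> R2 p"
    by (rule R2_laplace[OF that f_h_deriv]) (use f_h_lipschitz in auto)
  have ex_R3_h: "\<exists>Amax. cw_laplace (f_cw p \<beta> h) f_h (\<lambda>_. 2) {a} 2 (\<lambda>a. (deriv ^^ 4) (A_cw p \<beta> h) a / 24) Amax 2"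
    if "(\<beta>, h) \<in> R3 p" "a \<in> maximizers p \<beta> h" for a
    by (rule R3_laplace[OF that f_h_deriv]) (use f_h_lipschitz in auto)
  {
    assume R1: "(\<beta>, h) \<in> R1 p"
    obtain a c Amax where "cw_laplace (f_cw p \<beta> h) f_h (\<lambda>_. 2) {a} 1 c Amax 2"
      using ex_R1_h[OF R1] by blast
    then interpret cw_laplace "f_cw p \<beta> h" f_h "\<lambda>_. 2" "{a}" 1 c Amax 2 .
    show "\<exists>\<sigma>>0. weak_conv_m (err_h p \<beta> h (1/2)) (normal_law \<sigma>)"
      by (rule normal_limit[OF refl f_cw_split_h refl cdf_err_h])
  next
    assume R1: "(\<beta>, h) \<in> R1 p - {(b, 0) | b. b \<le> beta_tilde p}"
    then have \<beta>: "\<beta> > 0" and R1': "(\<beta>, h) \<in> R1 p" by (auto simp: R1_def)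
    have nz: "f_beta' p a \<noteq> 0" if "a \<in> maximizers p \<beta> h" for a
      using stationary_f_beta(3,5)[OF assms \<beta> that] R1 by blast
    have R1X: "\<exists>a c Amax. cw_laplace (f_cw p \<beta> h) (f_beta p) (f_beta' p) {a} 1 c Amax (2 * real p)"
      by (rule R1_laplace[OF R1']) (use f_beta_deriv f_beta'_cont f_beta_lipschitz nz in auto)
    obtain a c Amax where "cw_laplace (f_cw p \<beta> h) (f_beta p) (f_beta' p) {a} 1 c Amax (2 * real p)"
      using R1X by blast
    then interpret cw_laplace "f_cw p \<beta> h" "f_beta p" "f_beta' p" "{a}" 1 c Amax "2 * real p" .
    show "\<exists>\<sigma>>0. weak_conv_m (err_beta p \<beta> h (1/2)) (normal_law \<sigma>)"
      by (rule normal_limit[OF refl f_cw_split_beta refl cdf_err_beta])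
  next
    assume R2: "(\<beta>, h) \<in> R2 p"
    obtain Amax where "cw_laplace (f_cw p \<beta> h) f_h (\<lambda>_. 2) (maximizers p \<beta> h) 1 (\<lambda>a. dA p \<beta> h 2 a / 2) Amax 2"
      using ex_R2_h[OF R2] by blast
    then interpret cw_laplace "f_cw p \<beta> h" f_h "\<lambda>_. 2" "maximizers p \<beta> h" 1 "\<lambda>a. dA p \<beta> h 2 a / 2" Amax 2 .
    \<comment> \<open>\<open>f_h\<close> is injective, so each group is a single maximizer and the
      condition of equal \<open>V\<close> is trivial.\<close>
    show "\<exists>pm>0. \<exists>pp>0. \<exists>\<sigma>m>0. \<exists>\<sigma>p>0. pm + pp \<le> 1 \<and>
           weak_conv_m (err_h p \<beta> h (1/2)) (half_normal_mixture pm \<sigma>m pp \<sigma>p)"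
      by (rule mixture_limit[OF refl f_cw_split_h _ cdf_err_h]) (simp add: f_h_def)
  next
    assume R2: "(\<beta>, h) \<in> R2 p - {(beta_tilde p, 0)}"
    then obtain a1 a2 where \<beta>: "\<beta> > 0" and R2': "(\<beta>, h) \<in> R2 p"
      and a12: "a1 \<in> maximizers p \<beta> h" "a2 \<in> maximizers p \<beta> h" "a1 \<noteq> a2" by (auto simp: R2_def)
    have nz: "f_beta' p a \<noteq> 0" if a: "a \<in> maximizers p \<beta> h" for a
    proof
      assume f': "f_beta' p a = 0"
      obtain b where "b \<in> maximizers p \<beta> h" "b \<noteq> a" using a12 by metis
      then show False using stationary_f_beta_R2[OF assms \<beta> a f'] R2 by auto
    qed
    have R2X: "\<exists>Amax. cw_laplace (f_cw p \<beta> h) (f_beta p) (f_beta' p) (maximizers p \<beta> h) 1 (\<lambda>a. dA p \<beta> h 2 a / 2) Amax (2 * real p)"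
      by (rule R2_laplace[OF R2']) (use f_beta_deriv f_beta'_cont f_beta_lipschitz nz in auto)
    obtain Amax where "cw_laplace (f_cw p \<beta> h) (f_beta p) (f_beta' p) (maximizers p \<beta> h) 1 (\<lambda>a. dA p \<beta> h 2 a / 2) Amax (2 * real p)"
      using R2X by blast
    then interpret cw_laplace "f_cw p \<beta> h" "f_beta p" "f_beta' p" "maximizers p \<beta> h" 1 "\<lambda>a. dA p \<beta> h 2 a / 2" Amax "2 * real p" .
    show "\<exists>pm>0. \<exists>pp>0. \<exists>\<sigma>m>0. \<exists>\<sigma>p>0. pm + pp \<le> 1 \<and>
           weak_conv_m (err_beta p \<beta> h (1/2)) (half_normal_mixture pm \<sigma>m pp \<sigma>p)"
    proof (rule mixture_limit[OF refl f_cw_split_beta _ cdf_err_beta])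
      fix x y assume "x \<in> maximizers p \<beta> h" "y \<in> maximizers p \<beta> h" "f_beta p x = f_beta p y"
      from equal_f_beta[OF assms this]
      show "(f_beta' p x)\<^sup>2 / (- 2 * (dA p \<beta> h 2 x / 2)) = (f_beta' p y)\<^sup>2 / (- 2 * (dA p \<beta> h 2 y / 2))"
        by simp
    qed
  next
    fix a assume R3: "(\<beta>, h) \<in> R3 p" and a: "a \<in> maximizers p \<beta> h"
    define c where "c = (deriv ^^ 4) (A_cw p \<beta> h) a / 24"
    have dh: "deriv f_h a = 2" by (rule DERIV_imp_deriv[OF f_h_deriv])
    have db: "deriv (f_beta p) a = f_beta' p a" by (rule DERIV_imp_deriv[OF f_beta_deriv])
    obtain Amax where "cw_laplace (f_cw p \<beta> h) f_h (\<lambda>_. 2) {a} 2 (\<lambda>a. (deriv ^^ 4) (A_cw p \<beta> h) a / 24) Amax 2"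
      using ex_R3_h[OF R3 a] by blast
    then interpret H: cw_laplace "f_cw p \<beta> h" f_h "\<lambda>_. 2" "{a}" 2 "\<lambda>a. (deriv ^^ 4) (A_cw p \<beta> h) a / 24" Amax 2 .
    have h: "\<exists>Z. real_distribution Z \<and>
              (\<forall>t. cdf Z t = measure (quartic_law c 2 0) {y. y \<le> quartic_mean c 2 t}) \<and>
              weak_conv_m (err_h p \<beta> h (3/4)) Z"
      using H.quartic_limit[OF refl f_cw_split_h refl cdf_err_h] by (simp add: c_def)
    have b: "\<exists>Z. real_distribution Z \<and>
              (\<forall>t. cdf Z t = measure (quartic_law c (f_beta' p a) 0)
                {y. f_beta' p a * y \<le> f_beta' p a * quartic_mean c (f_beta' p a) t}) \<and>
              weak_conv_m (err_beta p \<beta> h (3/4)) Z" if nz: "f_beta' p a \<noteq> 0"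
    proof -
      have R3X: "\<exists>Amax. cw_laplace (f_cw p \<beta> h) (f_beta p) (f_beta' p) {a} 2 (\<lambda>a. (deriv ^^ 4) (A_cw p \<beta> h) a / 24) Amax (2 * real p)"
        by (rule R3_laplace[OF R3 a]) (use f_beta_deriv f_beta'_cont f_beta_lipschitz nz in auto)
      obtain Amax' where "cw_laplace (f_cw p \<beta> h) (f_beta p) (f_beta' p) {a} 2 (\<lambda>a. (deriv ^^ 4) (A_cw p \<beta> h) a / 24) Amax' (2 * real p)"
        using R3X by blast
      then interpret B: cw_laplace "f_cw p \<beta> h" "f_beta p" "f_beta' p" "{a}" 2 "\<lambda>a. (deriv ^^ 4) (A_cw p \<beta> h) a / 24" Amax' "2 * real p" .
      show ?thesis
        using B.quartic_limit[OF refl f_cw_split_beta refl cdf_err_beta] by (simp add: c_def)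
    qed
    show "let c = (deriv ^^ 4) (A_cw p \<beta> h) a / 24; dh = deriv f_h a; db = deriv (f_beta p) a in
           (\<exists>Z. real_distribution Z \<and>
              (\<forall>t. cdf Z t = measure (quartic_law c dh 0) {y. y \<le> quartic_mean c dh t}) \<and>
              weak_conv_m (err_h p \<beta> h (3/4)) Z) \<and>
           (db > 0 \<longrightarrow> (\<exists>Z. real_distribution Z \<and>
              (\<forall>t. cdf Z t = measure (quartic_law c db 0) {y. y \<le> quartic_mean c db t}) \<and>
              weak_conv_m (err_beta p \<beta> h (3/4)) Z)) \<and>
           (db < 0 \<longrightarrow> (\<exists>Z. real_distribution Z \<and>
              (\<forall>t. cdf Z t = measure (quartic_law c db 0) {y. y \<ge> quartic_mean c db t}) \<and>
              weak_conv_m (err_beta p \<beta> h (3/4)) Z))"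
      unfolding Let_def c_def [symmetric] dh db
    proof (intro conjI impI h)
      assume pos: "0 < f_beta' p a"
      then show "\<exists>Z. real_distribution Z \<and>
              (\<forall>t. cdf Z t = measure (quartic_law c (f_beta' p a) 0) {y. y \<le> quartic_mean c (f_beta' p a) t}) \<and>
              weak_conv_m (err_beta p \<beta> h (3/4)) Z"
        using b by (simp add: mult_le_cancel_left_pos)
    next
      assume neg: "f_beta' p a < 0"
      then show "\<exists>Z. real_distribution Z \<and>
              (\<forall>t. cdf Z t = measure (quartic_law c (f_beta' p a) 0) {y. y \<ge> quartic_mean c (f_beta' p a) t}) \<and>
              weak_conv_m (err_beta p \<beta> h (3/4)) Z"
        using b by (simp add: mult_le_cancel_left_neg)
    qed
  }
qed

end
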